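(* Let $\ell_0>4\pi$, let $\Phi_0\in H^m_\sharp$ with $m$ sufficiently large, and let $\Phi$ be the $\ell_0$-periodic solution of $$\Phi_\tau+4\Phi_{\eta\eta\eta\eta}+\Phi_{\eta\eta}+\tfrac12(\Phi_\eta)^2=0,\qquad\Phi(0)=\Phi_0 .$$ Set $\Psi=\Phi_\eta$. For every $T>0$ there exists $\varepsilon_0(T)>0$ such that, for every $0<\varepsilon\le\varepsilon_0(T)$, the equation $$\partial_\tau\big(B_\varepsilon\zeta\big)+H_\varepsilon(\Psi_\tau)=S\zeta+M_\varepsilon\big((\Psi^2)_\eta\big)+\varepsilon F_\varepsilon\big((\zeta^2)_\eta\big)+2F_\varepsilon\big((\Psi\zeta)_\eta\big)$$ has a unique classical ($\ell_0$-periodic in $\eta$) solution $\zeta$ on $[0,T]$ with $\zeta(0,\cdot)=0$.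
   Context: Functions are $\ell_0$-periodic on $[-\ell_0/2,\ell_0/2]$, and $D=D_\eta$. $\{w_k\}$ is the orthonormal eigenbasis of $D_{\eta\eta}$ with periodic boundary conditions, $D_{\eta\eta}w_k=-\lambda_kw_k$, $\lambda_0=0$, $\lambda_{2j-1}=\lambda_{2j}=4\pi^2j^2/\ell_0^2$. $H^s_\sharp$ is the periodic Sobolev space. An operator with symbol $(c_k)$ acts by $\widehat{(\mathscr Cf)}(k)=c_k\widehat f(k)$. With $X_{\varepsilon,k}=\sqrt{1+4\varepsilon\lambda_k}$, the operators $B_\varepsilon,F_\varepsilon,H_\varepsilon,M_\varepsilon$ have the symbols $$b_{\varepsilon,k}=X_{\varepsilon,k}^2+(1+\varepsilon)X_{\varepsilon,k}-1-\varepsilon,\qquad f_{\varepsilon,k}=\tfrac14(X_{\varepsilon,k}^3-3X_{\varepsilon,k}^2-4(1+\varepsilon)X_{\varepsilon,k}+4+4\varepsilon),$$ $$h_{\varepsilon,k}=\tfrac1\varepsilon(X_{\varepsilon,k}^2+(1+\varepsilon)X_{\varepsilon,k}-2-\varepsilon),\qquad m_{\varepsilon,k}=\tfrac1{4\varepsilon}(X_{\varepsilon,k}^3-3X_{\varepsilon,k}^2-4(1+\varepsilon)X_{\varepsilon,k}+6+4\varepsilon),$$ and $S=-4D^4-D^2$. A classical solution is one for which $\zeta$, $\zeta_\tau$ and all $\eta$-derivatives appearing in the equation are continuous on $[0,T]\times[-\ell_0/2,\ell_0/2]$. *)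

theory Defs
  imports "HOL-Analysis.Analysis"
begin

text \<open>Eigenvalues of D_{\eta\eta} with periodic b.c. on [-l/2,l/2]:
  lambda_0 = 0, lambda_{2j-1} = lambda_{2j} = 4 pi^2 j^2 / l^2.\<close>
definition lam :: "real \<Rightarrow> nat \<Rightarrow> real" where
  "lam l k = (2 * pi * real ((k + 1) div 2))^2 / l^2"

text \<open>Orthonormal eigenbasis w_k of D_{\eta\eta} on [-l/2,l/2] (periodic).\<close>
definition wk :: "real \<Rightarrow> nat \<Rightarrow> real \<Rightarrow> real" where
  "wk l k x = (if k = 0 then 1 / sqrt l
     else if odd k then sqrt (2 / l) * cos (2 * pi * real ((k + 1) div 2) * x / l)
     else sqrt (2 / l) * sin (2 * pi * real ((k + 1) div 2) * x / l))"

definition fcoef :: "real \<Rightarrow> (real \<Rightarrow> real) \<Rightarrow> nat \<Rightarrow> real" where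
  "fcoef l f k = integral {-l/2..l/2} (\<lambda>x. f x * wk l k x)"

definition symop :: "real \<Rightarrow> (nat \<Rightarrow> real) \<Rightarrow> (real \<Rightarrow> real) \<Rightarrow> real \<Rightarrow> real" where
  "symop l c f x = (\<Sum>k. c k * fcoef l f k * wk l k x)"

definition symop_ok :: "real \<Rightarrow> (nat \<Rightarrow> real) \<Rightarrow> (real \<Rightarrow> real) \<Rightarrow> bool" where
  "symop_ok l c f \<longleftrightarrow> (\<forall>x. summable (\<lambda>k. c k * fcoef l f k * wk l k x))"

definition periodic :: "real \<Rightarrow> (real \<Rightarrow> real) \<Rightarrow> bool" where
  "periodic l f \<longleftrightarrow> (\<forall>x. f (x + l) = f x)"

definition Hsharp :: "real \<Rightarrow> nat \<Rightarrow> (real \<Rightarrow> real) \<Rightarrow> bool" where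
  "Hsharp l s f \<longleftrightarrow> periodic l f \<and> f measurable_on {-l/2..l/2}
     \<and> (\<lambda>x. (f x)^2) integrable_on {-l/2..l/2}
     \<and> summable (\<lambda>k. (1 + lam l k) ^ s * (fcoef l f k)^2)"

definition Xe :: "real \<Rightarrow> real \<Rightarrow> nat \<Rightarrow> real" where
  "Xe l \<epsilon> k = sqrt (1 + 4 * \<epsilon> * lam l k)"

definition bsym :: "real \<Rightarrow> real \<Rightarrow> nat \<Rightarrow> real" where
  "bsym l \<epsilon> k = (Xe l \<epsilon> k)^2 + (1 + \<epsilon>) * Xe l \<epsilon> k - 1 - \<epsilon>"

definition fsym :: "real \<Rightarrow> real \<Rightarrow> nat \<Rightarrow> real" where
  "fsym l \<epsilon> k = ((Xe l \<epsilon> k)^3 - 3 * (Xe l \<epsilon> k)^2 - 4 * (1 + \<epsilon>) * Xe l \<epsilon> k + 4 + 4 * \<epsilon>) / 4"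

definition hsym :: "real \<Rightarrow> real \<Rightarrow> nat \<Rightarrow> real" where
  "hsym l \<epsilon> k = ((Xe l \<epsilon> k)^2 + (1 + \<epsilon>) * Xe l \<epsilon> k - 2 - \<epsilon>) / \<epsilon>"

definition msym :: "real \<Rightarrow> real \<Rightarrow> nat \<Rightarrow> real" where
  "msym l \<epsilon> k = ((Xe l \<epsilon> k)^3 - 3 * (Xe l \<epsilon> k)^2 - 4 * (1 + \<epsilon>) * Xe l \<epsilon> k + 6 + 4 * \<epsilon>) / (4 * \<epsilon>)"

definition pd :: "nat \<Rightarrow> (real \<Rightarrow> real) \<Rightarrow> real \<Rightarrow> real" where
  "pd k f = (deriv ^^ k) f"

definition creg :: "real set \<Rightarrow> nat \<Rightarrow> (real \<Rightarrow> real \<Rightarrow> real) \<Rightarrow> bool" where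
  "creg I n u \<longleftrightarrow>
     (\<forall>\<tau>\<in>I. \<forall>k<n. \<forall>x. pd k (u \<tau>) differentiable (at x))
   \<and> (\<forall>k\<le>n. continuous_on (I \<times> UNIV) (\<lambda>p. pd k (u (fst p)) (snd p)))"

definition time_deriv :: "real set \<Rightarrow> (real \<Rightarrow> real \<Rightarrow> real) \<Rightarrow> (real \<Rightarrow> real \<Rightarrow> real) \<Rightarrow> bool" where
  "time_deriv I u ut \<longleftrightarrow>
     (\<forall>\<tau>\<in>I. \<forall>x. ((\<lambda>s. u s x) has_real_derivative ut \<tau> x) (at \<tau> within I))
   \<and> continuous_on (I \<times> UNIV) (\<lambda>p. ut (fst p) (snd p))"

definition ks_solution :: "real \<Rightarrow> (real \<Rightarrow> real) \<Rightarrow> (real \<Rightarrow> real \<Rightarrow> real) \<Rightarrow> bool" where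
  "ks_solution l Phi0 Phi \<longleftrightarrow>
     (\<forall>\<tau>\<ge>0. periodic l (Phi \<tau>)) \<and> Phi 0 = Phi0 \<and> creg {0..} 4 Phi
   \<and> (\<exists>Phit. time_deriv {0..} Phi Phit \<and>
        (\<forall>\<tau>\<ge>0. \<forall>x. Phit \<tau> x + 4 * pd 4 (Phi \<tau>) x + pd 2 (Phi \<tau>) x
                       + (pd 1 (Phi \<tau>) x)^2 / 2 = 0))"

definition zeta_solution :: "real \<Rightarrow> real \<Rightarrow> real \<Rightarrow> (real \<Rightarrow> real \<Rightarrow> real)
    \<Rightarrow> (real \<Rightarrow> real \<Rightarrow> real) \<Rightarrow> (real \<Rightarrow> real \<Rightarrow> real) \<Rightarrow> bool" where
  "zeta_solution l \<epsilon> T Psi Psit z \<longleftrightarrow>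
     (\<forall>\<tau>\<in>{0..T}. periodic l (z \<tau>)) \<and> (\<forall>x. z 0 x = 0) \<and> creg {0..T} 4 z
   \<and> (\<exists>zt. time_deriv {0..T} z zt)
   \<and> (\<forall>\<tau>\<in>{0..T}.
        symop_ok l (bsym l \<epsilon>) (z \<tau>) \<and> symop_ok l (hsym l \<epsilon>) (Psit \<tau>)
      \<and> symop_ok l (msym l \<epsilon>) (pd 1 (\<lambda>x. (Psi \<tau> x)^2))
      \<and> symop_ok l (fsym l \<epsilon>) (pd 1 (\<lambda>x. (z \<tau> x)^2))
      \<and> symop_ok l (fsym l \<epsilon>) (pd 1 (\<lambda>x. Psi \<tau> x * z \<tau> x))
      \<and> (\<forall>x. \<exists>d. ((\<lambda>s. symop l (bsym l \<epsilon>) (z s) x) has_real_derivative d) (at \<tau> within {0..T})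
             \<and> d + symop l (hsym l \<epsilon>) (Psit \<tau>) x
               = - 4 * pd 4 (z \<tau>) x - pd 2 (z \<tau>) x
                 + symop l (msym l \<epsilon>) (pd 1 (\<lambda>y. (Psi \<tau> y)^2)) x
                 + \<epsilon> * symop l (fsym l \<epsilon>) (pd 1 (\<lambda>y. (z \<tau> y)^2)) x
                 + 2 * symop l (fsym l \<epsilon>) (pd 1 (\<lambda>y. Psi \<tau> y * z \<tau> y)) x))"

end

theory Submission
  imports Defs
begin

text \<open>
  On the Fourier side the equation for \<open>\<zeta>\<close> is a family of scalar linear equations with damping rate
  \<open>\<mu>\<^sub>k = (4 \<lambda>\<^sub>k\<^sup>2 - \<lambda>\<^sub>k) / b\<^sub>k\<close>, coupled through terms of size \<open>(|f\<^sub>k| / b\<^sub>k) \<lambda>\<^sub>k\<^sup>1\<^sup>/\<^sup>2\<close>. The nonlinearity has the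
  same order as the damping, but for every \<open>\<delta> > 0\<close> one has
  \<open>(|f\<^sub>k| / b\<^sub>k) \<lambda>\<^sub>k\<^sup>1\<^sup>/\<^sup>2 \<le> \<delta> (\<mu>\<^sub>k + \<gamma>)\<close> for all \<open>k\<close> and all small \<open>\<epsilon>\<close>, with \<open>\<gamma>\<close> depending on \<open>\<delta>\<close> only:
  low frequencies are absorbed by the time weight \<open>e\<^sup>\<gamma>\<^sup>t\<close>, high ones because the quotient by \<open>\<mu>\<^sub>k\<close> is
  of order \<open>\<epsilon>\<^sup>3\<^sup>/\<^sup>2\<close>. Since sequences decaying like a power at least 2 of the frequency form a convolution
  algebra, Duhamel's formula defines a contraction on such sequences, uniformly in \<open>\<epsilon>\<close> on \<open>[0, T]\<close>; the
  factor \<open>\<epsilon>\<close> in front of the quadratic term compensates the growth \<open>e\<^sup>\<gamma>\<^sup>T\<close>.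

  The forcing is smooth because the same scalar estimate for the Kuramoto-Sivashinsky equation improves
  the decay of the coefficients of \<open>\<Phi>\<close> by three powers per step, starting from \<open>\<Phi>\<close> being four times
  continuously differentiable.

  For uniqueness the coefficients of an arbitrary classical solution have to satisfy the scalar equations
  too. There \<open>F\<^sub>\<epsilon>((\<zeta>\<^sup>2)\<^sub>\<eta>)\<close> is only square integrable and its Fourier series only converges pointwise, so
  the time derivative is averaged against the basis by Fatou's lemma and Fubini's theorem.
\<close>

section \<open>The periodic eigenbasis\<close>

text \<open>The decay exponents are dictated backwards. A series needs order 2 to converge
  uniformly, so four \<open>\<eta>\<close>-derivatives of \<open>\<zeta>\<close> need order 6, and
  so does the forcing. There \<open>H\<close> costs two powers, which asks for order 8 of the time
  derivative of \<open>\<Psi>\<close>; \<open>M\<close> composed with the derivative costs four,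
  which order 12 of \<open>\<Psi>\<close> covers. Both follow from order 13 of
  \<open>\<Phi>\<close>, hence from 13 Sobolev derivatives of the initial value. Uniqueness works in
  order 2, where the distance of two functions is controlled by their values and second derivatives
  alone.

  The choice of constants looks circular: the smallness of \<open>\<epsilon>\<close> depends on the
  size of the solution, and that size grows like \<open>exp (\<gamma> * T)\<close>. The order of the
  choices resolves this. The bound \<open>P\<close> of \<open>\<Psi>\<close> on
  \<open>[0, T]\<close> fixes \<open>\<delta>\<close> and \<open>\<gamma>\<close>, these fix the
  bound \<open>Y\<close> of the solution, and \<open>\<epsilon>\<close> comes last. The quadratic
  term does not disturb this order, since it enters only through
  \<open>\<epsilon> * Y \<le> 1\<close>.\<close>

definition jk :: "nat \<Rightarrow> nat" where "jk k = (k + 1) div 2"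

definition freq :: "real \<Rightarrow> nat \<Rightarrow> real" where "freq l k = 2 * pi / l * real (jk k)"

text \<open>The phase turns every basis function into a cosine, so that differentiation is a shift by \<open>pi / 2\<close>.\<close>

definition phase :: "nat \<Rightarrow> real" where "phase k = (if k = 0 \<or> odd k then 0 else - (pi / 2))"

definition amp :: "real \<Rightarrow> nat \<Rightarrow> real" where "amp l k = (if k = 0 then 1 / sqrt l else sqrt (2 / l))"

text \<open>The \<open>r\<close>-th derivative of \<open>wk l k\<close> in closed form. The
  convention \<open>0 ^ 0 = 1\<close> lets the constant mode, of frequency 0, fit the same
  formula.\<close>

definition wkd :: "real \<Rightarrow> nat \<Rightarrow> nat \<Rightarrow> real \<Rightarrow> real" where
  "wkd l r k x = amp l k * freq l k ^ r * cos (freq l k * x + phase k + real r * (pi / 2))"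

text \<open>Decay of order \<open>p\<close> is always expressed as a constant times
  \<open>wt k ^ p\<close>. The shift by 1 admits the constant mode and keeps the weight at most 1,
  so that higher orders imply lower ones.\<close>

definition wt :: "nat \<Rightarrow> real" where "wt k = 1 / (1 + real (jk k))"

text \<open>The termwise \<open>r\<close>-th derivative of a Fourier series; \<open>pd_ser\<close>
  states the decay under which it is the true derivative.\<close>

definition ser :: "real \<Rightarrow> (nat \<Rightarrow> real) \<Rightarrow> nat \<Rightarrow> real \<Rightarrow> real" where
  "ser l y r x = (\<Sum>k. y k * wkd l r k x)"

section \<open>Weights and single basis functions\<close>

lemma jk_0 [simp]: "jk 0 = 0"
  by (simp add: jk_def)

lemma wt_pos [simp]: "0 < wt k" and wt_le_1 [simp]: "wt k \<le> 1" and wt_nonneg [simp]: "0 \<le> wt k"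
  by (auto simp: wt_def field_simps add_pos_nonneg)

lemma wt_power_antimono: "p \<le> q \<Longrightarrow> wt k ^ q \<le> wt k ^ p"
  by (rule power_decreasing) auto

text \<open>Decay hypotheses carry no sign condition on their constant; it is recovered from the
  bound itself.\<close>

lemma decay_bound_nonneg:
  assumes "\<bar>y\<bar> \<le> K * wt k ^ p"
  shows "0 \<le> K"
  by (rule ccontr) (use order_trans[OF abs_ge_zero assms] mult_neg_pos[of K "wt k ^ p"] in auto)

lemma decay_mono:
  assumes "\<bar>y\<bar> \<le> K * wt k ^ q" "p \<le> q"
  shows "\<bar>y\<bar> \<le> K * wt k ^ p"
  by (rule order_trans[OF assms(1)])
    (intro mult_left_mono wt_power_antimono assms(2) decay_bound_nonneg[OF assms(1)])

lemma wt_power_le_1 [simp]: "wt k ^ p \<le> 1"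
  by (simp add: power_le_one)

lemma summable_wt_power:
  assumes "2 \<le> p"
  shows "summable (\<lambda>k. wt k ^ p)"
proof (rule summable_comparison_test_ev)
  \<comment> \<open>The 4 is the square of the factor 2 in the bound of \<open>wt k\<close> below,
    lost because two indices share a harmonic.\<close>
  show "summable (\<lambda>k. 4 * inverse (real (Suc k) ^ 2))"
    by (intro summable_mult) (subst summable_Suc_iff, rule inverse_power_summable, simp)
  have "wt k ^ p \<le> 4 * inverse (real (Suc k) ^ 2)" for k
  proof -
    have "wt k \<le> 2 / real (Suc k)"
      unfolding wt_def jk_def by (simp add: field_simps)
    hence "wt k ^ 2 \<le> (2 / real (Suc k)) ^ 2"
      by (intro power_mono) auto
    moreover have "wt k ^ p \<le> wt k ^ 2"
      by (rule wt_power_antimono[OF assms])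
    ultimately show ?thesis
      by (simp add: power_divide inverse_eq_divide)
  qed
  thus "\<forall>\<^sub>F n in sequentially. norm (wt n ^ p) \<le> 4 * inverse ((real (Suc n))\<^sup>2)"
    by simp
qed

lemma wk_eq: "wk l k x = wkd l 0 k x"
  unfolding wk_def wkd_def amp_def freq_def phase_def
  by (auto simp: cos_diff jk_def mult_ac)

lemma lam_eq: "lam l k = freq l k ^ 2"
  by (simp add: lam_def freq_def jk_def power_mult_distrib power_divide)

lemma wkd_deriv: "(wkd l r k has_real_derivative wkd l (Suc r) k x) (at x within S)"
proof -
  have "cos (freq l k * x + phase k + real (Suc r) * (pi / 2)) = - sin (freq l k * x + phase k + real r * (pi / 2))"
    using cos_add[of "freq l k * x + phase k + real r * (pi / 2)" "pi/2"]
    by (simp add: algebra_simps add_divide_distrib)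
  thus ?thesis
    unfolding wkd_def by (auto intro!: derivative_eq_intros)
qed

lemma wkd_cont [continuous_intros]:
  fixes f :: "'a::t2_space \<Rightarrow> real"
  shows "continuous_on S f \<Longrightarrow> continuous_on S (\<lambda>x. wkd l r k (f x))"
  unfolding wkd_def by (intro continuous_intros)

lemma cos_periodic_nat: "cos (x + 2 * pi * real n) = cos x"
  by (induction n) (auto simp: algebra_simps cos_add sin_add)

lemma wkd_2: "wkd l (Suc (Suc r)) k x = - lam l k * wkd l r k x"
proof -
  have "cos (freq l k * x + phase k + real (Suc (Suc r)) * (pi / 2)) = - cos (freq l k * x + phase k + real r * (pi / 2))"
    using cos_add[of "freq l k * x + phase k + real r * (pi / 2)" "pi"]
    by (simp add: algebra_simps add_divide_distrib)
  thus ?thesis by (simp add: wkd_def lam_eq power2_eq_square)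
qed

text \<open>For a nonzero integer frequency the primitive, a sine, takes the same value at both ends
  of the period.\<close>

lemma int_cos:
  assumes "l > 0"
  shows "integral {-l/2..l/2} (\<lambda>x. cos (2 * pi / l * of_int n * x + c)) = (if n = 0 then l * cos c else 0)"
proof (cases "n = 0")
  case True
  thus ?thesis using assms by simp
next
  case False
  define a where "a = 2 * pi / l * of_int n"
  have a: "a \<noteq> 0" using False assms by (simp add: a_def)
  have "((\<lambda>x. cos (a * x + c)) has_integral (sin (a * (l/2) + c) / a - sin (a * (-l/2) + c) / a)) {-l/2..l/2}"
    using assms a by (intro fundamental_theorem_of_calculus)
      (auto intro!: derivative_eq_intros simp: has_real_derivative_iff_has_vector_derivative[symmetric])
  moreover have "a * (l/2) + c = (a * (-l/2) + c) + of_int n * (2 * pi)"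
    using assms by (simp add: a_def field_simps)
  hence "sin (a * (l/2) + c) = sin (a * (-l/2) + c)"
    using sin.plus_of_int[of "a * (-l/2) + c" n] by (simp add: mult_ac)
  ultimately show ?thesis using False by (simp add: a_def integral_unique)
qed

context
  fixes l :: real
  assumes l_pos: "0 < l"
begin

lemma freq_nonneg [simp]: "0 \<le> freq l k"
  using l_pos by (simp add: freq_def)

lemma lam_nonneg [simp]: "0 \<le> lam l k"
  by (simp add: lam_eq)

lemma freq_wt_le: "freq l k * wt k \<le> 2 * pi / l"
  using l_pos by (simp add: freq_def wt_def divide_simps)

text \<open>The exchange rate used throughout: each frequency factor is paid with one power of the
  weight and costs \<open>2 * pi / l\<close>.\<close>

lemma freq_power_wt: "freq l k ^ r * wt k ^ (r + s) \<le> (2 * pi / l) ^ r * wt k ^ s"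
proof -
  have "freq l k ^ r * wt k ^ (r + s) = (freq l k * wt k) ^ r * wt k ^ s"
    by (simp add: power_add power_mult_distrib)
  also have "\<dots> \<le> (2 * pi / l) ^ r * wt k ^ s"
    by (intro mult_right_mono power_mono freq_wt_le) auto
  finally show ?thesis .
qed

lemma amp_bounds: "0 \<le> amp l k" "amp l k \<le> sqrt (2 / l)"
  using l_pos unfolding amp_def by (auto simp: real_sqrt_divide field_simps)

lemma wkd_bound: "\<bar>wkd l r k x\<bar> \<le> sqrt (2 / l) * freq l k ^ r"
proof -
  have "\<bar>wkd l r k x\<bar> = amp l k * freq l k ^ r * \<bar>cos (freq l k * x + phase k + real r * (pi / 2))\<bar>"
    by (simp add: wkd_def abs_mult amp_bounds)
  also have "\<dots> \<le> amp l k * freq l k ^ r * 1"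
    by (intro mult_left_mono mult_nonneg_nonneg amp_bounds zero_le_power) auto
  also have "\<dots> \<le> sqrt (2 / l) * freq l k ^ r"
    by (simp add: mult_right_mono amp_bounds)
  finally show ?thesis .
qed

lemma wk_bound: "\<bar>wk l k x\<bar> \<le> sqrt (2 / l)"
  using wkd_bound[of 0] by (simp add: wk_eq)

lemma wkd_periodic: "wkd l r k (x + l) = wkd l r k x"
proof -
  have "freq l k * (x + l) + phase k + real r * (pi / 2) = (freq l k * x + phase k + real r * (pi / 2)) + 2 * pi * real (jk k)"
    using l_pos by (simp add: freq_def field_simps)
  thus ?thesis unfolding wkd_def by (simp only: cos_periodic_nat)
qed

text \<open>With the phases, sines and cosines need no separate product formulas. Orthonormality and
  the convolution bound both rest on this splitting into difference and sum of the
  harmonics.\<close>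

lemma wk_product:
  "wk l m x * wk l k x = amp l m * amp l k / 2 *
    (cos (2 * pi / l * of_int (int (jk m) - int (jk k)) * x + (phase m - phase k))
      + cos (2 * pi / l * of_int (int (jk m) + int (jk k)) * x + (phase m + phase k)))"
proof -
  have "cos (freq l m * x + phase m) * cos (freq l k * x + phase k)
      = (cos ((freq l m * x + phase m) - (freq l k * x + phase k)) + cos ((freq l m * x + phase m) + (freq l k * x + phase k))) / 2"
    by (rule cos_times_cos)
  also have "(freq l m * x + phase m) - (freq l k * x + phase k) = 2 * pi / l * of_int (int (jk m) - int (jk k)) * x + (phase m - phase k)"
    by (simp add: freq_def algebra_simps diff_divide_distrib)
  also have "(freq l m * x + phase m) + (freq l k * x + phase k) = 2 * pi / l * of_int (int (jk m) + int (jk k)) * x + (phase m + phase k)"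
    by (simp add: freq_def algebra_simps add_divide_distrib)
  finally show ?thesis unfolding wk_eq wkd_def by simp
qed

lemma wk_orthonormal: "integral {-l/2..l/2} (\<lambda>x. wk l m x * wk l k x) = (if m = k then 1 else 0)"
proof -
  let ?A = "\<lambda>x. cos (2 * pi / l * of_int (int (jk m) - int (jk k)) * x + (phase m - phase k))"
  let ?B = "\<lambda>x. cos (2 * pi / l * of_int (int (jk m) + int (jk k)) * x + (phase m + phase k))"
  have "integral {-l/2..l/2} (\<lambda>x. wk l m x * wk l k x) = integral {-l/2..l/2} (\<lambda>x. amp l m * amp l k / 2 * (?A x + ?B x))"
    by (simp only: wk_product)
  also have "\<dots> = amp l m * amp l k / 2 * integral {-l/2..l/2} (\<lambda>x. ?A x + ?B x)"
    by (rule integral_mult_right)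
  also have "integral {-l/2..l/2} (\<lambda>x. ?A x + ?B x) = integral {-l/2..l/2} ?A + integral {-l/2..l/2} ?B"
    by (intro integral_add integrable_continuous_interval continuous_intros)
  also have "\<dots> = (if jk m = jk k then l * cos (phase m - phase k) else 0) + (if jk m = 0 \<and> jk k = 0 then l * cos (phase m + phase k) else 0)"
    unfolding int_cos[OF l_pos] by auto
  also have "amp l m * amp l k / 2 * \<dots> = (if m = k then 1 else 0)"
  proof (cases "jk m = jk k")
    case True
    show ?thesis
    proof (cases "m = k")
      case True
      thus ?thesis using l_pos by (auto simp: amp_def phase_def jk_def)
    next
      case False
      \<comment> \<open>Two different indices of one harmonic are its cosine and its sine, whose
        phases differ by \<open>pi / 2\<close>.\<close>
      hence "m \<noteq> 0" "k \<noteq> 0" "odd m \<noteq> odd k"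
        using True unfolding jk_def by presburger+
      hence "cos (phase m - phase k) = 0" "jk m \<noteq> 0"
        by (auto simp: phase_def jk_def)
      thus ?thesis using False True by simp
    qed
  qed (auto simp: jk_def)
  finally show ?thesis .
qed

text \<open>Origin of the recurrent exponent \<open>r + 2\<close>: \<open>r\<close> powers pay for
  the derivatives and 2 for summability. The bound is free of \<open>x\<close>, as the Weierstrass
  test requires.\<close>

lemma ser_term_bound:
  assumes "\<And>k. \<bar>y k\<bar> \<le> K * wt k ^ (r + 2)"
  shows "\<bar>y k * wkd l r k x\<bar> \<le> K * sqrt (2 / l) * (2 * pi / l) ^ r * wt k ^ 2"
proof -
  have K: "0 \<le> K" by (rule decay_bound_nonneg[OF assms])
  have "\<bar>y k * wkd l r k x\<bar> \<le> (K * wt k ^ (r + 2)) * (sqrt (2 / l) * freq l k ^ r)"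
    unfolding abs_mult by (intro mult_mono assms wkd_bound) (auto simp: K)
  also have "\<dots> = K * sqrt (2 / l) * (freq l k ^ r * wt k ^ (r + 2))" by simp
  also have "\<dots> \<le> K * sqrt (2 / l) * ((2 * pi / l) ^ r * wt k ^ 2)"
    using K l_pos by (intro mult_left_mono freq_power_wt) auto
  finally show ?thesis by simp
qed

lemma ser_summable:
  assumes "\<And>k. \<bar>y k\<bar> \<le> K * wt k ^ (r + 2)"
  shows "summable (\<lambda>k. y k * wkd l r k x)"
  by (rule summable_comparison_test_ev[OF always_eventually summable_mult[OF summable_wt_power[of 2]]])
     (use ser_term_bound[OF assms] in auto)

lemma ser_uniform_limit:
  assumes "\<And>\<tau> k. \<tau> \<in> I \<Longrightarrow> \<bar>y \<tau> k\<bar> \<le> K * wt k ^ (r + 2)"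
  shows "uniform_limit (I \<times> UNIV) (\<lambda>n p. \<Sum>k<n. y (fst p) k * wkd l r k (snd p)) (\<lambda>p. ser l (y (fst p)) r (snd p)) sequentially"
  unfolding ser_def
  by (rule Weierstrass_m_test[where M = "\<lambda>k. K * sqrt (2 / l) * (2 * pi / l) ^ r * wt k ^ 2"])
     (use ser_term_bound[OF assms] in \<open>auto intro!: summable_mult summable_wt_power\<close>)

lemma ser_uniform_limit1:
  assumes "\<And>k. \<bar>y k\<bar> \<le> K * wt k ^ (r + 2)"
  shows "uniform_limit A (\<lambda>n x. \<Sum>k<n. y k * wkd l r k x) (\<lambda>x. ser l y r x) sequentially"
  unfolding ser_def
  by (rule Weierstrass_m_test[where M = "\<lambda>k. K * sqrt (2 / l) * (2 * pi / l) ^ r * wt k ^ 2"])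
     (use ser_term_bound[OF assms] in \<open>auto intro!: summable_mult summable_wt_power\<close>)

lemma ser_continuous2:
  fixes I :: "real set"
  assumes "\<And>\<tau> k. \<tau> \<in> I \<Longrightarrow> \<bar>y \<tau> k\<bar> \<le> K * wt k ^ (r + 2)"
    and "\<And>k. continuous_on I (\<lambda>\<tau>. y \<tau> k)"
  shows "continuous_on (I \<times> UNIV) (\<lambda>p. ser l (y (fst p)) r (snd p))"
proof (rule uniform_limit_theorem[OF _ ser_uniform_limit[OF assms(1)]])
  show "\<forall>\<^sub>F n in sequentially. continuous_on (I \<times> UNIV) (\<lambda>p. \<Sum>k<n. y (fst p) k * wkd l r k (snd p))"
    by (intro always_eventually allI continuous_intros continuous_on_compose2[OF assms(2)]) auto
qed auto

lemma ser_continuous: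
  assumes "\<And>k. \<bar>y k\<bar> \<le> K * wt k ^ (r + 2)"
  shows "continuous_on A (ser l y r)"
  by (rule uniform_limit_theorem[OF _ ser_uniform_limit1[OF assms]])
     (auto intro!: always_eventually continuous_intros)

lemma ser_periodic: "ser l y r (x + l) = ser l y r x"
  by (simp add: ser_def wkd_periodic)

lemma ser_deriv:
  assumes "\<And>k. \<bar>y k\<bar> \<le> K * wt k ^ (r + 3)"
  shows "(ser l y r has_real_derivative ser l y (Suc r) x) (at x)"
proof -
  have *: "\<bar>y k\<bar> \<le> K * wt k ^ (r + 2)" for k by (rule decay_mono[OF assms]) simp
  obtain g where g: "\<forall>x\<in>UNIV. (\<lambda>k. y k * wkd l r k x) sums g x \<and> (g has_real_derivative ser l y (Suc r) x) (at x)"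
  proof (rule exE[OF has_field_derivative_series])
    show "uniform_limit UNIV (\<lambda>n x. \<Sum>k<n. y k * wkd l (Suc r) k x) (ser l y (Suc r)) sequentially"
      by (rule ser_uniform_limit1[of _ K]) (use assms in \<open>simp add: eval_nat_numeral\<close>)
    show "((\<lambda>x. y k * wkd l r k x) has_real_derivative y k * wkd l (Suc r) k x) (at x)" for k x
      by (intro DERIV_cmult wkd_deriv)
    show "summable (\<lambda>k. y k * wkd l r k 0)" by (rule ser_summable[OF *])
  qed auto
  have "g = ser l y r" using g by (auto simp: ser_def fun_eq_iff sums_iff)
  thus ?thesis using g by auto
qed

lemma pd_ser:
  assumes "\<And>k. \<bar>y k\<bar> \<le> K * wt k ^ (r + 2)"
  shows "pd r (ser l y 0) = ser l y r"
  using assms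
proof (induction r)
  case 0
  thus ?case by (simp add: pd_def)
next
  case (Suc r)
  have "\<bar>y k\<bar> \<le> K * wt k ^ (r + 2)" for k by (rule decay_mono[OF Suc.prems]) simp
  hence "pd r (ser l y 0) = ser l y r" by (rule Suc.IH)
  hence "pd (Suc r) (ser l y 0) = deriv (ser l y r)" by (simp add: pd_def)
  also have "\<dots> = ser l y (Suc r)"
  proof
    fix x
    show "deriv (ser l y r) x = ser l y (Suc r) x"
      by (rule DERIV_imp_deriv, rule ser_deriv[where K = K])
         (use Suc.prems in \<open>simp add: eval_nat_numeral\<close>)
  qed
  finally show ?case .
qed

lemma ser_creg:
  assumes "\<And>\<tau> k. \<tau> \<in> I \<Longrightarrow> \<bar>y \<tau> k\<bar> \<le> K * wt k ^ (n + 2)"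
    and "\<And>k. continuous_on I (\<lambda>\<tau>. y \<tau> k)"
  shows "creg I n (\<lambda>\<tau>. ser l (y \<tau>) 0)"
proof -
  have *: "\<bar>y \<tau> k\<bar> \<le> K * wt k ^ m" if "\<tau> \<in> I" "m \<le> n + 2" for \<tau> k m
    by (rule decay_mono[OF assms(1)[OF that(1)] that(2)])
  have pd: "pd r (ser l (y \<tau>) 0) = ser l (y \<tau>) r" if "\<tau> \<in> I" "r \<le> n" for r \<tau>
    by (rule pd_ser, rule *[OF that(1)]) (use that in simp)
  show ?thesis unfolding creg_def
  proof (intro conjI ballI allI impI)
    fix \<tau> r x assume "\<tau> \<in> I" "r < n"
    thus "pd r (ser l (y \<tau>) 0) differentiable at x"
      using ser_deriv[of "y \<tau>" K r x] *[of \<tau> "r + 3"] pd[of \<tau> r] by (auto simp: real_differentiable_def)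
  next
    fix r assume r: "r \<le> n"
    have "continuous_on (I \<times> UNIV) (\<lambda>p. ser l (y (fst p)) r (snd p))"
    proof (rule ser_continuous2)
      show "\<bar>y \<tau> k\<bar> \<le> K * wt k ^ (r + 2)" if "\<tau> \<in> I" for \<tau> k
        by (rule *[OF that]) (use r in simp)
    qed (rule assms)
    thus "continuous_on (I \<times> UNIV) (\<lambda>p. pd r (ser l (y (fst p)) 0) (snd p))"
      by (rule continuous_on_eq) (use pd r in auto)
  qed
qed

lemma ser_time_deriv:
  assumes "convex I" and "\<tau> \<in> I"
    and "\<And>k \<tau>. \<tau> \<in> I \<Longrightarrow> ((\<lambda>s. y s k) has_real_derivative y' \<tau> k) (at \<tau> within I)"
    and y: "\<And>\<tau> k. \<tau> \<in> I \<Longrightarrow> \<bar>y \<tau> k\<bar> \<le> K * wt k ^ (r + 2)"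
    and y': "\<And>\<tau> k. \<tau> \<in> I \<Longrightarrow> \<bar>y' \<tau> k\<bar> \<le> K' * wt k ^ (r + 2)"
  shows "((\<lambda>s. ser l (y s) r x) has_real_derivative ser l (y' \<tau>) r x) (at \<tau> within I)"
proof -
  obtain g where g: "\<forall>s\<in>I. (\<lambda>k. y s k * wkd l r k x) sums g s \<and> (g has_real_derivative ser l (y' s) r x) (at s within I)"
  proof (rule exE[OF has_field_derivative_series[OF \<open>convex I\<close>]])
    show "uniform_limit I (\<lambda>n s. \<Sum>k<n. y' s k * wkd l r k x) (\<lambda>s. ser l (y' s) r x) sequentially"
      unfolding ser_def
      by (rule Weierstrass_m_test[where M = "\<lambda>k. K' * sqrt (2 / l) * (2 * pi / l) ^ r * wt k ^ 2"])
         (use ser_term_bound[OF y'] in \<open>auto intro!: summable_mult summable_wt_power\<close>)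
    show "((\<lambda>s. y s k * wkd l r k x) has_real_derivative y' s k * wkd l r k x) (at s within I)" if "s \<in> I" for k s
      by (intro DERIV_cmult_right assms that)
    show "summable (\<lambda>k. y \<tau> k * wkd l r k x)" by (rule ser_summable[OF y[OF \<open>\<tau> \<in> I\<close>]])
  qed (use assms in auto)
  have "(g has_real_derivative ser l (y' \<tau>) r x) (at \<tau> within I)" using g assms by auto
  moreover have "g s = ser l (y s) r x" if "s \<in> I" for s
    using g that by (auto simp: ser_def sums_iff)
  ultimately show ?thesis
    using has_field_derivative_transform_within[of g _ \<tau> I 1 "\<lambda>s. ser l (y s) r x"] \<open>\<tau> \<in> I\<close> by auto
qed

text \<open>Uniform convergence allows testing the partial sums against \<open>wk l m\<close>, and
  orthonormality freezes the result once more than \<open>m\<close> terms are present.\<close>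

lemma fcoef_ser:
  assumes "\<And>k. \<bar>y k\<bar> \<le> K * wt k ^ 2"
  shows "fcoef l (ser l y 0) m = y m"
proof -
  let ?J = "{-l/2..l/2}"
  let ?p = "\<lambda>n x. \<Sum>k<n. y k * wkd l 0 k x"
  have "uniform_limit ?J ?p (ser l y 0) sequentially"
    by (rule ser_uniform_limit1[of _ K]) (use assms in \<open>simp add: power2_eq_square\<close>)
  hence "uniform_limit ?J (\<lambda>n x. ?p n x * wk l m x) (\<lambda>x. ser l y 0 x * wk l m x) sequentially"
  proof (rule uniform_lim_mult[OF _ uniform_limit_const])
    show "bounded (ser l y 0 ` ?J)"
      by (intro compact_imp_bounded compact_continuous_image ser_continuous[of _ K]) (use assms in \<open>auto simp: power2_eq_square\<close>)
    show "bounded ((\<lambda>x. wk l m x) ` ?J)"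
      unfolding wk_eq by (intro compact_imp_bounded compact_continuous_image continuous_intros) auto
  qed
  moreover have "continuous_on ?J (\<lambda>x. ?p n x * wk l m x)" for n
    unfolding wk_eq by (intro continuous_intros)
  ultimately obtain I J where IJ: "\<And>n. ((\<lambda>x. ?p n x * wk l m x) has_integral I n) ?J"
    "((\<lambda>x. ser l y 0 x * wk l m x) has_integral J) ?J" "I \<longlonglongrightarrow> J"
    by (rule uniform_limit_integral) auto
  have "I n = y m" if "n > m" for n
  proof -
    have "I n = integral ?J (\<lambda>x. \<Sum>k<n. y k * (wk l k x * wk l m x))"
      using integral_unique[OF IJ(1)] by (simp add: wk_eq sum_distrib_right mult.assoc)
    also have "\<dots> = (\<Sum>k<n. integral ?J (\<lambda>x. y k * (wk l k x * wk l m x)))"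
      unfolding wk_eq by (intro integral_sum integrable_continuous_interval continuous_intros) auto
    also have "\<dots> = (\<Sum>k<n. y k * (if k = m then 1 else 0))"
      by (simp only: integral_mult_right wk_orthonormal)
    also have "\<dots> = y m" using that by (simp add: if_distrib cong: if_cong)
    finally show ?thesis .
  qed
  hence "I \<longlonglongrightarrow> y m"
    by (intro tendsto_eventually) (auto simp: eventually_sequentially intro!: exI[of _ "Suc m"])
  hence "J = y m" using IJ(3) LIMSEQ_unique by blast
  thus ?thesis using IJ(2) by (simp add: fcoef_def integral_unique)
qed

end

section \<open>Periodic smooth functions and their coefficients\<close>

text \<open>\<open>pk\<close> exchanges the sine and the cosine of the same frequency, as differentiation does.\<close>

definition pk :: "nat \<Rightarrow> nat" where "pk k = (if k = 0 then 0 else if odd k then k + 1 else k - 1)"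

text \<open>The sign that accompanies the exchange: minus for cosines, which have odd index, plus
  for sines. The value at 0 is always multiplied by the frequency 0.\<close>

definition sg :: "nat \<Rightarrow> real" where "sg k = (if odd k then - 1 else 1)"

lemma jk_pk [simp]: "jk (pk k) = jk k"
  unfolding pk_def jk_def by (auto elim!: oddE evenE)

lemma freq_pk [simp]: "freq l (pk k) = freq l k" and wt_pk [simp]: "wt (pk k) = wt k"
  by (simp_all add: freq_def wt_def)

lemma pk_pk [simp]: "pk (pk k) = k"
  unfolding pk_def by auto

lemma inj_pk: "inj pk"
  by (rule inj_on_inverseI[of _ pk]) simp

lemma abs_sg [simp]: "\<bar>sg k\<bar> = 1"
  by (simp add: sg_def)

lemma wkd_1: "wkd l (Suc 0) k x = sg k * freq l k * wk l (pk k) x"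
proof (cases "k = 0")
  case True
  thus ?thesis by (simp add: wkd_def freq_def)
next
  case False
  thus ?thesis
    unfolding wk_eq wkd_def freq_pk
    by (auto simp: sg_def pk_def phase_def amp_def cos_add cos_diff sin_diff)
qed

section \<open>Calculus of time-dependent functions with continuous space derivatives\<close>

lemma pd_0 [simp]: "pd 0 f = f"
  by (simp add: pd_def)

lemma pd_Suc: "pd (Suc k) f = pd k (pd (Suc 0) f)"
  unfolding pd_def by (simp add: funpow_swap1)

lemma pd_pd: "pd j (pd k f) = pd (j + k) f"
  by (simp add: pd_def funpow_add)

lemma pd_1: "pd (Suc 0) f = deriv f"
  by (simp add: pd_def)

lemma creg_0: "creg I 0 u \<longleftrightarrow> continuous_on (I \<times> UNIV) (\<lambda>p. u (fst p) (snd p))"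
  by (simp add: creg_def)

lemma creg_mono: "creg I n u \<Longrightarrow> m \<le> n \<Longrightarrow> creg I m u"
  by (auto simp: creg_def)

lemma creg_subset: "creg I n u \<Longrightarrow> I' \<subseteq> I \<Longrightarrow> creg I' n u"
  unfolding creg_def by (blast intro: continuous_on_subset)

text \<open>Peeling off the first derivative makes closure under sums and products an induction on
  the order, without the general Leibniz formula.\<close>

lemma creg_Suc:
  "creg I (Suc n) u \<longleftrightarrow> (\<forall>\<tau>\<in>I. \<forall>x. u \<tau> differentiable (at x))
     \<and> continuous_on (I \<times> UNIV) (\<lambda>p. u (fst p) (snd p)) \<and> creg I n (\<lambda>\<tau>. pd (Suc 0) (u \<tau>))"
proof -
  have *: "(\<forall>k\<le>Suc n. P k) \<longleftrightarrow> P 0 \<and> (\<forall>k\<le>n. P (Suc k))" for P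
    unfolding less_Suc_eq_le[symmetric] All_less_Suc2 ..
  show ?thesis
    unfolding creg_def * All_less_Suc2 pd_0 pd_Suc[symmetric] by blast
qed

lemma creg_cong:
  assumes "\<And>\<tau>. \<tau> \<in> I \<Longrightarrow> u \<tau> = v \<tau>"
  shows "creg I n u \<longleftrightarrow> creg I n v"
proof -
  have "continuous_on (I \<times> UNIV) (\<lambda>p. pd k (u (fst p)) (snd p)) \<longleftrightarrow> continuous_on (I \<times> UNIV) (\<lambda>p. pd k (v (fst p)) (snd p))" for k
    by (rule continuous_on_cong) (use assms in auto)
  thus ?thesis using assms unfolding creg_def by simp
qed

lemma creg_add:
  assumes "creg I n u" "creg I n v"
  shows "creg I n (\<lambda>\<tau> x. u \<tau> x + v \<tau> x)"
  using assms
proof (induction n arbitrary: u v)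
  case 0
  thus ?case by (auto simp: creg_0 intro!: continuous_intros)
next
  case (Suc n)
  have "pd (Suc 0) (\<lambda>x. u \<tau> x + v \<tau> x) = (\<lambda>x. pd (Suc 0) (u \<tau>) x + pd (Suc 0) (v \<tau>) x)" if "\<tau> \<in> I" for \<tau>
    using Suc.prems that unfolding creg_Suc pd_1
    by (intro ext deriv_add) (auto simp: field_differentiable_def real_differentiable_def)
  hence "creg I n (\<lambda>\<tau>. pd (Suc 0) (\<lambda>x. u \<tau> x + v \<tau> x)) = creg I n (\<lambda>\<tau> x. pd (Suc 0) (u \<tau>) x + pd (Suc 0) (v \<tau>) x)"
    by (rule creg_cong)
  with Suc show ?case
    unfolding creg_Suc by (auto intro!: continuous_intros)
qed

lemma creg_mult:
  assumes "creg I n u" "creg I n v"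
  shows "creg I n (\<lambda>\<tau> x. u \<tau> x * v \<tau> x)"
  using assms
proof (induction n arbitrary: u v)
  case 0
  thus ?case by (auto simp: creg_0 intro!: continuous_intros)
next
  case (Suc n)
  have "pd (Suc 0) (\<lambda>x. u \<tau> x * v \<tau> x) = (\<lambda>x. u \<tau> x * pd (Suc 0) (v \<tau>) x + pd (Suc 0) (u \<tau>) x * v \<tau> x)" if "\<tau> \<in> I" for \<tau>
    using Suc.prems that unfolding creg_Suc pd_1
    by (intro ext deriv_mult) (auto simp: field_differentiable_def real_differentiable_def)
  hence "creg I n (\<lambda>\<tau>. pd (Suc 0) (\<lambda>x. u \<tau> x * v \<tau> x)) = creg I n (\<lambda>\<tau> x. u \<tau> x * pd (Suc 0) (v \<tau>) x + pd (Suc 0) (u \<tau>) x * v \<tau> x)"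
    by (rule creg_cong)
  moreover have "creg I n (\<lambda>\<tau> x. u \<tau> x * pd (Suc 0) (v \<tau>) x + pd (Suc 0) (u \<tau>) x * v \<tau> x)"
    using Suc.prems creg_mono[of I "Suc n" _ n]
    by (intro creg_add Suc.IH) (auto simp: creg_Suc[of I n])
  ultimately show ?case using Suc.prems
    unfolding creg_Suc by (auto intro!: continuous_intros)
qed

lemma creg_cmult: "creg I n u \<Longrightarrow> creg I n (\<lambda>\<tau> x. c * u \<tau> x)"
proof (rule creg_mult)
  have "pd k (\<lambda>x. c) = (\<lambda>x. if k = 0 then c else 0)" for k
    by (induction k) (auto simp: pd_def)
  thus "creg I n (\<lambda>\<tau> x. c)" by (simp add: creg_def)
qed

text \<open>Periodic functions of class \<open>C^n\<close>. Taking \<open>creg\<close> over the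
  single time 0 reuses the calculus of time-dependent functions.\<close>

definition cper :: "real \<Rightarrow> nat \<Rightarrow> (real \<Rightarrow> real) \<Rightarrow> bool" where
  "cper l n f \<longleftrightarrow> periodic l f \<and> creg {0} n (\<lambda>_. f)"

lemma creg_const_iff:
  assumes "I \<noteq> {}"
  shows "creg I n (\<lambda>_. f) \<longleftrightarrow> (\<forall>k<n. \<forall>x. pd k f differentiable at x) \<and> (\<forall>k\<le>n. continuous_on UNIV (pd k f))"
proof -
  obtain i where "i \<in> I" using assms by auto
  have "continuous_on (I \<times> UNIV) (\<lambda>p. pd k f (snd p)) \<longleftrightarrow> continuous_on UNIV (pd k f)" for k
  proof
    assume "continuous_on (I \<times> UNIV) (\<lambda>p. pd k f (snd p))"
    moreover have "continuous_on UNIV (\<lambda>x::real. (i, x))" by (intro continuous_intros)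
    ultimately show "continuous_on UNIV (pd k f)"
      using \<open>i \<in> I\<close> continuous_on_compose2[of "I \<times> UNIV" "\<lambda>p. pd k f (snd p)" UNIV "\<lambda>x. (i, x)"] by auto
  qed (auto intro!: continuous_on_compose2[of UNIV "pd k f"] continuous_intros)
  thus ?thesis using assms by (auto simp: creg_def)
qed

lemma creg_imp_cper:
  assumes "creg I n u" "\<tau> \<in> I" "periodic l (u \<tau>)"
  shows "cper l n (u \<tau>)"
proof -
  have "continuous_on UNIV (pd k (u \<tau>))" if "k \<le> n" for k
  proof -
    have "continuous_on (I \<times> UNIV) (\<lambda>p. pd k (u (fst p)) (snd p))" using assms that by (auto simp: creg_def)
    moreover have "continuous_on UNIV (\<lambda>x::real. (\<tau>, x))" by (intro continuous_intros)
    ultimately show ?thesis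
      using assms continuous_on_compose2[of "I \<times> UNIV" "\<lambda>p. pd k (u (fst p)) (snd p)" UNIV "\<lambda>x. (\<tau>, x)"] by auto
  qed
  thus ?thesis using assms by (auto simp: cper_def creg_const_iff) (auto simp: creg_def)
qed

lemma cper_Suc_deriv:
  assumes "cper l (Suc n) f"
  shows "(f has_real_derivative pd (Suc 0) f x) (at x)"
  using assms by (auto simp: cper_def creg_Suc pd_1 DERIV_deriv_iff_real_differentiable)

lemma cper_continuous: "cper l n f \<Longrightarrow> continuous_on A f"
  unfolding cper_def creg_const_iff[OF insert_not_empty]
  by (metis continuous_on_subset pd_0 subset_UNIV zero_le)

lemma cper_mono: "cper l n f \<Longrightarrow> m \<le> n \<Longrightarrow> cper l m f"
  by (auto simp: cper_def intro: creg_mono)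

lemma periodic_pd_1:
  assumes "periodic l f" "\<And>x. f differentiable (at x)"
  shows "periodic l (pd (Suc 0) f)"
  unfolding periodic_def pd_1
proof
  fix x
  have "(f has_real_derivative deriv f (x + l)) (at (x + l))"
    using assms by (simp add: DERIV_deriv_iff_real_differentiable)
  hence "((\<lambda>x. f (x + l)) has_real_derivative deriv f (x + l)) (at x)"
    by (simp add: DERIV_shift)
  moreover have "(\<lambda>x. f (x + l)) = f" using assms by (auto simp: periodic_def)
  ultimately show "deriv f (x + l) = deriv f x" by (simp add: DERIV_imp_deriv)
qed

lemma cper_pd:
  assumes "cper l (Suc n) f"
  shows "cper l n (pd (Suc 0) f)"
  using assms periodic_pd_1 by (auto simp: cper_def creg_Suc)

lemma cper_pd_2: "cper l (Suc (Suc n)) f \<Longrightarrow> cper l n (pd 2 f)"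
  using cper_pd[OF cper_pd] by (simp add: pd_pd numeral_2_eq_2)

lemma cper_add: "cper l n f \<Longrightarrow> cper l n g \<Longrightarrow> cper l n (\<lambda>x. f x + g x)"
  unfolding cper_def using creg_add[of "{0}" n "\<lambda>_. f" "\<lambda>_. g"] by (auto simp: periodic_def)

lemma cper_cmult: "cper l n f \<Longrightarrow> cper l n (\<lambda>x. c * f x)"
  unfolding cper_def using creg_cmult[of "{0}" n "\<lambda>_. f" c] by (auto simp: periodic_def)

lemma cper_mult: "cper l n f \<Longrightarrow> cper l n g \<Longrightarrow> cper l n (\<lambda>x. f x * g x)"
  unfolding cper_def using creg_mult[of "{0}" n "\<lambda>_. f" "\<lambda>_. g"] by (auto simp: periodic_def)

section \<open>Fourier coefficients and differentiation\<close>

lemma fcoef_add: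
  assumes "continuous_on {-l/2..l/2} f" "continuous_on {-l/2..l/2} g"
  shows "fcoef l (\<lambda>x. f x + g x) k = fcoef l f k + fcoef l g k"
  unfolding fcoef_def distrib_right wk_eq
  by (intro integral_add integrable_continuous_interval continuous_intros assms)

lemma fcoef_diff:
  assumes "continuous_on {-l/2..l/2} f" "continuous_on {-l/2..l/2} g"
  shows "fcoef l (\<lambda>x. f x - g x) k = fcoef l f k - fcoef l g k"
  unfolding fcoef_def left_diff_distrib wk_eq
  by (intro integral_diff integrable_continuous_interval continuous_intros assms)

lemma fcoef_cmult: "fcoef l (\<lambda>x. c * f x) k = c * fcoef l f k"
  unfolding fcoef_def mult.assoc by (rule integral_mult_right)

lemma fcoef_continuous:
  assumes "continuous_on (I \<times> UNIV) (\<lambda>p. u (fst p) (snd p))"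
  shows "continuous_on (I::real set) (\<lambda>\<tau>. fcoef l (u \<tau>) k)"
  unfolding fcoef_def interval_cbox
proof (rule integral_continuous_on_param)
  show "continuous_on (I \<times> cbox (- l / 2) (l / 2)) (\<lambda>(\<tau>, x). u \<tau> x * wk l k x)"
    unfolding wk_eq case_prod_beta
    by (intro continuous_intros continuous_on_subset[OF assms]) auto
qed

context
  fixes l :: real
  assumes l_pos: "0 < l"
begin

lemma fcoef_bound:
  assumes "continuous_on {-l/2..l/2} f" "\<And>x. x \<in> {-l/2..l/2} \<Longrightarrow> \<bar>f x\<bar> \<le> M"
  shows "\<bar>fcoef l f k\<bar> \<le> M * sqrt (2 / l) * l"
proof -
  have "norm (integral {-l/2..l/2} (\<lambda>x. f x * wk l k x)) \<le> (M * sqrt (2 / l)) * (l/2 - (-l/2))"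
  proof (rule integral_bound)
    show "continuous_on {-l/2..l/2} (\<lambda>x. f x * wk l k x)"
      unfolding wk_eq by (intro continuous_intros assms)
    show "norm (f x * wk l k x) \<le> M * sqrt (2 / l)" if "x \<in> {-l/2..l/2}" for x
      unfolding norm_mult
      by (intro mult_mono) (use assms(2)[OF that] wk_bound[OF l_pos] in auto)
  qed (use l_pos in auto)
  thus ?thesis by (simp add: fcoef_def)
qed

text \<open>Integration by parts, with boundary terms that cancel by periodicity. The derivative
  falls on \<open>wk l k\<close> and turns it into the partner function of the same harmonic, hence
  the index \<open>pk k\<close>.\<close>

lemma fcoef_pd_1:
  assumes "cper l (Suc 0) f"
  shows "fcoef l (pd (Suc 0) f) k = - sg k * freq l k * fcoef l f (pk k)"
proof -
  let ?J = "{-l/2..l/2}"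
  have fc: "continuous_on ?J f" by (rule cper_continuous[OF assms])
  have fper: "f (l/2) = f (-l/2)"
  proof -
    have "f (-l/2 + l) = f (-l/2)" using assms unfolding cper_def periodic_def by blast
    thus ?thesis by (simp add: field_simps)
  qed
  have wper: "wk l k (l/2) = wk l k (-l/2)"
    using wkd_periodic[OF l_pos, of 0 k "-l/2"] by (simp add: wk_eq)
  have "((\<lambda>x. pd (Suc 0) f x * wk l k x) has_integral (- integral ?J (\<lambda>x. f x * wkd l (Suc 0) k x))) ?J"
  proof (rule integration_by_parts[OF bounded_bilinear_mult, where f = f and g' = "wkd l (Suc 0) k"])
    show "((\<lambda>x. f x * wkd l (Suc 0) k x) has_integral
       f (l / 2) * wk l k (l / 2) - f (- l / 2) * wk l k (- l / 2) - - integral ?J (\<lambda>x. f x * wkd l (Suc 0) k x)) ?J"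
      unfolding fper wper
      by (simp, rule integrable_integral) (intro integrable_continuous_interval continuous_intros fc[simplified])
    show "continuous_on ?J (wk l k)" unfolding wk_eq[abs_def] by (intro continuous_intros)
    show "(f has_vector_derivative pd (Suc 0) f x) (at x)" for x
      using cper_Suc_deriv[OF assms] by (simp add: has_real_derivative_iff_has_vector_derivative)
    show "(wk l k has_vector_derivative wkd l (Suc 0) k x) (at x)" for x
      using wkd_deriv[of l 0 k x UNIV] by (simp add: wk_eq[abs_def] has_real_derivative_iff_has_vector_derivative)
  qed (use l_pos fc in simp_all)
  hence "fcoef l (pd (Suc 0) f) k = - integral ?J (\<lambda>x. f x * wkd l (Suc 0) k x)"
    by (simp add: fcoef_def integral_unique)
  also have "integral ?J (\<lambda>x. f x * wkd l (Suc 0) k x) = integral ?J (\<lambda>x. (sg k * freq l k) * (f x * wk l (pk k) x))"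
    by (simp add: wkd_1 mult_ac)
  also have "\<dots> = sg k * freq l k * fcoef l f (pk k)" unfolding fcoef_def by (rule integral_mult_right)
  finally show ?thesis by simp
qed

lemma fcoef_pd_2:
  assumes "cper l 2 f"
  shows "fcoef l (pd 2 f) k = - lam l k * fcoef l f k"
proof -
  have *: "cper l (Suc (Suc 0)) f" using assms by (simp add: numeral_2_eq_2)
  have "fcoef l (pd 2 f) k = - sg k * freq l k * fcoef l (pd (Suc 0) f) (pk k)"
    unfolding numeral_2_eq_2 pd_Suc[of "Suc 0" f] by (rule fcoef_pd_1[OF cper_pd[OF *]])
  also have "fcoef l (pd (Suc 0) f) (pk k) = - sg (pk k) * freq l k * fcoef l f k"
    using fcoef_pd_1[OF cper_mono[OF *], of "pk k"] by simp
  finally have "fcoef l (pd 2 f) k = (sg k * sg (pk k)) * freq l k ^ 2 * fcoef l f k"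
    by (simp add: power2_eq_square)
  \<comment> \<open>\<open>pk\<close> changes the parity of a positive index, so the two signs are
    opposite; at index 0 both sides vanish.\<close>
  also have "(sg k * sg (pk k)) * freq l k ^ 2 = - lam l k"
    by (auto simp: sg_def pk_def lam_eq freq_def)
  finally show ?thesis .
qed

lemma fcoef_pd_4:
  assumes "cper l 4 f"
  shows "fcoef l (pd 4 f) k = lam l k ^ 2 * fcoef l f k"
proof -
  have "cper l 2 (pd 2 f)" using assms by (intro cper_pd_2) (simp add: eval_nat_numeral)
  from fcoef_pd_2[OF this, of k] fcoef_pd_2[OF cper_mono[OF assms], of k] show ?thesis
    by (simp add: pd_pd power2_eq_square)
qed

text \<open>An identity rather than a bound, so that Bessel's inequality can be applied to the
  derivative; for this the permuted index has to be tracked.\<close>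

lemma abs_fcoef_pd:
  assumes "cper l r f"
  shows "freq l k ^ r * \<bar>fcoef l f k\<bar> = \<bar>fcoef l (pd r f) ((pk ^^ r) k)\<bar>"
  using assms
proof (induction r arbitrary: f k)
  case (Suc r)
  have "freq l k ^ Suc r * \<bar>fcoef l f k\<bar> = freq l k ^ r * \<bar>fcoef l (pd (Suc 0) f) (pk k)\<bar>"
    using fcoef_pd_1[OF cper_mono[OF Suc.prems], of "pk k"] freq_nonneg[OF l_pos, of k] by (simp add: abs_mult)
  also have "\<dots> = \<bar>fcoef l (pd r (pd (Suc 0) f)) ((pk ^^ r) (pk k))\<bar>"
    using Suc.IH[OF cper_pd[OF Suc.prems], of "pk k"] by simp
  finally show ?case by (simp only: pd_Suc[of r f] funpow_Suc_right o_apply)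
qed simp

end

section \<open>Fourier inversion and products\<close>

text \<open>The factors come from \<open>one_plus_power_le\<close>, from turning the harmonic number
  into a frequency, and from \<open>fcoef_bound\<close>.\<close>

definition decay_const :: "real \<Rightarrow> nat \<Rightarrow> real" where
  "decay_const l r = 2 ^ r * (1 + (l / (2 * pi)) ^ r) * (sqrt (2 / l) * l)"

text \<open>\<open>4 / sqrt l\<close> from \<open>ser_times_wk_bound\<close> times
  \<open>2 ^ p * 16\<close> from \<open>sum_wt_conv\<close>.\<close>

definition conv_const :: "real \<Rightarrow> nat \<Rightarrow> real" where
  "conv_const l p = 64 * 2 ^ p / sqrt l"

lemma one_plus_power_le: "(1 + real n) ^ r \<le> 2 ^ r * (1 + real n ^ r)"
proof (cases "n = 0")
  case False
  have "(1 + real n) ^ r \<le> (2 * real n) ^ r" using False by (intro power_mono) auto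
  also have "\<dots> \<le> 2 ^ r * (1 + real n ^ r)" by (simp add: power_mult_distrib)
  finally show ?thesis .
next
  case True
  thus ?thesis using one_le_power[of "2::real" r] by (cases r) auto
qed

section \<open>Discrete convolution of the weights\<close>

lemma sum_inverse_square_shift:
  fixes j :: int
  shows "(\<Sum>i<N. 1 / (1 + \<bar>real_of_int (int i - j)\<bar>) ^ 2) \<le> 4"
proof -
  define psi where "psi d = 2 * d / (1 + \<bar>d\<bar>)" for d :: real
  \<comment> \<open>a bounded function whose increments dominate the summands, so that the sum telescopes\<close>
  have step: "1 / (1 + \<bar>real_of_int d\<bar>) ^ 2 \<le> psi (real_of_int (d + 1)) - psi (real_of_int d)" for d :: int
  proof (cases "d \<ge> 0")
    case True
    hence "psi (real_of_int (d + 1)) - psi (real_of_int d) = 2 / ((1 + real_of_int d) * (2 + real_of_int d))"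
      by (simp add: psi_def field_simps)
    moreover have "1 / (1 + real_of_int d) ^ 2 \<le> 2 / ((1 + real_of_int d) * (2 + real_of_int d))"
      using True by (simp add: divide_simps power2_eq_square)
    ultimately show ?thesis using True by simp
  next
    case False
    define e where "e = - real_of_int d"
    have e: "e \<ge> 1" using False by (simp add: e_def)
    have "psi (real_of_int (d + 1)) - psi (real_of_int d) = 2 * (1 - e) / e + 2 * e / (1 + e)"
    proof -
      have "\<bar>real_of_int (d + 1)\<bar> = e - 1" "\<bar>real_of_int d\<bar> = e" "real_of_int (d + 1) = 1 - e" "real_of_int d = - e"
        using False by (auto simp: e_def)
      thus ?thesis unfolding psi_def by simp
    qed
    also have "\<dots> = 2 / (e * (1 + e))"
      using e by (simp add: divide_simps) (simp add: algebra_simps)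
    finally have "psi (real_of_int (d + 1)) - psi (real_of_int d) = 2 / (e * (1 + e))" .
    moreover have "1 / (1 + e) ^ 2 \<le> 2 / (e * (1 + e))"
      using e by (simp add: divide_simps power2_eq_square)
    moreover have "\<bar>real_of_int d\<bar> = e" using False by (simp add: e_def)
    ultimately show ?thesis by simp
  qed
  have psi_bound: "\<bar>psi d\<bar> \<le> 2" for d
    by (simp add: psi_def abs_mult divide_simps)
  have "(\<Sum>i<N. 1 / (1 + \<bar>real_of_int (int i - j)\<bar>) ^ 2)
      \<le> (\<Sum>i<N. psi (real_of_int (int (Suc i) - j)) - psi (real_of_int (int i - j)))"
    by (intro sum_mono) (use step[of "int _ - j"] in \<open>simp add: algebra_simps\<close>)
  also have "\<dots> = psi (real_of_int (int N - j)) - psi (real_of_int (int 0 - j))"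
    by (rule sum_lessThan_telescope)
  also have "\<dots> \<le> 4" using psi_bound[of "real_of_int (int N - j)"] psi_bound[of "real_of_int (int 0 - j)"] by linarith
  finally show ?thesis .
qed

text \<open>A harmonic belongs to at most two indices. The induction runs over
  \<open>2 * n + 1\<close> terms, the constant mode and \<open>n\<close> complete pairs.\<close>

lemma sum_jk_le:
  assumes "\<And>i. 0 \<le> F i"
  shows "(\<Sum>k<N. F (jk k)) \<le> 2 * (\<Sum>i<Suc N. F i :: real)"
proof -
  have "(\<Sum>k<2 * n + 1. F (jk k)) \<le> 2 * (\<Sum>i<Suc n. F i)" for n
  proof (induction n)
    case (Suc n)
    have "jk (2 * n + 1) = Suc n" "jk (2 * n + 2) = Suc n" by (auto simp: jk_def)
    with Suc show ?case by simp
  qed (use assms in simp)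
  note this[of N]
  moreover have "(\<Sum>k<N. F (jk k)) \<le> (\<Sum>k<2 * N + 1. F (jk k))"
    by (rule sum_mono2) (use assms in auto)
  ultimately show ?thesis by simp
qed

text \<open>By the triangle inequality the larger of the two bases is at least half of
  \<open>1 + jk k\<close>, so its \<open>p\<close>-th power supplies
  \<open>2 ^ p * wt k ^ p\<close>, while the other factor is summed as an inverse square. The 16
  consists of two such sums, each at most twice the 4 of
  \<open>sum_inverse_square_shift\<close>.\<close>

lemma sum_wt_conv:
  assumes "2 \<le> p"
  shows "(\<Sum>m<N. wt m ^ p * (1 / (1 + \<bar>real (jk m) - real (jk k)\<bar>) ^ p)) \<le> 2 ^ p * 16 * wt k ^ p"
proof -
  have summand: "wt m ^ p * (1 / (1 + \<bar>real (jk m) - real (jk k)\<bar>) ^ p)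
     \<le> 2 ^ p * wt k ^ p * (1 / (1 + \<bar>real (jk m) - real 0\<bar>) ^ 2 + 1 / (1 + \<bar>real (jk m) - real (jk k)\<bar>) ^ 2)" for m
  proof -
    define a where "a = 1 + real (jk m)"
    define b where "b = 1 + \<bar>real (jk m) - real (jk k)\<bar>"
    define c where "c = 1 + real (jk k)"
    have pos: "a \<ge> 1" "b \<ge> 1" "c \<ge> 1" by (auto simp: a_def b_def c_def)
    have c: "c \<le> a + b" by (auto simp: a_def b_def c_def)
    have *: "1 / x ^ p \<le> 1 / x ^ 2" if "x \<ge> 1" for x :: real
      using that assms by (intro divide_left_mono power_increasing) auto
    have "1 / a ^ p * (1 / b ^ p) \<le> 2 ^ p * (1 / c ^ p) * (1 / a ^ 2 + 1 / b ^ 2)"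
    proof (cases "a \<le> b")
      case True
      hence "c ^ p \<le> (2 * b) ^ p" using c pos by (intro power_mono) auto
      hence "1 / b ^ p \<le> 2 ^ p * (1 / c ^ p)"
        using pos by (simp add: divide_simps power_mult_distrib mult.commute)
      hence "1 / b ^ p * (1 / a ^ p) \<le> 2 ^ p * (1 / c ^ p) * (1 / a ^ 2 + 1 / b ^ 2)"
        using *[OF pos(1)] pos by (intro mult_mono) (auto intro: add_increasing2)
      thus ?thesis by (simp add: mult.commute)
    next
      case False
      hence "c ^ p \<le> (2 * a) ^ p" using c pos by (intro power_mono) auto
      hence "1 / a ^ p \<le> 2 ^ p * (1 / c ^ p)"
        using pos by (simp add: divide_simps power_mult_distrib mult.commute)
      thus "1 / a ^ p * (1 / b ^ p) \<le> 2 ^ p * (1 / c ^ p) * (1 / a ^ 2 + 1 / b ^ 2)"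
        using *[OF pos(2)] pos by (intro mult_mono) (auto intro: add_increasing)
    qed
    thus ?thesis by (simp add: wt_def a_def b_def c_def power_one_over[symmetric])
  qed
  have shift: "(\<Sum>m<N. 1 / (1 + \<bar>real (jk m) - real j\<bar>) ^ 2) \<le> 8" for j
    using sum_jk_le[of "\<lambda>i. 1 / (1 + \<bar>real i - real j\<bar>) ^ 2" N] sum_inverse_square_shift[of "int j" "Suc N"] by simp
  have "(\<Sum>m<N. wt m ^ p * (1 / (1 + \<bar>real (jk m) - real (jk k)\<bar>) ^ p))
     \<le> (\<Sum>m<N. 2 ^ p * wt k ^ p * (1 / (1 + \<bar>real (jk m) - real 0\<bar>) ^ 2 + 1 / (1 + \<bar>real (jk m) - real (jk k)\<bar>) ^ 2))"
    by (intro sum_mono summand)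
  also have "\<dots> = 2 ^ p * wt k ^ p * ((\<Sum>m<N. 1 / (1 + \<bar>real (jk m) - real 0\<bar>) ^ 2) + (\<Sum>m<N. 1 / (1 + \<bar>real (jk m) - real (jk k)\<bar>) ^ 2))"
    by (simp only: sum_distrib_left sum.distrib[symmetric])
  also have "\<dots> \<le> 2 ^ p * wt k ^ p * (8 + 8)"
    by (intro mult_left_mono add_mono shift) auto
  finally show ?thesis by simp
qed

context
  fixes l :: real
  assumes l_pos: "0 < l"
begin

lemma one_plus_freq_wt: "(1 + 2 * freq l k) * wt k \<le> 1 + 4 * pi / l"
proof -
  have "(1 + 2 * freq l k) * wt k = wt k + 2 * (freq l k * wt k)" by (simp add: algebra_simps)
  also have "\<dots> \<le> 1 + 2 * (2 * pi / l)" by (intro add_mono mult_left_mono freq_wt_le l_pos) auto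
  finally show ?thesis by simp
qed

text \<open>The derivative controls the high frequencies but is blind to the constant mode, which is
  why a bound of \<open>f\<close> itself enters too.\<close>

lemma fcoef_decay:
  assumes "cper l r f" "\<And>x. x \<in> {-l/2..l/2} \<Longrightarrow> \<bar>f x\<bar> \<le> M" "\<And>x. x \<in> {-l/2..l/2} \<Longrightarrow> \<bar>pd r f x\<bar> \<le> M"
  shows "\<bar>fcoef l f k\<bar> \<le> decay_const l r * M * wt k ^ r"
proof -
  let ?B = "M * sqrt (2 / l) * l"
  have f: "\<bar>fcoef l f k\<bar> \<le> ?B"
    by (rule fcoef_bound[OF l_pos cper_continuous[OF assms(1)] assms(2)])
  have "continuous_on UNIV (pd r f)"
    using assms(1) by (simp add: cper_def creg_const_iff)
  hence pd: "\<bar>fcoef l (pd r f) k'\<bar> \<le> ?B" for k'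
    by (intro fcoef_bound[OF l_pos _ assms(3)]) (auto intro: continuous_on_subset)
  have "(2 * pi / l * real (jk k)) ^ r * \<bar>fcoef l f k\<bar> \<le> ?B"
    using abs_fcoef_pd[OF l_pos assms(1), of k] pd by (simp add: freq_def)
  hence "(l / (2 * pi)) ^ r * ((2 * pi / l) ^ r * real (jk k) ^ r * \<bar>fcoef l f k\<bar>) \<le> (l / (2 * pi)) ^ r * ?B"
    unfolding power_mult_distrib[symmetric] using l_pos by (intro mult_left_mono) auto
  moreover have "(l / (2 * pi)) ^ r * ((2 * pi / l) ^ r * real (jk k) ^ r * \<bar>fcoef l f k\<bar>) = real (jk k) ^ r * \<bar>fcoef l f k\<bar>"
  proof -
    have "(l / (2 * pi)) ^ r * (2 * pi / l) ^ r = 1"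
      using l_pos by (simp add: power_mult_distrib[symmetric])
    thus ?thesis by (simp add: mult.assoc[symmetric])
  qed
  ultimately have *: "real (jk k) ^ r * \<bar>fcoef l f k\<bar> \<le> (l / (2 * pi)) ^ r * ?B" by simp
  have "(1 + real (jk k)) ^ r * \<bar>fcoef l f k\<bar> \<le> 2 ^ r * (1 + real (jk k) ^ r) * \<bar>fcoef l f k\<bar>"
    by (intro mult_right_mono one_plus_power_le) auto
  also have "\<dots> = 2 ^ r * (\<bar>fcoef l f k\<bar> + real (jk k) ^ r * \<bar>fcoef l f k\<bar>)" by (simp add: algebra_simps)
  also have "\<dots> \<le> 2 ^ r * (?B + (l / (2 * pi)) ^ r * ?B)"
    by (intro mult_left_mono add_mono f *) auto
  also have "\<dots> = decay_const l r * M" by (simp add: decay_const_def algebra_simps)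
  finally show ?thesis by (simp add: wt_def power_one_over divide_simps mult.commute)
qed

section \<open>Bessel's inequality and pointwise inversion\<close>

lemma integral_wk_sum_square:
  assumes "finite A"
  shows "integral {-l/2..l/2} (\<lambda>x. (\<Sum>k\<in>A. c k * wk l k x)^2) = (\<Sum>k\<in>A. (c k)^2)"
proof -
  let ?J = "{-l/2..l/2}"
  have cw: "continuous_on ?J (wk l k)" for k unfolding wk_eq[abs_def] by (intro continuous_intros)
  note ci = integrable_continuous_interval continuous_intros cw assms
  have "integral ?J (\<lambda>x. (\<Sum>k\<in>A. c k * wk l k x)^2) = integral ?J (\<lambda>x. \<Sum>j\<in>A. \<Sum>k\<in>A. (c j * c k) * (wk l j x * wk l k x))"
    by (simp add: power2_eq_square sum_product mult_ac)
  also have "\<dots> = (\<Sum>j\<in>A. \<Sum>k\<in>A. integral ?J (\<lambda>x. (c j * c k) * (wk l j x * wk l k x)))"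
    by (subst integral_sum, (intro ci)+, intro sum.cong refl integral_sum ci)
  also have "\<dots> = (\<Sum>j\<in>A. \<Sum>k\<in>A. (c j * c k) * (if j = k then 1 else 0))"
    by (simp only: integral_mult_right wk_orthonormal[OF l_pos])
  also have "\<dots> = (\<Sum>k\<in>A. (c k)^2)" using assms by (simp add: if_distrib power2_eq_square cong: if_cong)
  finally show ?thesis .
qed

lemma bessel:
  assumes "continuous_on {-l/2..l/2} f" "finite A"
  shows "(\<Sum>k\<in>A. (fcoef l f k)^2) \<le> integral {-l/2..l/2} (\<lambda>x. (f x)^2)"
proof -
  let ?J = "{-l/2..l/2}"
  let ?c = "fcoef l f"
  let ?s = "\<lambda>x. \<Sum>k\<in>A. ?c k * wk l k x"
  have cw: "continuous_on ?J (wk l k)" for k unfolding wk_eq[abs_def] by (intro continuous_intros)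
  note ci = integrable_continuous_interval continuous_intros cw assms
  have 1: "integral ?J (\<lambda>x. f x * ?s x) = (\<Sum>k\<in>A. (?c k)^2)"
  proof -
    have "integral ?J (\<lambda>x. f x * ?s x) = integral ?J (\<lambda>x. \<Sum>k\<in>A. ?c k * (f x * wk l k x))"
      by (simp add: sum_distrib_left mult_ac)
    also have "\<dots> = (\<Sum>k\<in>A. integral ?J (\<lambda>x. ?c k * (f x * wk l k x)))"
      by (intro integral_sum ci)
    also have "\<dots> = (\<Sum>k\<in>A. ?c k * fcoef l f k)" unfolding fcoef_def by (simp only: integral_mult_right)
    finally show ?thesis by (simp add: power2_eq_square)
  qed
  have 2: "integral ?J (\<lambda>x. ?s x * ?s x) = (\<Sum>k\<in>A. (?c k)^2)"
    using integral_wk_sum_square[OF assms(2), of ?c] by (simp only: power2_eq_square)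
  have "0 \<le> integral ?J (\<lambda>x. (f x - ?s x)^2)"
    by (intro integral_nonneg ci) auto
  also have "\<dots> = integral ?J (\<lambda>x. ((f x)^2 - 2 * (f x * ?s x)) + ?s x * ?s x)"
    by (simp add: power2_eq_square algebra_simps)
  also have "\<dots> = integral ?J (\<lambda>x. (f x)^2 - 2 * (f x * ?s x)) + integral ?J (\<lambda>x. ?s x * ?s x)"
    by (intro integral_add ci)
  also have "integral ?J (\<lambda>x. (f x)^2 - 2 * (f x * ?s x)) = integral ?J (\<lambda>x. (f x)^2) - integral ?J (\<lambda>x. 2 * (f x * ?s x))"
    by (intro integral_diff ci)
  also have "integral ?J (\<lambda>x. 2 * (f x * ?s x)) = 2 * integral ?J (\<lambda>x. f x * ?s x)"
    by (rule integral_mult_right)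
  finally show ?thesis unfolding 1 2 by linarith
qed

lemma fcoef_tendsto_0:
  assumes "continuous_on {-l/2..l/2} f"
  shows "fcoef l f \<longlonglongrightarrow> 0"
proof -
  have "summable (\<lambda>k. (fcoef l f k)^2)"
    by (rule summableI_nonneg_bounded[OF _ bessel[OF assms]]) auto
  hence "(\<lambda>k. (fcoef l f k)^2) \<longlonglongrightarrow> 0" by (rule summable_LIMSEQ_zero)
  hence "(\<lambda>k. sqrt ((fcoef l f k)^2)) \<longlonglongrightarrow> sqrt 0" by (rule tendsto_real_sqrt)
  thus ?thesis by (simp add: tendsto_rabs_zero_iff)
qed

text \<open>The sine is kept as a factor on the left instead of dividing by it, so that
  \<open>x = y\<close> is no exception. The number of terms is odd because only complete harmonics
  give a closed formula.\<close>

lemma dirichlet_kernel: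
  "sin (pi / l * (x - y)) * (\<Sum>k<2 * N + 1. wk l k x * wk l k y) = sin ((2 * real N + 1) * (pi / l * (x - y))) / l"
proof (induction N)
  case 0
  have "sqrt l * sqrt l = l" using l_pos by simp
  thus ?case by (simp add: wk_def)
next
  case (Suc N)
  let ?u = "pi / l * (x - y)"
  have ll: "sqrt (2 / l) * sqrt (2 / l) = 2 / l" using l_pos by simp
  have "wk l (2 * N + 1) x * wk l (2 * N + 1) y + wk l (2 * N + 2) x * wk l (2 * N + 2) y
     = (sqrt (2 / l) * sqrt (2 / l)) * (cos (2 * pi * real (N + 1) * x / l) * cos (2 * pi * real (N + 1) * y / l)
        + sin (2 * pi * real (N + 1) * x / l) * sin (2 * pi * real (N + 1) * y / l))"
    by (simp add: wk_def algebra_simps del: real_sqrt_mult_self)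
  also have "\<dots> = (2 / l) * cos (2 * pi * real (N + 1) * x / l - 2 * pi * real (N + 1) * y / l)"
    by (simp only: ll cos_diff)
  also have "2 * pi * real (N + 1) * x / l - 2 * pi * real (N + 1) * y / l = 2 * real (N + 1) * ?u"
    by (simp add: algebra_simps diff_divide_distrib add_divide_distrib)
  finally have step: "wk l (2 * N + 1) x * wk l (2 * N + 1) y + wk l (2 * N + 2) x * wk l (2 * N + 2) y
     = (2 / l) * cos (2 * real (N + 1) * ?u)" .
  have "sin ?u * ((2 / l) * cos (2 * real (N + 1) * ?u))
      = (sin (?u + 2 * real (N + 1) * ?u) + sin (?u - 2 * real (N + 1) * ?u)) / l"
    by (simp only: sin_add sin_diff) (simp add: field_simps)
  also have "sin (?u - 2 * real (N + 1) * ?u) = - sin ((2 * real N + 1) * ?u)"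
  proof -
    have "u - 2 * real (N + 1) * u = - ((2 * real N + 1) * u)" for u :: real by (simp add: algebra_simps)
    thus ?thesis by (simp only: sin_minus)
  qed
  also have "?u + 2 * real (N + 1) * ?u = (2 * real (Suc N) + 1) * ?u"
  proof -
    have "u + 2 * real (N + 1) * u = (2 * real (Suc N) + 1) * u" for u :: real by (simp add: algebra_simps)
    thus ?thesis .
  qed
  finally have "sin ?u * ((2 / l) * cos (2 * real (N + 1) * ?u))
      = (sin ((2 * real (Suc N) + 1) * ?u) - sin ((2 * real N + 1) * ?u)) / l" by simp
  moreover have "(\<Sum>k<2 * Suc N + 1. wk l k x * wk l k y) = (\<Sum>k<2 * N + 1. wk l k x * wk l k y)
     + (wk l (2 * N + 1) x * wk l (2 * N + 1) y + wk l (2 * N + 2) x * wk l (2 * N + 2) y)"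
    by (simp add: add_ac)
  ultimately show ?case using Suc.IH unfolding step by (simp only: distrib_left) (simp add: diff_divide_distrib)
qed

text \<open>Multiplied by \<open>sin (pi (x - y) / l)\<close>, the Dirichlet kernel is a pure oscillation, and the quotient of
  \<open>f x - f y\<close> by this sine is continuous: the error of the partial sums tends to \<open>0\<close> by the
  Riemann-Lebesgue lemma.\<close>

lemma fourier_inversion_interior:
  assumes f: "continuous_on {-l/2..l/2} f" "(f has_real_derivative f') (at y)"
    and y: "- l / 2 < y" "y < l / 2"
  shows "(\<lambda>N. \<Sum>k<2 * N + 1. fcoef l f k * wk l k y) \<longlonglongrightarrow> f y"
proof -
  let ?J = "{-l/2..l/2}"
  let ?s = "\<lambda>x. sin (pi / l * (x - y))"
  \<comment> \<open>The value at \<open>y\<close> is the limit of the quotient, since the sine has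
    derivative \<open>pi / l\<close> there.\<close>
  define g where "g x = (if x = y then f' / (pi / l) else (f x - f y) / ?s x)" for x
  \<comment> \<open>Here the restriction to interior \<open>y\<close> is used: at an end point the
    sine would also vanish at the opposite end.\<close>
  have s_nz: "?s x \<noteq> 0" if "x \<in> ?J" "x \<noteq> y" for x
  proof -
    have lt: "\<bar>x - y\<bar> < l" using that y by auto
    have "\<bar>pi / l * (x - y)\<bar> < pi"
    proof -
      have "\<bar>pi / l * (x - y)\<bar> = pi * (\<bar>x - y\<bar> / l)" using l_pos by (simp add: abs_mult)
      also have "\<dots> < pi * 1" using lt l_pos by (intro mult_strict_left_mono) auto
      finally show ?thesis by simp
    qed
    moreover have "pi / l * (x - y) \<noteq> 0" using that l_pos by simp
    ultimately show ?thesis by (meson abs_less_iff minus_less_iff sin_eq_0_pi)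
  qed
  have g_eq: "g x * ?s x = f x - f y" if "x \<in> ?J" for x
    using s_nz[OF that] by (auto simp: g_def)
  have g_cont: "continuous_on ?J g"
  proof (rule continuous_on_eq_continuous_within[THEN iffD2], rule ballI)
    fix x assume x: "x \<in> ?J"
    show "continuous (at x within ?J) g"
    proof (cases "x = y")
      case False
      have "continuous (at x within ?J) (\<lambda>x. (f x - f y) / ?s x)"
        using x False s_nz f(1) by (intro continuous_intros) (auto simp: continuous_on_eq_continuous_within)
      moreover have "eventually (\<lambda>z. z \<noteq> y) (at x within ?J)"
        using False by (intro eventually_neq_at_within)
      hence "eventually (\<lambda>z. (f z - f y) / ?s z = g z) (at x within ?J)"
        by eventually_elim (simp add: g_def)
      ultimately show ?thesis
        unfolding continuous_within using False
        by (auto intro: Lim_transform_eventually simp: g_def)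
    next
      case True
      have "((\<lambda>z. (f z - f y) / (z - y)) \<longlongrightarrow> f') (at y)"
        using f(2) by (simp add: has_field_derivative_iff)
      moreover have "(?s has_real_derivative pi / l) (at y)"
        using l_pos by (auto intro!: derivative_eq_intros)
      hence "((\<lambda>z. ?s z / (z - y)) \<longlongrightarrow> pi / l) (at y)"
        by (simp add: has_field_derivative_iff)
      ultimately have "((\<lambda>z. ((f z - f y) / (z - y)) / (?s z / (z - y))) \<longlongrightarrow> f' / (pi / l)) (at y)"
        by (rule tendsto_divide) (use l_pos in auto)
      moreover have "eventually (\<lambda>z. ((f z - f y) / (z - y)) / (?s z / (z - y)) = g z) (at y)"
        by (auto simp: eventually_at_filter g_def)
      ultimately have "(g \<longlongrightarrow> g y) (at y)"
        by (auto intro: Lim_transform_eventually simp: g_def)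
      thus ?thesis using True by (simp add: continuous_within tendsto_within_subset[of g _ y UNIV])
    qed
  qed
  have cw: "continuous_on ?J (wk l k)" for k unfolding wk_eq[abs_def] by (intro continuous_intros)
  note ci = integrable_continuous_interval continuous_intros cw f(1) g_cont
  let ?D = "\<lambda>N x. \<Sum>k<2 * N + 1. wk l k x * wk l k y"
  \<comment> \<open>Mean value 1 of the kernel: \<open>1 = sqrt l * wk l 0 x\<close>, so integrating
    means testing against the constant mode.\<close>
  have intD: "integral ?J (?D N) = 1" for N
  proof -
    have "integral ?J (?D N) = integral ?J (\<lambda>x. \<Sum>k<2 * N + 1. (wk l k y * sqrt l) * (wk l k x * wk l 0 x))"
      using l_pos by (simp add: wk_def[of l 0] mult.commute cong: sum.cong)
    also have "\<dots> = (\<Sum>k<2 * N + 1. integral ?J (\<lambda>x. (wk l k y * sqrt l) * (wk l k x * wk l 0 x)))"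
      by (intro integral_sum ci) auto
    also have "\<dots> = (\<Sum>k<2 * N + 1. (wk l k y * sqrt l) * (if k = 0 then 1 else 0))"
      by (simp only: integral_mult_right wk_orthonormal[OF l_pos])
    also have "\<dots> = wk l 0 y * sqrt l" by (simp add: if_distrib cong: if_cong)
    finally show ?thesis using l_pos by (simp add: wk_def)
  qed
  \<comment> \<open>The kernel oscillates with frequency \<open>(2 * N + 1) * pi / l\<close>, which
    is not a basis frequency. The addition theorem moves the excess \<open>pi / l\<close> into the
    continuous functions \<open>?gc\<close> and \<open>?gs\<close> and the dependence on
    \<open>y\<close> into the bounded factors with \<open>a N\<close>. What remains are Fourier
    coefficients, which tend to 0.\<close>
  define a where "a N = (2 * real N + 1) * (pi / l * y)" for N
  let ?gc = "\<lambda>x. g x * cos (pi / l * x)" and ?gs = "\<lambda>x. g x * sin (pi / l * x)"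
  let ?I = "\<lambda>h. integral ?J h"
  let ?C = "\<lambda>N x. cos (2 * pi * real N * x / l)" and ?S = "\<lambda>N x. sin (2 * pi * real N * x / l)"
  have err: "(\<Sum>k<2 * N + 1. fcoef l f k * wk l k y) - f y
     = (cos (a N) * (?I (\<lambda>x. ?gc x * ?S N x) + ?I (\<lambda>x. ?gs x * ?C N x))
        - sin (a N) * (?I (\<lambda>x. ?gc x * ?C N x) - ?I (\<lambda>x. ?gs x * ?S N x))) / l" for N
  proof -
    have "(\<Sum>k<2 * N + 1. fcoef l f k * wk l k y) = (\<Sum>k<2 * N + 1. ?I (\<lambda>x. f x * wk l k x * wk l k y))"
      unfolding fcoef_def by (simp only: integral_mult_left)
    also have "\<dots> = ?I (\<lambda>x. \<Sum>k<2 * N + 1. f x * wk l k x * wk l k y)"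
      by (rule integral_sum[symmetric], simp, intro ci)
    also have "\<dots> = ?I (\<lambda>x. f x * ?D N x)" by (simp only: sum_distrib_left mult.assoc)
    finally have "(\<Sum>k<2 * N + 1. fcoef l f k * wk l k y) - f y = ?I (\<lambda>x. f x * ?D N x) - ?I (\<lambda>x. f y * ?D N x)"
      by (simp only: integral_mult_right intD mult_1_right)
    also have "\<dots> = ?I (\<lambda>x. f x * ?D N x - f y * ?D N x)"
      by (rule integral_diff[symmetric]) (intro ci)+
    also have "\<dots> = ?I (\<lambda>x. (cos (a N) * (?gc x * ?S N x + ?gs x * ?C N x) - sin (a N) * (?gc x * ?C N x - ?gs x * ?S N x)) / l)"
    proof (rule integral_cong)
      fix x assume x: "x \<in> ?J"
      have "f x * ?D N x - f y * ?D N x = g x * (?s x * ?D N x)"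
        using g_eq[OF x] by (simp only: left_diff_distrib[symmetric] mult.assoc[symmetric])
      also have "?s x * ?D N x = sin ((2 * real N + 1) * (pi / l * (x - y))) / l"
        by (rule dirichlet_kernel)
      also have "(2 * real N + 1) * (pi / l * (x - y)) = (2 * pi * real N * x / l + pi / l * x) - a N"
      proof -
        have *: "(2 * real N + 1) * (c * (x - y)) = (2 * real N * (c * x) + c * x) - (2 * real N + 1) * (c * y)" for c
          by (simp add: algebra_simps)
        have "2 * pi * real N * x / l = 2 * real N * (pi / l * x)" by simp
        thus ?thesis unfolding a_def by (simp only: *)
      qed
      finally show "f x * ?D N x - f y * ?D N x = (cos (a N) * (?gc x * ?S N x + ?gs x * ?C N x) - sin (a N) * (?gc x * ?C N x - ?gs x * ?S N x)) / l"
        by (simp only: sin_diff sin_add cos_add) (simp add: algebra_simps)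
    qed
    also have "\<dots> = (cos (a N) * (?I (\<lambda>x. ?gc x * ?S N x) + ?I (\<lambda>x. ?gs x * ?C N x))
        - sin (a N) * (?I (\<lambda>x. ?gc x * ?C N x) - ?I (\<lambda>x. ?gs x * ?S N x))) / l"
      by (intro integral_unique has_integral_divide has_integral_diff has_integral_mult_right has_integral_add
            integrable_integral ci) (use l_pos in simp_all)
    finally show ?thesis .
  qed
  have lim: "(\<lambda>N. ?I (\<lambda>x. h x * ?S N x)) \<longlonglongrightarrow> 0 \<and> (\<lambda>N. ?I (\<lambda>x. h x * ?C N x)) \<longlonglongrightarrow> 0" if h: "continuous_on ?J h" for h
  proof -
    have s: "sqrt (2 / l) \<noteq> 0" using l_pos by simp
    have "?I (\<lambda>x. h x * ?S (Suc N) x) = fcoef l h (2 * N + 2) / sqrt (2 / l)"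
       "?I (\<lambda>x. h x * ?C (Suc N) x) = fcoef l h (2 * N + 1) / sqrt (2 / l)" for N
    proof -
      have "fcoef l h (2 * N + 2) = ?I (\<lambda>x. sqrt (2 / l) * (h x * ?S (Suc N) x))"
        unfolding fcoef_def by (rule arg_cong[of _ _ "integral ?J"]) (auto simp: wk_def mult_ac)
      also have "\<dots> = sqrt (2 / l) * ?I (\<lambda>x. h x * ?S (Suc N) x)" by (rule integral_mult_right)
      finally show "?I (\<lambda>x. h x * ?S (Suc N) x) = fcoef l h (2 * N + 2) / sqrt (2 / l)" using s by (simp add: nonzero_eq_divide_eq mult.commute)
      have "fcoef l h (2 * N + 1) = ?I (\<lambda>x. sqrt (2 / l) * (h x * ?C (Suc N) x))"
        unfolding fcoef_def by (rule arg_cong[of _ _ "integral ?J"]) (auto simp: wk_def mult_ac)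
      also have "\<dots> = sqrt (2 / l) * ?I (\<lambda>x. h x * ?C (Suc N) x)" by (rule integral_mult_right)
      finally show "?I (\<lambda>x. h x * ?C (Suc N) x) = fcoef l h (2 * N + 1) / sqrt (2 / l)" using s by (simp add: nonzero_eq_divide_eq mult.commute)
    qed
    moreover have "(\<lambda>N. fcoef l h (2 * N + 2)) \<longlonglongrightarrow> 0" "(\<lambda>N. fcoef l h (2 * N + 1)) \<longlonglongrightarrow> 0"
      by (rule filterlim_compose[OF fcoef_tendsto_0[OF h]], rule filterlim_subseq, simp add: strict_mono_def)+
    ultimately have "(\<lambda>N. ?I (\<lambda>x. h x * ?S (Suc N) x)) \<longlonglongrightarrow> 0 / sqrt (2 / l)" "(\<lambda>N. ?I (\<lambda>x. h x * ?C (Suc N) x)) \<longlonglongrightarrow> 0 / sqrt (2 / l)"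
      by (simp_all only:) (rule tendsto_divide[OF _ tendsto_const s], assumption)+
    thus ?thesis
      using filterlim_sequentially_Suc[of "\<lambda>N. ?I (\<lambda>x. h x * ?S N x)"]
        filterlim_sequentially_Suc[of "\<lambda>N. ?I (\<lambda>x. h x * ?C N x)"] by (simp only: div_0)
  qed
  have "continuous_on ?J ?gc" "continuous_on ?J ?gs" by (intro ci)+
  note L = lim[OF this(1)] lim[OF this(2)]
  have bt: "(\<lambda>N. b N * e N) \<longlonglongrightarrow> 0" if "\<And>N. \<bar>b N\<bar> \<le> 1" "e \<longlonglongrightarrow> 0" for b e :: "nat \<Rightarrow> real"
  proof (rule Lim_null_comparison)
    show "(\<lambda>N. \<bar>e N\<bar>) \<longlonglongrightarrow> 0" using that(2) by (simp add: tendsto_rabs_zero_iff)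
    show "\<forall>\<^sub>F N in sequentially. norm (b N * e N) \<le> \<bar>e N\<bar>"
      using mult_right_mono[OF that(1)] by (auto simp: abs_mult)
  qed
  have "(\<lambda>N. (\<Sum>k<2 * N + 1. fcoef l f k * wk l k y) - f y) \<longlonglongrightarrow> (0 - 0) / l"
    unfolding err
    using L by (intro tendsto_divide tendsto_diff tendsto_const bt tendsto_add_zero)
       (auto intro!: tendsto_eq_intros simp: l_pos[THEN less_imp_neq, symmetric])
  thus ?thesis by (simp add: LIM_zero_iff)
qed

text \<open>The end points, excluded before, are reached by continuity of both sides and the rest of
  the line by periodicity. Two derivatives make the coefficients summable.\<close>

lemma fourier_inversion:
  assumes "cper l 2 f"
  shows "f x = ser l (fcoef l f) 0 x"
proof -
  let ?J = "{-l/2..l/2}"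
  have "compact ?J" by simp
  have "continuous_on ?J (pd 2 f)" "continuous_on ?J f"
    using assms by (auto simp: cper_def creg_const_iff numeral_2_eq_2 intro: continuous_on_subset)
       (metis continuous_on_subset le0 pd_0 subset_UNIV)
  hence "compact (f ` ?J)" "compact (pd 2 f ` ?J)" by (auto intro: compact_continuous_image)
  then obtain M1 M2 where "\<forall>x\<in>?J. \<bar>f x\<bar> \<le> M1" "\<forall>x\<in>?J. \<bar>pd 2 f x\<bar> \<le> M2"
    unfolding real_norm_def[symmetric] by (auto dest!: compact_imp_bounded simp only: bounded_iff ball_simps)
  hence M: "\<And>x. x \<in> ?J \<Longrightarrow> \<bar>f x\<bar> \<le> M1" "\<And>x. x \<in> ?J \<Longrightarrow> \<bar>pd 2 f x\<bar> \<le> M2" by auto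
  have K: "\<bar>fcoef l f k\<bar> \<le> decay_const l 2 * max M1 M2 * wt k ^ 2" for k
    by (rule fcoef_decay[OF assms]) (use M in \<open>force simp: le_max_iff_disj\<close>)+
  let ?h = "\<lambda>x. f x - ser l (fcoef l f) 0 x"
  have K': "\<bar>fcoef l f k\<bar> \<le> decay_const l 2 * max M1 M2 * wt k ^ (0 + 2)" for k
    using K by (simp add: power2_eq_square)
  have ser_c: "continuous_on UNIV (ser l (fcoef l f) 0)"
    by (rule ser_continuous[OF l_pos K'])
  have int: "?h x = 0" if x: "- l / 2 < x" "x < l / 2" for x
  proof -
    have "(\<lambda>N. \<Sum>k<2 * N + 1. fcoef l f k * wk l k x) \<longlonglongrightarrow> f x"
      by (rule fourier_inversion_interior[OF _ _ x])
         (use cper_continuous[OF assms] cper_Suc_deriv[of l 1 f] assms in \<open>auto simp: numeral_2_eq_2\<close>)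
    moreover have "(\<lambda>n. \<Sum>k<n. fcoef l f k * wk l k x) \<longlonglongrightarrow> ser l (fcoef l f) 0 x"
      unfolding ser_def wk_eq
      by (rule summable_LIMSEQ, rule ser_summable[OF l_pos K'])
    hence "(\<lambda>N. \<Sum>k<2 * N + 1. fcoef l f k * wk l k x) \<longlonglongrightarrow> ser l (fcoef l f) 0 x"
      by (rule filterlim_compose, intro filterlim_subseq) (simp add: strict_mono_def)
    ultimately show ?thesis using LIMSEQ_unique by fastforce
  qed
  have "closed {x \<in> ?J. ?h x = 0}"
    by (intro continuous_closed_preimage_constant continuous_intros cper_continuous[OF assms] continuous_on_subset[OF ser_c]) auto
  hence "closure {-l/2<..<l/2} \<subseteq> {x \<in> ?J. ?h x = 0}"
    by (intro closure_minimal) (use int in auto)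
  hence J: "?h x = 0" if "x \<in> ?J" for x using that l_pos by (auto simp: closure_greaterThanLessThan)
  have per: "?h (x + l) = ?h x" for x
    using assms by (simp add: ser_periodic[OF l_pos] cper_def periodic_def)
  have pern: "?h (x + of_int n * l) = ?h x" for n :: int and x
  proof (induction n rule: int_induct[of _ 0])
    case (step1 i)
    thus ?case using per[of "x + of_int i * l"] by (simp add: algebra_simps)
  next
    case (step2 i)
    thus ?case using per[of "x + of_int (i - 1) * l"] by (simp add: algebra_simps)
  qed simp
  \<comment> \<open>The number of periods that brings \<open>x\<close> back to the fundamental
    interval.\<close>
  define n where "n = - \<lfloor>x / l + 1 / 2\<rfloor>"
  have "x + of_int n * l \<in> ?J"
  proof -
    have "- (1 / 2) \<le> x / l + of_int n" "x / l + of_int n \<le> 1 / 2" unfolding n_def of_int_minus by linarith+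
    hence "- (1 / 2) * l \<le> (x / l + of_int n) * l" "(x / l + of_int n) * l \<le> 1 / 2 * l"
      by (intro mult_right_mono; use l_pos in simp)+
    moreover have "(x / l + of_int n) * l = x + of_int n * l" using l_pos by (simp add: distrib_right)
    ultimately show ?thesis by simp
  qed
  from J[OF this] pern[of x n] show ?thesis by simp
qed

text \<open>Up to sign and phase the cosine combines the two basis functions of harmonic
  \<open>|d|\<close>, so the integral consists of two coefficients of the series; this is the factor
  2. For \<open>d = 0\<close> only the constant mode is met.\<close>

lemma ser_times_cos_bound:
  assumes b: "\<And>k. \<bar>b k\<bar> \<le> B * wt k ^ p" and p: "2 \<le> p"
  shows "\<bar>integral {-l/2..l/2} (\<lambda>x. ser l b 0 x * cos (2 * pi / l * of_int d * x + c))\<bar>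
      \<le> 2 * sqrt l * B * (1 / (1 + \<bar>real_of_int d\<bar>) ^ p)"
proof -
  let ?J = "{-l/2..l/2}"
  let ?h = "ser l b 0"
  define n where "n = nat \<bar>d\<bar>"
  let ?C = "\<lambda>x. cos (2 * pi * real n * x / l)" and ?S = "\<lambda>x. sin (2 * pi * real n * x / l)"
  have B: "0 \<le> B" by (rule decay_bound_nonneg[OF b])
  have b2: "\<bar>b k\<bar> \<le> B * wt k ^ 2" for k by (rule decay_mono[OF b p])
  have hc: "continuous_on ?J ?h" by (rule ser_continuous[OF l_pos, of _ B]) (use b2 in \<open>simp add: power2_eq_square\<close>)
  note ci = integrable_continuous_interval continuous_intros hc
  define s :: real where "s = (if d \<ge> 0 then 1 else - 1)"
  have d: "real_of_int d = s * real n" by (auto simp: s_def n_def)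
  have "cos (2 * pi / l * of_int d * x + c) = cos c * ?C x - (s * sin c) * ?S x" for x
  proof -
    have "2 * pi / l * of_int d * x + c = s * (2 * pi * real n * x / l) + c" unfolding d by simp
    moreover have "s = 1 \<or> s = - 1" by (simp add: s_def)
    ultimately show ?thesis by (auto simp only: cos_add) auto
  qed
  moreover have "h * (c * A - d * B) = c * (h * A) - d * (h * B)" for h c d A B :: real
    by (simp add: algebra_simps)
  ultimately have "integral ?J (\<lambda>x. ?h x * cos (2 * pi / l * of_int d * x + c))
      = integral ?J (\<lambda>x. cos c * (?h x * ?C x) - (s * sin c) * (?h x * ?S x))"
    by (simp only:)
  also have "\<dots> = integral ?J (\<lambda>x. cos c * (?h x * ?C x)) - integral ?J (\<lambda>x. (s * sin c) * (?h x * ?S x))"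
    by (rule integral_diff) (intro ci; use l_pos in simp)+
  also have "\<dots> = cos c * integral ?J (\<lambda>x. ?h x * ?C x) - (s * sin c) * integral ?J (\<lambda>x. ?h x * ?S x)"
    by (simp only: integral_mult_right)
  finally have eq: "integral ?J (\<lambda>x. ?h x * cos (2 * pi / l * of_int d * x + c))
     = cos c * integral ?J (\<lambda>x. ?h x * ?C x) - (s * sin c) * integral ?J (\<lambda>x. ?h x * ?S x)" .
  let ?R = "sqrt l * (B * (1 / (1 + real n) ^ p))"
  have CS: "\<bar>integral ?J (\<lambda>x. ?h x * ?C x)\<bar> \<le> ?R \<and> \<bar>integral ?J (\<lambda>x. ?h x * ?S x)\<bar> \<le> ?R"
  proof (cases n)
    case 0
    have "b 0 = integral ?J (\<lambda>x. (1 / sqrt l) * ?h x)"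
      using fcoef_ser[OF l_pos b2, of 0] unfolding fcoef_def by (simp add: wk_def)
    also have "\<dots> = (1 / sqrt l) * integral ?J ?h" by (rule integral_mult_right)
    finally have "integral ?J ?h = sqrt l * b 0" using l_pos by simp
    moreover have "sqrt l * \<bar>b 0\<bar> \<le> sqrt l * (B * 1)"
      using b[of 0] l_pos by (intro mult_left_mono) (auto simp: wt_def)
    ultimately show ?thesis using 0 B l_pos by (simp add: abs_mult)
  next
    case (Suc m)
    have key: "\<bar>integral ?J (\<lambda>x. ?h x * w x)\<bar> \<le> ?R"
      if w: "\<And>x. wk l k x = sqrt (2 / l) * w x" and k: "jk k = n" for w k
    proof -
      have "b k = integral ?J (\<lambda>x. sqrt (2 / l) * (?h x * w x))"
        using fcoef_ser[OF l_pos b2, of k] unfolding fcoef_def w by (simp add: mult_ac)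
      also have "\<dots> = sqrt (2 / l) * integral ?J (\<lambda>x. ?h x * w x)" by (rule integral_mult_right)
      finally have "b k = sqrt (2 / l) * integral ?J (\<lambda>x. ?h x * w x)" .
      hence "sqrt l * \<bar>b k\<bar> = (sqrt l * sqrt (2 / l)) * \<bar>integral ?J (\<lambda>x. ?h x * w x)\<bar>"
        using l_pos by (simp add: abs_mult)
      \<comment> \<open>This factor is given away below, so that the same bound \<open>?R\<close>
        covers the constant mode, whose normalisation is different.\<close>
      also have "sqrt l * sqrt (2 / l) = sqrt 2" using l_pos by (simp add: real_sqrt_mult[symmetric])
      finally have "sqrt 2 * \<bar>integral ?J (\<lambda>x. ?h x * w x)\<bar> = sqrt l * \<bar>b k\<bar>" ..
      moreover have "1 * \<bar>integral ?J (\<lambda>x. ?h x * w x)\<bar> \<le> sqrt 2 * \<bar>integral ?J (\<lambda>x. ?h x * w x)\<bar>"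
        by (intro mult_right_mono) auto
      moreover have "sqrt l * \<bar>b k\<bar> \<le> ?R"
        using b[of k] l_pos by (intro mult_left_mono) (auto simp: wt_def k power_one_over)
      ultimately show ?thesis by linarith
    qed
    have "\<bar>integral ?J (\<lambda>x. ?h x * ?C x)\<bar> \<le> ?R"
      by (rule key[of "2 * m + 1"]) (auto simp: wk_def jk_def Suc)
    moreover have "\<bar>integral ?J (\<lambda>x. ?h x * ?S x)\<bar> \<le> ?R"
      by (rule key[of "2 * m + 2"]) (auto simp: wk_def jk_def Suc)
    ultimately show ?thesis ..
  qed
  have "\<bar>cos c * integral ?J (\<lambda>x. ?h x * ?C x) - (s * sin c) * integral ?J (\<lambda>x. ?h x * ?S x)\<bar>
     \<le> \<bar>cos c\<bar> * \<bar>integral ?J (\<lambda>x. ?h x * ?C x)\<bar> + \<bar>s * sin c\<bar> * \<bar>integral ?J (\<lambda>x. ?h x * ?S x)\<bar>"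
    unfolding abs_mult[symmetric] by linarith
  also have "\<dots> \<le> 1 * ?R + 1 * ?R"
    using CS by (intro add_mono mult_mono) (auto simp: abs_mult s_def)
  finally show ?thesis unfolding eq by (simp add: n_def mult_ac)
qed

lemma ser_times_wk_bound:
  assumes b: "\<And>k. \<bar>b k\<bar> \<le> B * wt k ^ p" and p: "2 \<le> p"
  shows "\<bar>integral {-l/2..l/2} (\<lambda>x. ser l b 0 x * (wk l m x * wk l k x))\<bar>
      \<le> 4 / sqrt l * B * (1 / (1 + \<bar>real (jk m) - real (jk k)\<bar>) ^ p)"
proof -
  let ?J = "{-l/2..l/2}"
  let ?h = "ser l b 0"
  let ?A = "\<lambda>x. cos (2 * pi / l * of_int (int (jk m) - int (jk k)) * x + (phase m - phase k))"
  let ?B = "\<lambda>x. cos (2 * pi / l * of_int (int (jk m) + int (jk k)) * x + (phase m + phase k))"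
  have B: "0 \<le> B" by (rule decay_bound_nonneg[OF b])
  have hc: "continuous_on ?J ?h"
    by (rule ser_continuous[OF l_pos, of _ B], rule decay_mono[OF b]) (use p in simp)
  note ci = integrable_continuous_interval continuous_intros hc
  have "h * (c * (A + B)) = c * (h * A + h * B)" for h c A B :: real
    by (simp add: algebra_simps)
  hence "integral ?J (\<lambda>x. ?h x * (wk l m x * wk l k x))
      = integral ?J (\<lambda>x. amp l m * amp l k / 2 * (?h x * ?A x + ?h x * ?B x))"
    by (simp only: wk_product[OF l_pos])
  also have "\<dots> = amp l m * amp l k / 2 * integral ?J (\<lambda>x. ?h x * ?A x + ?h x * ?B x)"
    by (rule integral_mult_right)
  also have "integral ?J (\<lambda>x. ?h x * ?A x + ?h x * ?B x) = integral ?J (\<lambda>x. ?h x * ?A x) + integral ?J (\<lambda>x. ?h x * ?B x)"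
    by (rule integral_add) (intro ci)+
  finally have eq: "integral ?J (\<lambda>x. ?h x * (wk l m x * wk l k x)) = amp l m * amp l k / 2 * (integral ?J (\<lambda>x. ?h x * ?A x) + integral ?J (\<lambda>x. ?h x * ?B x))" .
  let ?R = "2 * sqrt l * B * (1 / (1 + \<bar>real (jk m) - real (jk k)\<bar>) ^ p)"
  have "\<bar>integral ?J (\<lambda>x. ?h x * ?A x)\<bar> \<le> ?R"
    using ser_times_cos_bound[OF b p, of "int (jk m) - int (jk k)"] by simp
  \<comment> \<open>The sum of two harmonics is at least their distance, so this term decays no
    slower than the first.\<close>
  moreover have "\<bar>integral ?J (\<lambda>x. ?h x * ?B x)\<bar> \<le> ?R"
  proof (rule order_trans[OF ser_times_cos_bound[OF b p]])
    show "2 * sqrt l * B * (1 / (1 + \<bar>real_of_int (int (jk m) + int (jk k))\<bar>) ^ p) \<le> ?R"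
      using B l_pos by (intro mult_left_mono divide_left_mono power_mono) auto
  qed
  ultimately have "\<bar>integral ?J (\<lambda>x. ?h x * ?A x) + integral ?J (\<lambda>x. ?h x * ?B x)\<bar> \<le> 2 * ?R"
    by linarith
  moreover have "amp l m * amp l k / 2 \<le> 1 / l"
  proof -
    have "amp l m * amp l k \<le> sqrt (2 / l) * sqrt (2 / l)"
      by (intro mult_mono amp_bounds[OF l_pos]) (use l_pos in auto)
    also have "\<dots> = 2 / l" using l_pos by simp
    finally show ?thesis by simp
  qed
  ultimately have "amp l m * amp l k / 2 * \<bar>integral ?J (\<lambda>x. ?h x * ?A x) + integral ?J (\<lambda>x. ?h x * ?B x)\<bar> \<le> 1 / l * (2 * ?R)"
    using l_pos by (intro mult_mono) auto
  also have "1 / l * (2 * ?R) = 4 * (sqrt l / l) * B * (1 / (1 + \<bar>real (jk m) - real (jk k)\<bar>) ^ p)" by simp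
  also have "sqrt l / l = 1 / sqrt l" using l_pos by (simp add: divide_simps)
  finally show ?thesis unfolding eq by (simp add: abs_mult amp_bounds[OF l_pos])
qed

text \<open>Only the first factor is expanded. Multiplication by the second series then acts as a
  matrix whose entries decay away from the diagonal, and a single discrete convolution remains. The
  bound is uniform in the partial sums and passes to the limit.\<close>

lemma fcoef_product:
  assumes a: "\<And>k. \<bar>a k\<bar> \<le> A * wt k ^ p" and b: "\<And>k. \<bar>b k\<bar> \<le> B * wt k ^ p" and p: "2 \<le> p"
  shows "\<bar>fcoef l (\<lambda>x. ser l a 0 x * ser l b 0 x) k\<bar> \<le> conv_const l p * A * B * wt k ^ p"
proof -
  let ?J = "{-l/2..l/2}"
  have A: "0 \<le> A" by (rule decay_bound_nonneg[OF a])
  have B: "0 \<le> B" by (rule decay_bound_nonneg[OF b])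
  have a2: "\<bar>a k\<bar> \<le> A * wt k ^ (0 + 2)" for k
    by (rule decay_mono[OF a]) (use p in simp)
  have b2: "\<bar>b k\<bar> \<le> B * wt k ^ (0 + 2)" for k
    by (rule decay_mono[OF b]) (use p in simp)
  have hc: "continuous_on ?J (ser l b 0)" by (rule ser_continuous[OF l_pos b2])
  have cw: "continuous_on ?J (wk l k)" for k unfolding wk_eq[abs_def] by (intro continuous_intros)
  note ci = integrable_continuous_interval continuous_intros hc cw
  let ?g = "\<lambda>x. ser l b 0 x * wk l k x"
  let ?p = "\<lambda>n x. \<Sum>m<n. a m * wk l m x"
  have "uniform_limit ?J ?p (ser l a 0) sequentially"
    using ser_uniform_limit1[OF l_pos a2, of ?J] by (simp add: wk_eq)
  hence "uniform_limit ?J (\<lambda>n x. ?p n x * ?g x) (\<lambda>x. ser l a 0 x * ?g x) sequentially"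
  proof (rule uniform_lim_mult[OF _ uniform_limit_const])
    show "bounded (ser l a 0 ` ?J)"
      by (intro compact_imp_bounded compact_continuous_image ser_continuous[OF l_pos a2]) auto
    show "bounded (?g ` ?J)"
      by (intro compact_imp_bounded compact_continuous_image ci) auto
  qed
  moreover have "continuous_on ?J (\<lambda>x. ?p n x * ?g x)" for n by (intro ci)
  ultimately obtain I J where IJ: "\<And>n. ((\<lambda>x. ?p n x * ?g x) has_integral I n) ?J"
    "((\<lambda>x. ser l a 0 x * ?g x) has_integral J) ?J" "I \<longlonglongrightarrow> J"
    by (rule uniform_limit_integral) auto
  have bound: "\<bar>I n\<bar> \<le> conv_const l p * A * B * wt k ^ p" for n
  proof -
    have "I n = integral ?J (\<lambda>x. ?p n x * ?g x)" by (rule integral_unique[OF IJ(1), symmetric])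
    also have "\<dots> = integral ?J (\<lambda>x. \<Sum>m<n. a m * (ser l b 0 x * (wk l m x * wk l k x)))"
      unfolding sum_distrib_right by (intro arg_cong[of _ _ "integral ?J"] ext sum.cong) simp_all
    also have "\<dots> = (\<Sum>m<n. integral ?J (\<lambda>x. a m * (ser l b 0 x * (wk l m x * wk l k x))))"
      by (intro integral_sum ci) auto
    also have "\<dots> = (\<Sum>m<n. a m * integral ?J (\<lambda>x. ser l b 0 x * (wk l m x * wk l k x)))"
      by (simp only: integral_mult_right)
    finally have I_eq: "I n = (\<Sum>m<n. a m * integral ?J (\<lambda>x. ser l b 0 x * (wk l m x * wk l k x)))" .
    have "\<bar>I n\<bar> \<le> (\<Sum>m<n. \<bar>a m * integral ?J (\<lambda>x. ser l b 0 x * (wk l m x * wk l k x))\<bar>)"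
      unfolding I_eq by (rule sum_abs)
    also have "\<dots> \<le> (\<Sum>m<n. (A * wt m ^ p) * (4 / sqrt l * B * (1 / (1 + \<bar>real (jk m) - real (jk k)\<bar>) ^ p)))"
      unfolding abs_mult by (intro sum_mono mult_mono a ser_times_wk_bound b p) (auto simp: A)
    also have "\<dots> = A * B * 4 / sqrt l * (\<Sum>m<n. wt m ^ p * (1 / (1 + \<bar>real (jk m) - real (jk k)\<bar>) ^ p))"
      unfolding sum_distrib_left by (rule sum.cong) simp_all
    also have "\<dots> \<le> A * B * 4 / sqrt l * (2 ^ p * 16 * wt k ^ p)"
      by (intro mult_left_mono sum_wt_conv p) (use A B l_pos in auto)
    also have "A * B * 4 / sqrt l * (2 ^ p * 16 * wt k ^ p) = conv_const l p * A * B * wt k ^ p"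
      by (simp add: conv_const_def)
    finally show ?thesis .
  qed
  have "\<bar>J\<bar> \<le> conv_const l p * A * B * wt k ^ p"
    by (rule LIMSEQ_le_const2[OF tendsto_rabs[OF IJ(3)]]) (use bound in auto)
  moreover have "fcoef l (\<lambda>x. ser l a 0 x * ser l b 0 x) k = J"
    unfolding fcoef_def using integral_unique[OF IJ(2)] by (simp add: mult.assoc)
  ultimately show ?thesis by simp
qed

end

section \<open>Linear mode equations and symbol estimates\<close>

text \<open>For both signs \<open>\<sigma>\<close>, the function
  \<open>exp (\<mu> * t) * \<sigma> * y t\<close> minus a primitive of the majorant of the forcing
  is nonincreasing. The gain \<open>1 / (\<mu> + \<gamma>)\<close> is the smoothing on which all
  later estimates live; the weight \<open>\<gamma>\<close> makes it available for unstable modes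
  with negative \<open>\<mu>\<close>.\<close>

lemma ode_growth_bound:
  fixes y :: "real \<Rightarrow> real"
  assumes deriv: "\<And>t. t \<in> {0..T} \<Longrightarrow> (y has_real_derivative y' t) (at t within {0..T})"
    and G: "\<And>t. t \<in> {0..T} \<Longrightarrow> \<bar>y' t + \<mu> * y t\<bar> \<le> G * exp (\<gamma> * t)"
    and pos: "0 < \<mu> + \<gamma>" and t: "t \<in> {0..T}"
  shows "\<bar>y t\<bar> \<le> exp (\<gamma> * t) * (\<bar>y 0\<bar> + G / (\<mu> + \<gamma>))"
proof -
  have G0: "0 \<le> G" using order_trans[OF abs_ge_zero G[of 0]] t by simp
  have main: "exp (\<mu> * t) * (\<sigma> * y t) \<le> \<bar>y 0\<bar> + G / (\<mu> + \<gamma>) * exp ((\<mu> + \<gamma>) * t)" if \<sigma>: "\<bar>\<sigma>\<bar> = 1" for \<sigma> :: real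
  proof (cases "t = 0")
    case True
    have "\<sigma> * y 0 \<le> \<bar>y 0\<bar>" using abs_ge_self[of "\<sigma> * y 0"] \<sigma> by (simp add: abs_mult)
    thus ?thesis using True G0 pos by (simp add: add_increasing2)
  next
    case False
    hence t0: "0 < t" using t by simp
    define c where "c = G / (\<mu> + \<gamma>)"
    have c: "c * (\<mu> + \<gamma>) = G" using pos by (simp add: c_def)
    define h where "h s = exp (\<mu> * s) * (\<sigma> * y s) - c * exp ((\<mu> + \<gamma>) * s)" for s
    have h': "(h has_real_derivative (exp (\<mu> * s) * (\<sigma> * (y' s + \<mu> * y s)) - G * exp ((\<mu> + \<gamma>) * s))) (at s within {0..T})"
      if "s \<in> {0..T}" for s
      unfolding h_def c[symmetric]
      by (auto intro!: derivative_eq_intros deriv[OF that] simp: algebra_simps)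
    have nonpos: "exp (\<mu> * s) * (\<sigma> * (y' s + \<mu> * y s)) - G * exp ((\<mu> + \<gamma>) * s) \<le> 0" if "s \<in> {0..T}" for s
    proof -
      have "\<sigma> * (y' s + \<mu> * y s) \<le> \<bar>\<sigma> * (y' s + \<mu> * y s)\<bar>" by simp
      also have "\<dots> \<le> G * exp (\<gamma> * s)" using G[OF that] \<sigma> by (simp add: abs_mult)
      finally have "exp (\<mu> * s) * (\<sigma> * (y' s + \<mu> * y s)) \<le> exp (\<mu> * s) * (G * exp (\<gamma> * s))"
        by (intro mult_left_mono) auto
      moreover have "G * exp ((\<mu> + \<gamma>) * s) = exp (\<mu> * s) * (G * exp (\<gamma> * s))"
        by (simp add: distrib_right exp_add)
      ultimately show ?thesis by linarith
    qed
    have "h t \<le> h 0"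
    \<comment> \<open>Derivatives within \<open>{0..T}\<close> are one-sided at its ends, so the
      criterion is used that asks for them in the open interval only.\<close>
    proof (rule DERIV_nonpos_imp_decreasing_open[OF less_imp_le[OF t0]])
      fix s assume s: "0 < s" "s < t"
      hence "(h has_real_derivative (exp (\<mu> * s) * (\<sigma> * (y' s + \<mu> * y s)) - G * exp ((\<mu> + \<gamma>) * s))) (at s)"
        using h'[of s] t by (simp add: at_within_Icc_at)
      thus "\<exists>z. (h has_real_derivative z) (at s) \<and> z \<le> 0" using nonpos[of s] s t by auto
    next
      show "continuous_on {0..t} h"
        using h' t by (intro continuous_on_subset[OF DERIV_continuous_on, of "{0..T}"]) auto
    qed
    moreover have "h 0 \<le> \<bar>y 0\<bar>"
    proof -
      have "\<sigma> * y 0 \<le> \<bar>y 0\<bar>" using abs_ge_self[of "\<sigma> * y 0"] \<sigma> by (simp add: abs_mult)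
      moreover have "0 \<le> G / (\<mu> + \<gamma>)" using G0 pos by simp
      ultimately show ?thesis by (simp add: h_def c_def)
    qed
    ultimately show ?thesis by (simp add: h_def c_def)
  qed
  have "exp (\<mu> * t) * \<bar>y t\<bar> \<le> \<bar>y 0\<bar> + G / (\<mu> + \<gamma>) * exp ((\<mu> + \<gamma>) * t)"
    using main[of 1] main[of "-1"] by (cases "y t \<ge> 0") auto
  also have "\<dots> \<le> exp ((\<mu> + \<gamma>) * t) * \<bar>y 0\<bar> + G / (\<mu> + \<gamma>) * exp ((\<mu> + \<gamma>) * t)"
    using pos t mult_right_mono[of 1 "exp ((\<mu> + \<gamma>) * t)" "\<bar>y 0\<bar>"] by simp
  also have "\<dots> = exp (\<mu> * t) * (exp (\<gamma> * t) * (\<bar>y 0\<bar> + G / (\<mu> + \<gamma>)))"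
    by (simp add: distrib_right exp_add algebra_simps)
  finally show ?thesis by simp
qed

definition duhamel :: "real \<Rightarrow> (real \<Rightarrow> real) \<Rightarrow> real \<Rightarrow> real" where
  "duhamel \<mu> g t = exp (- \<mu> * t) * integral {0..t} (\<lambda>s. exp (\<mu> * s) * g s)"

lemma duhamel_0 [simp]: "duhamel \<mu> g 0 = 0"
  by (simp add: duhamel_def)

lemma duhamel_deriv:
  assumes g: "continuous_on {0..T} g" and t: "t \<in> {0..T}"
  shows "(duhamel \<mu> g has_real_derivative (g t - \<mu> * duhamel \<mu> g t)) (at t within {0..T})"
proof -
  have "((\<lambda>u. integral {0..u} (\<lambda>s. exp (\<mu> * s) * g s)) has_real_derivative exp (\<mu> * t) * g t) (at t within {0..T})"
    by (intro integral_has_real_derivative t continuous_intros g)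
  thus ?thesis unfolding duhamel_def
    by (auto intro!: derivative_eq_intros simp: exp_minus field_simps)
qed

section \<open>Bounds of the symbols, uniform in the small parameter\<close>

lemma Xe_ge_1: "0 \<le> \<epsilon> \<Longrightarrow> 1 \<le> Xe l \<epsilon> k"
  by (simp add: Xe_def lam_def)

lemma Xe_square: "0 \<le> \<epsilon> \<Longrightarrow> Xe l \<epsilon> k ^ 2 = 1 + 4 * \<epsilon> * lam l k"
  by (simp add: Xe_def lam_def)

context
  fixes \<epsilon> :: real
  assumes eps: "0 < \<epsilon>" "\<epsilon> \<le> 1"
begin

lemma bsym_ge: "Xe l \<epsilon> k ^ 2 \<le> bsym l \<epsilon> k"
proof -
  have "0 \<le> (1 + \<epsilon>) * (Xe l \<epsilon> k - 1)" using Xe_ge_1[of \<epsilon> l k] eps by simp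
  thus ?thesis by (simp add: bsym_def algebra_simps)
qed

lemma bsym_ge_1: "1 \<le> bsym l \<epsilon> k"
  using bsym_ge[of l k] power_mono[OF Xe_ge_1[of \<epsilon> l k], of 2] eps by simp

lemma bsym_le: "bsym l \<epsilon> k \<le> 3 * Xe l \<epsilon> k ^ 2"
proof -
  let ?X = "Xe l \<epsilon> k"
  have X: "1 \<le> ?X" using Xe_ge_1 eps by simp
  have "(1 + \<epsilon>) * ?X \<le> 2 * ?X ^ 2"
    using X eps by (simp add: power2_eq_square)
  thus ?thesis using eps by (simp add: bsym_def)
qed

lemma fsym_le: "\<bar>fsym l \<epsilon> k\<bar> \<le> 5 * Xe l \<epsilon> k ^ 3"
proof -
  let ?X = "Xe l \<epsilon> k"
  have X: "1 \<le> ?X" using Xe_ge_1 eps by simp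
  have p: "1 \<le> ?X ^ 3" "?X \<le> ?X ^ 3" "?X ^ 2 \<le> ?X ^ 3" "0 \<le> ?X ^ 2"
    using X power_increasing[of 1 3 ?X] power_increasing[of 2 3 ?X] by (auto simp: one_le_power)
  have "\<epsilon> * ?X \<le> 1 * ?X" "0 \<le> \<epsilon> * ?X" using X eps by (auto intro: mult_right_mono)
  hence "\<bar>?X ^ 3 - 3 * ?X ^ 2 - 4 * ?X - 4 * (\<epsilon> * ?X) + 4 + 4 * \<epsilon>\<bar> \<le> 20 * ?X ^ 3"
    using p eps X by (intro abs_leI) linarith+
  thus ?thesis by (simp add: fsym_def algebra_simps)
qed

lemma fsym_div_bsym_le: "\<bar>fsym l \<epsilon> k\<bar> / bsym l \<epsilon> k \<le> 5 * Xe l \<epsilon> k"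
proof -
  let ?X = "Xe l \<epsilon> k"
  have X: "1 \<le> ?X" using Xe_ge_1 eps by simp
  have "\<bar>fsym l \<epsilon> k\<bar> \<le> 5 * ?X * ?X ^ 2" using fsym_le[of l k] by (simp add: power3_eq_cube power2_eq_square mult.assoc)
  also have "\<dots> \<le> 5 * ?X * bsym l \<epsilon> k" using bsym_ge X by (intro mult_left_mono) auto
  finally show ?thesis using bsym_ge_1[of l k] by (simp add: divide_le_eq)
qed

text \<open>The numerator vanishes at \<open>X = 1\<close>, and
  \<open>X - 1 = 4 * \<epsilon> * lam l k / (X + 1)\<close> cancels the division by
  \<open>\<epsilon>\<close>. This keeps the bound uniform as \<open>\<epsilon>\<close> tends to
  0.\<close>

lemma hsym_le: "\<bar>hsym l \<epsilon> k\<bar> \<le> 8 * lam l k"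
proof -
  let ?X = "Xe l \<epsilon> k"
  have X: "1 \<le> ?X" using Xe_ge_1 eps by simp
  have "(?X - 1) * (?X + 1) = 4 * \<epsilon> * lam l k"
    using Xe_square[of \<epsilon> l k] eps by (simp add: power2_eq_square algebra_simps)
  hence X1: "?X - 1 = 4 * \<epsilon> * lam l k / (?X + 1)" using X by (simp add: eq_divide_eq)
  have "hsym l \<epsilon> k = (?X - 1) * (?X + 2 + \<epsilon>) / \<epsilon>"
    by (simp add: hsym_def power2_eq_square algebra_simps)
  also have "\<dots> = 4 * lam l k * ((?X + 2 + \<epsilon>) / (?X + 1))" using eps unfolding X1 by simp
  finally have "\<bar>hsym l \<epsilon> k\<bar> = 4 * lam l k * ((?X + 2 + \<epsilon>) / (?X + 1))"
    using X eps by (simp add: lam_def)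
  also have "\<dots> \<le> 4 * lam l k * 2" using X eps by (intro mult_left_mono) (auto simp: divide_le_eq lam_def)
  finally show ?thesis by simp
qed

text \<open>Again \<open>X = 1\<close> is a root of the numerator. The cofactor is quadratic, so one
  power of \<open>X\<close> is left after division by \<open>X + 1\<close>; 13 bounds the sum of its
  absolute coefficients \<open>1 + 2 + 6 + 4 * \<epsilon>\<close>.\<close>

lemma msym_le: "\<bar>msym l \<epsilon> k\<bar> \<le> 13 * lam l k * Xe l \<epsilon> k"
proof -
  let ?X = "Xe l \<epsilon> k"
  have X: "1 \<le> ?X" using Xe_ge_1 eps by simp
  have "(?X - 1) * (?X + 1) = 4 * \<epsilon> * lam l k"
    using Xe_square[of \<epsilon> l k] eps by (simp add: power2_eq_square algebra_simps)
  hence X1: "?X - 1 = 4 * \<epsilon> * lam l k / (?X + 1)" using X by (simp add: eq_divide_eq)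
  let ?q = "?X ^ 2 - 2 * ?X - 6 - 4 * \<epsilon>"
  have "msym l \<epsilon> k = (?X - 1) * ?q / (4 * \<epsilon>)"
    by (simp add: msym_def power2_eq_square power3_eq_cube algebra_simps)
  also have "\<dots> = lam l k * (?q / (?X + 1))" using eps unfolding X1 by simp
  finally have m: "\<bar>msym l \<epsilon> k\<bar> = lam l k * (\<bar>?q\<bar> / (?X + 1))"
    using X by (simp add: abs_mult lam_def)
  have "?X \<le> ?X ^ 2" "1 \<le> ?X ^ 2" using X power_increasing[of 1 2 ?X] by (auto simp: one_le_power)
  hence "\<bar>?q\<bar> \<le> 13 * ?X ^ 2" using X eps by (auto simp: abs_le_iff)
  also have "\<dots> \<le> 13 * ?X * (?X + 1)" using X by (simp add: power2_eq_square)
  finally have "\<bar>?q\<bar> / (?X + 1) \<le> 13 * ?X" using X by (simp add: divide_le_eq)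
  hence "lam l k * (\<bar>?q\<bar> / (?X + 1)) \<le> lam l k * (13 * ?X)" by (intro mult_left_mono) (auto simp: lam_def)
  thus ?thesis by (simp add: m)
qed

text \<open>Trades a factor \<open>X\<close> for a frequency factor free of
  \<open>\<epsilon>\<close>, that is, for one power of the weight.\<close>

lemma Xe_le:
  assumes "0 < l"
  shows "Xe l \<epsilon> k \<le> 1 + 2 * freq l k"
proof -
  have f: "0 \<le> freq l k" using assms by simp
  have "\<epsilon> * lam l k \<le> 1 * lam l k" using eps assms by (intro mult_right_mono) auto
  hence "1 + 4 * \<epsilon> * lam l k \<le> (1 + 2 * freq l k) ^ 2"
    using f by (simp add: lam_eq power2_eq_square algebra_simps)
  hence "Xe l \<epsilon> k \<le> sqrt ((1 + 2 * freq l k) ^ 2)" unfolding Xe_def by (rule real_sqrt_le_mono)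
  thus ?thesis using f by simp
qed

end

section \<open>The damping rate and the absorption of the coupling\<close>

definition rate :: "real \<Rightarrow> real \<Rightarrow> nat \<Rightarrow> real" where
  "rate l \<epsilon> k = (4 * lam l k ^ 2 - lam l k) / bsym l \<epsilon> k"

lemma quad_ge: "- (1 / 16) \<le> 4 * x ^ 2 - (x :: real)"
proof -
  have "0 \<le> (2 * x - 1 / 4) ^ 2" by simp
  thus ?thesis by (simp add: power2_eq_square algebra_simps)
qed

text \<open>The minimum of the numerator, attained at \<open>lam l k = 1 / 8\<close>, survives the
  division because the denominator is at least 1.\<close>

lemma rate_ge:
  assumes "0 < \<epsilon>" "\<epsilon> \<le> 1"
  shows "- (1 / 16) \<le> rate l \<epsilon> k"
proof (cases "0 \<le> 4 * lam l k ^ 2 - lam l k")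
  case True
  thus ?thesis using bsym_ge_1[OF assms, of l k] unfolding rate_def
    by (intro order_trans[OF _ divide_nonneg_nonneg]) auto
next
  case False
  hence "(4 * lam l k ^ 2 - lam l k) * bsym l \<epsilon> k \<le> (4 * lam l k ^ 2 - lam l k) * 1"
    using bsym_ge_1[OF assms, of l k] by (intro mult_left_mono_neg) auto
  hence "4 * lam l k ^ 2 - lam l k \<le> rate l \<epsilon> k"
    using bsym_ge_1[OF assms, of l k] unfolding rate_def by (simp add: le_divide_eq)
  thus ?thesis using quad_ge[of "lam l k"] by linarith
qed

text \<open>The split is at \<open>\<epsilon> * lam l k = 1\<close>. Below it
  \<open>X \<le> 3\<close> and \<open>bsym \<le> 15\<close>, so the symbols behave as for
  \<open>\<epsilon> = 0\<close>: the left side is linear in the frequency, the damping quartic, and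
  \<open>\<gamma>\<close> pays for the low modes. Above it \<open>bsym\<close> grows like
  \<open>\<epsilon> * lam\<close>, the damping is only \<open>lam / (5 * \<epsilon>)\<close> and the
  left side at most \<open>12 * lam\<close>; \<open>60 * \<epsilon> \<le> \<delta>\<close> closes
  the gap.\<close>

lemma fsym_absorption:
  assumes \<delta>: "0 < \<delta>" and eps: "0 < \<epsilon>" "\<epsilon> \<le> 1" "60 * \<epsilon> \<le> \<delta>" and \<gamma>: "15 / 4 + 57 / \<delta> ^ 2 \<le> \<gamma>" and l: "0 < l"
  shows "\<bar>fsym l \<epsilon> k\<bar> / bsym l \<epsilon> k * freq l k \<le> \<delta> * (rate l \<epsilon> k + \<gamma>)"
proof -
  let ?X = "Xe l \<epsilon> k" and ?b = "bsym l \<epsilon> k" and ?f = "freq l k"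
  define L where "L = lam l k"
  have f: "0 \<le> ?f" "L = ?f ^ 2" using l by (auto simp: L_def lam_eq)
  have L: "0 \<le> L" using f by simp
  have X: "1 \<le> ?X" "?X ^ 2 = 1 + 4 * (\<epsilon> * L)" using Xe_ge_1[of \<epsilon>] Xe_square[of \<epsilon> l k] eps by (auto simp: L_def)
  have b: "1 \<le> ?b" "?b \<le> 3 * ?X ^ 2" using bsym_ge_1[OF eps(1,2)] bsym_le[OF eps(1,2)] by auto
  have \<gamma>0: "0 \<le> \<gamma>"   proof -
    have "0 \<le> 57 / \<delta> ^ 2" by simp
    thus ?thesis using \<gamma> by linarith
  qed
  have "\<bar>fsym l \<epsilon> k\<bar> / ?b * ?f \<le> 5 * ?X * ?f"
    by (intro mult_right_mono fsym_div_bsym_le f eps)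
  also have "5 * ?X * ?f \<le> \<delta> * (rate l \<epsilon> k + \<gamma>)"
  proof (cases "\<epsilon> * L \<le> 1")
    case True
    have "?X ^ 2 \<le> 9" using True unfolding X(2) by linarith
    hence "?X ^ 2 \<le> 3 ^ 2" by simp
    hence X3: "?X \<le> 3" by (rule power2_le_imp_le) simp
    have b15: "?b \<le> 15" using b X True by linarith
    have "4 * L ^ 2 / 15 \<le> 4 * L ^ 2 / ?b" using b b15 by (intro divide_left_mono) auto
    moreover have "L / ?b \<le> L" using b L mult_left_mono[OF b(1) L] by (simp add: divide_le_eq)
    ultimately have r: "4 * L ^ 2 / 15 - L \<le> rate l \<epsilon> k" by (simp add: rate_def L_def diff_divide_distrib)
    \<comment> \<open>Origin of \<open>15 / 4\<close> in the hypothesis on \<open>\<gamma>\<close>: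
      one \<open>L\<close> compensates the negative part of the rate, the other one is kept for the
      left side.\<close>
    have "0 \<le> 4 / 15 * (L - 15 / 4) ^ 2" by simp
    hence "2 * L \<le> 4 * L ^ 2 / 15 + 15 / 4" by (simp add: power2_eq_square algebra_simps)
    hence "L + 57 / \<delta> ^ 2 \<le> rate l \<epsilon> k + \<gamma>" using r \<gamma> by linarith
    hence "\<delta> * (L + 57 / \<delta> ^ 2) \<le> \<delta> * (rate l \<epsilon> k + \<gamma>)" using \<delta> by (intro mult_left_mono) auto
    moreover have "5 * ?X * ?f \<le> 15 * ?f" using X3 f by (intro mult_right_mono) auto
    moreover have "15 * ?f \<le> \<delta> * (L + 57 / \<delta> ^ 2)"
    proof -
      \<comment> \<open>Origin of 57: completing the square needs \<open>225 / 4\<close>, and the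
        remaining \<open>3 / 4\<close> rounds it up.\<close>
      have "0 \<le> (\<delta> * ?f - 15 / 2) ^ 2 + 3 / 4" by simp
      hence "\<delta> * (15 * ?f) \<le> \<delta> ^ 2 * ?f ^ 2 + 57" by (simp add: power2_eq_square algebra_simps)
      also have "\<dots> = \<delta> * (\<delta> * (L + 57 / \<delta> ^ 2))" using \<delta> by (simp add: f power2_eq_square algebra_simps)
      finally show ?thesis using \<delta> by simp
    qed
    ultimately show ?thesis by linarith
  next
    case False
    hence eL: "1 \<le> \<epsilon> * L" by simp
    have "\<epsilon> * L \<le> 1 * L" using eps L by (intro mult_right_mono) auto
    hence L1: "1 \<le> L" using eL by simp
    have X5: "?X ^ 2 \<le> 5 * (\<epsilon> * L)" using eL unfolding X(2) by linarith
    hence b15: "?b \<le> 15 * (\<epsilon> * L)" using b by linarith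
    have "L * 1 \<le> L * L" using L1 by (intro mult_left_mono) auto
    hence L3: "3 * L ^ 2 \<le> 4 * L ^ 2 - L" by (simp add: power2_eq_square)
    have "0 \<le> 3 * L ^ 2" by simp
    hence "0 \<le> 4 * L ^ 2 - L" using L3 by linarith
    moreover have "0 < ?b" using b by linarith
    ultimately have "3 * L ^ 2 / (15 * (\<epsilon> * L)) \<le> (4 * L ^ 2 - L) / ?b"
      using L3 b15 by (intro frac_le)
    moreover have "3 * L ^ 2 / (15 * (\<epsilon> * L)) = L / (5 * \<epsilon>)" using L1 eps by (simp add: power2_eq_square)
    ultimately have r: "L / (5 * \<epsilon>) \<le> rate l \<epsilon> k" by (simp add: rate_def L_def)
    have "(5 * ?X * ?f) ^ 2 = 25 * L * ?X ^ 2" by (simp add: f power_mult_distrib)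
    also have "\<dots> \<le> 25 * L * (5 * (\<epsilon> * L))" using X5 L by (intro mult_left_mono) auto
    also have "\<dots> = 125 * (L ^ 2 * \<epsilon>)" by (simp add: power2_eq_square)
    \<comment> \<open>The next square above 125, so that the root can be taken without an irrational
      constant.\<close>
    also have "\<dots> \<le> 144 * (L ^ 2 * \<epsilon>)" using eps by (intro mult_right_mono) auto
    also have "\<dots> = (12 * L) ^ 2 * \<epsilon>" by (simp add: power_mult_distrib)
    also have "\<dots> \<le> (12 * L) ^ 2 * 1" using eps by (intro mult_left_mono) auto
    finally have "(5 * ?X * ?f) ^ 2 \<le> (12 * L) ^ 2" by (simp only: mult_1_right)
    hence "5 * ?X * ?f \<le> 12 * L" by (rule power2_le_imp_le) (use L in simp)
    also have "\<dots> \<le> \<delta> * (L / (5 * \<epsilon>))"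
    proof -
      have "12 * L * (5 * \<epsilon>) \<le> \<delta> * L" using mult_right_mono[OF eps(3) L] by (simp add: mult.commute mult.left_commute)
      hence "12 * L \<le> \<delta> * L / (5 * \<epsilon>)" using eps(1) by (subst pos_le_divide_eq) auto
      thus ?thesis by simp
    qed
    also have "\<dots> \<le> \<delta> * (rate l \<epsilon> k + \<gamma>)" using r \<gamma>0 \<delta> by (intro mult_left_mono) auto
    finally show ?thesis .
  qed
  finally show ?thesis .
qed

text \<open>Banach's theorem for a weighted supremum distance, expressed through inequalities so
  that no normed space of coefficient families has to be set up. Closedness is demanded only along
  sequences converging at the geometric rate that the iteration produces, and a vanishing weight
  forces equality.\<close>

lemma weighted_contraction_fixpoint:
  fixes w :: "'a \<Rightarrow> real" and \<Gamma> :: "('a \<Rightarrow> real) \<Rightarrow> 'a \<Rightarrow> real"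
  assumes w: "\<And>a. 0 \<le> w a"
    and ne: "u0 \<in> V"
    and bounded: "\<And>u a. u \<in> V \<Longrightarrow> \<bar>u a\<bar> \<le> R * w a"
    and maps: "\<And>u. u \<in> V \<Longrightarrow> \<Gamma> u \<in> V"
    and contr: "\<And>u v K. u \<in> V \<Longrightarrow> v \<in> V \<Longrightarrow> 0 \<le> K \<Longrightarrow> (\<And>a. \<bar>u a - v a\<bar> \<le> K * w a) \<Longrightarrow> (\<And>a. \<bar>\<Gamma> u a - \<Gamma> v a\<bar> \<le> K / 2 * w a)"
    and closed: "\<And>(s :: nat \<Rightarrow> 'a \<Rightarrow> real) u. (\<And>n. s n \<in> V) \<Longrightarrow> (\<And>n a. \<bar>s n a - u a\<bar> \<le> 4 * R / 2 ^ n * w a) \<Longrightarrow> u \<in> V"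
    and R: "0 \<le> R"
  shows "\<exists>u\<in>V. \<Gamma> u = u"
proof -
  define s where "s n = (\<Gamma> ^^ n) u0" for n
  have sV: "s n \<in> V" for n by (induction n) (auto simp: s_def ne maps)
  \<comment> \<open>Two elements of \<open>V\<close> differ by at most \<open>2 * R * w a\<close>;
    with ratio \<open>1 / 2\<close> the steps sum up to the \<open>4 * R\<close> of the closedness
    hypothesis.\<close>
  have step: "\<bar>s (Suc n) a - s n a\<bar> \<le> 2 * R / 2 ^ n * w a" for n a
  proof (induction n arbitrary: a)
    case 0
    show ?case using bounded[OF sV[of 0], of a] bounded[OF sV[of "Suc 0"], of a] by (simp add: abs_le_iff)
  next
    case (Suc n)
    have "\<bar>\<Gamma> (s (Suc n)) a - \<Gamma> (s n) a\<bar> \<le> 2 * R / 2 ^ n / 2 * w a"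
      by (rule contr[OF sV sV _ Suc.IH]) (use R in auto)
    thus ?case by (simp add: s_def)
  qed
  \<comment> \<open>The remainder is subtracted so that the induction closes; it is dropped in the
    next fact.\<close>
  have dist: "\<bar>s (n + m) a - s n a\<bar> \<le> (4 * R / 2 ^ n - 4 * R / 2 ^ (n + m)) * w a" for n m a
  proof (induction m)
    case (Suc m)
    have "\<bar>s (n + Suc m) a - s n a\<bar> \<le> \<bar>s (Suc (n + m)) a - s (n + m) a\<bar> + \<bar>s (n + m) a - s n a\<bar>" by simp
    also have "\<dots> \<le> 2 * R / 2 ^ (n + m) * w a + (4 * R / 2 ^ n - 4 * R / 2 ^ (n + m)) * w a"
      by (intro add_mono step Suc.IH)
    also have "\<dots> = (4 * R / 2 ^ n - 4 * R / 2 ^ (n + Suc m)) * w a" by (simp add: field_simps)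
    finally show ?case .
  qed simp
  have dist': "\<bar>s (n + m) a - s n a\<bar> \<le> 4 * R / 2 ^ n * w a" for n m a
    by (rule order_trans[OF dist], intro mult_right_mono w) (use R in auto)
  have "Cauchy (\<lambda>n. s n a)" for a
  proof (rule metric_CauchyI)
    fix e :: real assume e: "0 < e"
    have "(\<lambda>n. 4 * R * w a * (1 / 2) ^ n) \<longlonglongrightarrow> 4 * R * w a * 0"
      by (intro tendsto_mult tendsto_const LIMSEQ_power_zero) auto
    hence "eventually (\<lambda>n. 4 * R * w a * (1 / 2) ^ n < e / 2) sequentially"
      using e by (intro order_tendstoD) auto
    then obtain N where "4 * R * w a * (1 / 2) ^ N < e / 2" by (auto simp: eventually_sequentially)
    hence N: "4 * R / 2 ^ N * w a < e / 2" by (simp add: power_one_over field_simps)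
    show "\<exists>M. \<forall>m\<ge>M. \<forall>n\<ge>M. dist (s m a) (s n a) < e"
    proof (intro exI allI impI)
      fix m n assume "N \<le> m" "N \<le> n"
      then obtain i j where "m = N + i" "n = N + j" by (auto simp: le_iff_add)
      thus "dist (s m a) (s n a) < e"
        using dist'[of N i a] dist'[of N j a] N by (simp add: dist_real_def)
    qed
  qed
  hence "convergent (\<lambda>n. s n a)" for a by (rule Cauchy_convergent)
  then obtain u where u: "\<And>a. (\<lambda>n. s n a) \<longlonglongrightarrow> u a" unfolding convergent_def by metis
  have su: "\<bar>s n a - u a\<bar> \<le> 4 * R / 2 ^ n * w a" for n a
  proof -
    have "(\<lambda>m. \<bar>s (m + n) a - s n a\<bar>) \<longlonglongrightarrow> \<bar>u a - s n a\<bar>"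
      by (intro tendsto_intros LIMSEQ_ignore_initial_segment u)
    hence "\<bar>u a - s n a\<bar> \<le> 4 * R / 2 ^ n * w a"
      by (rule LIMSEQ_le_const2) (use dist'[of n _ a] in \<open>auto simp: add.commute\<close>)
    thus ?thesis by (simp add: abs_minus_commute)
  qed
  have uV: "u \<in> V" by (rule closed[of s, OF sV su])
  have "(\<lambda>n. s (Suc n) a) \<longlonglongrightarrow> \<Gamma> u a" for a
  proof (rule LIM_zero_cancel, rule Lim_null_comparison)
    show "\<forall>\<^sub>F n in sequentially. norm (s (Suc n) a - \<Gamma> u a) \<le> 2 * R * w a * (1 / 2) ^ n"
    proof (intro always_eventually allI)
      fix n
      have "\<bar>\<Gamma> (s n) a - \<Gamma> u a\<bar> \<le> 4 * R / 2 ^ n / 2 * w a"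
        by (rule contr[OF sV uV _ su]) (use R in auto)
      thus "norm (s (Suc n) a - \<Gamma> u a) \<le> 2 * R * w a * (1 / 2) ^ n"
        by (simp add: s_def power_one_over field_simps)
    qed
    have "(\<lambda>n. 2 * R * w a * (1 / 2) ^ n) \<longlonglongrightarrow> 2 * R * w a * 0"
      by (intro tendsto_mult tendsto_const LIMSEQ_power_zero) auto
    thus "(\<lambda>n. 2 * R * w a * (1 / 2) ^ n) \<longlonglongrightarrow> 0" by simp
  qed
  hence "\<Gamma> u a = u a" for a
    using LIMSEQ_unique[OF _ LIMSEQ_Suc[OF u[of a]]] by blast
  thus ?thesis using uV by auto
qed

section \<open>Averaging a pointwise time derivative\<close>

text \<open>Nothing is assumed on the integrability of \<open>G\<close>: by Fatou's lemma the approximations \<open>S n\<close> converge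
  to it in the mean, and then \<open>G (\<cdot>, x)\<close> is Lebesgue integrable for almost every \<open>x\<close>, where the gauge
  integral of the derivative coincides with the Lebesgue integral.\<close>

lemma mean_of_pointwise_derivative:
  fixes S :: "nat \<Rightarrow> real \<times> real \<Rightarrow> real" and G :: "real \<times> real \<Rightarrow> real" and U :: "real \<Rightarrow> real \<Rightarrow> real" and a b t :: real
  defines "R \<equiv> cbox (0, a) (t, b)"
  assumes t: "0 \<le> t"
    and cont: "\<And>n. continuous_on R (S n)"
    and lim: "\<And>p. p \<in> R \<Longrightarrow> (\<lambda>n. S n p) \<longlonglongrightarrow> G p"
    and cauchy: "\<And>e. e > 0 \<Longrightarrow> \<exists>N. \<forall>n\<ge>N. \<forall>m\<ge>N. integral R (\<lambda>p. \<bar>S n p - S m p\<bar>) \<le> e"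
    and deriv: "\<And>x s. x \<in> {a..b} \<Longrightarrow> s \<in> {0..t} \<Longrightarrow> ((\<lambda>s. U s x) has_real_derivative G (s, x)) (at s within {0..t})"
    and contU: "continuous_on {a..b} (U 0)" "continuous_on {a..b} (U t)"
    and \<phi>: "continuous_on {a..b} \<phi>"
  shows "(\<lambda>n. integral R (\<lambda>p. S n p * \<phi> (snd p))) \<longlonglongrightarrow> integral {a..b} (\<lambda>x. (U t x - U 0 x) * \<phi> x)"
proof -
  have R: "compact R" "R \<in> sets borel" by (auto simp: R_def)
  have R_iff: "(s, x) \<in> R \<longleftrightarrow> s \<in> {0..t} \<and> x \<in> {a..b}" for s x by (auto simp: R_def)
  have Rsnd: "snd p \<in> {a..b}" if "p \<in> R" for p using that R_iff[of "fst p" "snd p"] by simp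
  define F where "F n p = indicator R p *\<^sub>R S n p" for n p
  define H where "H p = indicator R p *\<^sub>R G p" for p
  define \<psi> where "\<psi> x = indicator {a..b} x *\<^sub>R \<phi> x" for x
  have intR: "integrable lborel (\<lambda>p. indicator R p *\<^sub>R h p)" if "continuous_on R h" for h :: "real \<times> real \<Rightarrow> real"
    by (rule borel_integrable_compact[OF R(1) that])
  have F_int: "integrable lborel (F n)" for n unfolding F_def by (rule intR[OF cont])
  have F_meas [measurable]: "F n \<in> borel_measurable lborel" for n by (rule borel_measurable_integrable[OF F_int])
  have F_lim: "(\<lambda>n. F n p) \<longlonglongrightarrow> H p" for p
    unfolding F_def H_def by (cases "p \<in> R") (auto intro: lim)
  have H_meas [measurable]: "H \<in> borel_measurable lborel"
    by (rule borel_measurable_LIMSEQ_real[OF F_lim]) measurable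
  have \<psi>_meas [measurable]: "\<psi> \<in> borel_measurable borel"
    unfolding \<psi>_def using \<phi> by (intro borel_measurable_continuous_on_indicator) auto
  have "compact (\<phi> ` {a..b})" using \<phi> by (intro compact_continuous_image) auto
  then obtain C where C: "\<forall>x\<in>{a..b}. \<bar>\<phi> x\<bar> \<le> C"
    unfolding real_norm_def[symmetric] using compact_imp_bounded bounded_iff by (metis imageI)
  define C' where "C' = max C 0"
  have \<psi>_le: "\<bar>\<psi> x\<bar> \<le> C'" for x using C by (auto simp: \<psi>_def C'_def indicator_def le_max_iff_disj)
  have C'0: "0 \<le> C'" by (simp add: C'_def)
  have FF: "(LINT p|lborel. \<bar>F n p - F m p\<bar>) = integral R (\<lambda>p. \<bar>S n p - S m p\<bar>)" for n m
  proof -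
    have "continuous_on R (\<lambda>p. \<bar>S n p - S m p\<bar>)" by (intro continuous_intros cont)
    from set_borel_integral_eq_integral(2)[of R "\<lambda>p. \<bar>S n p - S m p\<bar>"] intR[OF this]
    have "(LINT p|lborel. indicator R p *\<^sub>R \<bar>S n p - S m p\<bar>) = integral R (\<lambda>p. \<bar>S n p - S m p\<bar>)"
      by (simp add: set_integrable_def set_lebesgue_integral_def)
    moreover have "\<bar>F n p - F m p\<bar> = indicator R p *\<^sub>R \<bar>S n p - S m p\<bar>" for p
      by (simp add: F_def indicator_def)
    ultimately show ?thesis by simp
  qed
  \<comment> \<open>Fatou's lemma in the second index: for fixed \<open>n\<close> the mean distance
    to the pointwise limit is at most the lower limit of the distances to \<open>F m\<close>, which
    the Cauchy property controls.\<close>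
  have close: "\<exists>N. \<forall>n\<ge>N. (\<integral>\<^sup>+p. ennreal \<bar>F n p - H p\<bar> \<partial>lborel) \<le> ennreal e" if e: "e > 0" for e
  proof -
    obtain N where N: "\<And>n m. n \<ge> N \<Longrightarrow> m \<ge> N \<Longrightarrow> integral R (\<lambda>p. \<bar>S n p - S m p\<bar>) \<le> e"
      using cauchy[OF e] by blast
    have "(\<integral>\<^sup>+p. ennreal \<bar>F n p - H p\<bar> \<partial>lborel) \<le> ennreal e" if n: "n \<ge> N" for n
    proof -
      have "(\<lambda>m. ennreal \<bar>F n p - F m p\<bar>) \<longlonglongrightarrow> ennreal \<bar>F n p - H p\<bar>" for p
        by (intro tendsto_ennrealI tendsto_intros F_lim)
      hence "ennreal \<bar>F n p - H p\<bar> = liminf (\<lambda>m. ennreal \<bar>F n p - F m p\<bar>)" for p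
        by (intro lim_imp_Liminf[symmetric]) auto
      hence "(\<integral>\<^sup>+p. ennreal \<bar>F n p - H p\<bar> \<partial>lborel) = (\<integral>\<^sup>+p. liminf (\<lambda>m. ennreal \<bar>F n p - F m p\<bar>) \<partial>lborel)" by simp
      also have "\<dots> \<le> liminf (\<lambda>m. \<integral>\<^sup>+p. ennreal \<bar>F n p - F m p\<bar> \<partial>lborel)"
        by (rule nn_integral_liminf) measurable
      also have "\<dots> \<le> ennreal e"
      proof (rule Liminf_le)
        show "\<forall>\<^sub>F m in sequentially. (\<integral>\<^sup>+p. ennreal \<bar>F n p - F m p\<bar> \<partial>lborel) \<le> ennreal e"
          unfolding eventually_sequentially
        proof (intro exI allI impI)
          fix m assume m: "N \<le> m"
          have "(\<integral>\<^sup>+p. ennreal \<bar>F n p - F m p\<bar> \<partial>lborel) = ennreal (LINT p|lborel. \<bar>F n p - F m p\<bar>)"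
            by (rule nn_integral_eq_integral) (auto intro!: integrable_abs Bochner_Integration.integrable_diff F_int)
          also have "\<dots> \<le> ennreal e" unfolding FF by (intro ennreal_leI N n m)
          finally show "(\<integral>\<^sup>+p. ennreal \<bar>F n p - F m p\<bar> \<partial>lborel) \<le> ennreal e" .
        qed
      qed simp
      finally show ?thesis .
    qed
    thus ?thesis by blast
  qed
  have diff_int: "integrable lborel (\<lambda>p. F n p - H p)" if "(\<integral>\<^sup>+p. ennreal \<bar>F n p - H p\<bar> \<partial>lborel) \<le> ennreal e" for n e
  proof (rule integrableI_bounded)
    have "(\<integral>\<^sup>+p. ennreal (norm (F n p - H p)) \<partial>lborel) \<le> ennreal e" using that by simp
    also have "\<dots> < \<infinity>" by simp
    finally show "(\<integral>\<^sup>+p. ennreal (norm (F n p - H p)) \<partial>lborel) < \<infinity>" .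
  qed measurable
  have H_int: "integrable lborel H"
  proof -
    obtain N where "(\<integral>\<^sup>+p. ennreal \<bar>F N p - H p\<bar> \<partial>lborel) \<le> ennreal 1" using close[of 1] by auto
    from Bochner_Integration.integrable_diff[OF F_int[of N] diff_int[OF this]] show ?thesis by simp
  qed
  have mult_int: "integrable lborel (\<lambda>p. h p * \<psi> (snd p))" if h: "integrable lborel h" for h :: "real \<times> real \<Rightarrow> real"
  proof (rule Bochner_Integration.integrable_bound[OF integrable_mult_left[OF integrable_abs[OF h], of C']])
    have [measurable]: "h \<in> borel_measurable lborel" using h by auto
    have "(\<lambda>p::real \<times> real. \<psi> (snd p)) \<in> borel_measurable borel"
      by (rule measurable_compose[OF _ \<psi>_meas]) (simp add: borel_measurable_continuous_onI continuous_on_snd)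
    thus "(\<lambda>p. h p * \<psi> (snd p)) \<in> borel_measurable lborel" by measurable
    show "AE p in lborel. norm (h p * \<psi> (snd p)) \<le> norm (\<bar>h p\<bar> * C')"
      using \<psi>_le C'0 by (auto simp: abs_mult intro!: mult_left_mono)
  qed
  have conv: "(\<lambda>n. LINT p|lborel. F n p * \<psi> (snd p)) \<longlonglongrightarrow> (LINT p|lborel. H p * \<psi> (snd p))"
  proof (rule LIMSEQ_I)
    fix e :: real assume e: "0 < e"
    define d where "d = e / (2 * (C' + 1))"
    have d: "0 < d" using e C'0 by (simp add: d_def)
    obtain N where N: "\<And>n. n \<ge> N \<Longrightarrow> (\<integral>\<^sup>+p. ennreal \<bar>F n p - H p\<bar> \<partial>lborel) \<le> ennreal d" using close[OF d] by blast
    show "\<exists>N. \<forall>n\<ge>N. norm ((LINT p|lborel. F n p * \<psi> (snd p)) - (LINT p|lborel. H p * \<psi> (snd p))) < e"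
    proof (intro exI allI impI)
      fix n assume n: "N \<le> n"
      note di = diff_int[OF N[OF n]]
      have "ennreal (LINT p|lborel. \<bar>F n p - H p\<bar>) = (\<integral>\<^sup>+p. ennreal \<bar>F n p - H p\<bar> \<partial>lborel)"
        by (rule nn_integral_eq_integral[symmetric]) (auto intro: integrable_abs di)
      hence "ennreal (LINT p|lborel. \<bar>F n p - H p\<bar>) \<le> ennreal d" using N[OF n] by (simp only:)
      hence le: "(LINT p|lborel. \<bar>F n p - H p\<bar>) \<le> d" using ennreal_le_iff[OF less_imp_le[OF d]] by blast
      have "(LINT p|lborel. F n p * \<psi> (snd p)) - (LINT p|lborel. H p * \<psi> (snd p)) = (LINT p|lborel. (F n p - H p) * \<psi> (snd p))"
        unfolding left_diff_distrib
        by (rule Bochner_Integration.integral_diff[symmetric]) (intro mult_int F_int H_int)+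
      also have "norm \<dots> \<le> (LINT p|lborel. \<bar>F n p - H p\<bar> * C')"
      proof (rule order_trans[OF Bochner_Integration.integral_norm_bound Bochner_Integration.integral_mono])
        show "integrable lborel (\<lambda>p. \<bar>F n p - H p\<bar> * C')" by (intro integrable_mult_left integrable_abs di)
        show "norm ((F n p - H p) * \<psi> (snd p)) \<le> \<bar>F n p - H p\<bar> * C'" for p
          using \<psi>_le by (auto simp: abs_mult intro!: mult_left_mono)
        show "integrable lborel (\<lambda>p. norm ((F n p - H p) * \<psi> (snd p)))"
          by (rule integrable_norm[OF mult_int[OF di]])
      qed
      also have "\<dots> = (LINT p|lborel. \<bar>F n p - H p\<bar>) * C'" by simp
      also have "\<dots> \<le> d * C'" by (intro mult_right_mono le C'0)
      also have "\<dots> < e" using e C'0 by (simp add: d_def divide_simps)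
      finally show "norm ((LINT p|lborel. F n p * \<psi> (snd p)) - (LINT p|lborel. H p * \<psi> (snd p))) < e" .
    qed
  qed
  have F_eq: "(LINT p|lborel. F n p * \<psi> (snd p)) = integral R (\<lambda>p. S n p * \<phi> (snd p))" for n
  proof -
    have "continuous_on R (\<lambda>p. S n p * \<phi> (snd p))"
      by (intro continuous_intros cont continuous_on_compose2[OF \<phi>]) (use Rsnd in auto)
    from set_borel_integral_eq_integral(2)[of R "\<lambda>p. S n p * \<phi> (snd p)"] intR[OF this]
    have "(LINT p|lborel. indicator R p *\<^sub>R (S n p * \<phi> (snd p))) = integral R (\<lambda>p. S n p * \<phi> (snd p))"
      by (simp add: set_integrable_def set_lebesgue_integral_def)
    moreover have "F n p * \<psi> (snd p) = indicator R p *\<^sub>R (S n p * \<phi> (snd p))" for p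
      using Rsnd[of p] by (auto simp: F_def \<psi>_def indicator_def)
    ultimately show ?thesis by simp
  qed
  have Hp: "integrable (lborel \<Otimes>\<^sub>M lborel) (\<lambda>(s, x). H (s, x))" using H_int by (simp add: lborel_prod)
  have Hp\<psi>: "integrable (lborel \<Otimes>\<^sub>M lborel) (\<lambda>(s, x). H (s, x) * \<psi> x)"
    using mult_int[OF H_int] by (simp add: lborel_prod case_prod_beta')
  have inner: "(LINT s|lborel. H (s, x) * \<psi> x) = indicator {a..b} x *\<^sub>R ((U t x - U 0 x) * \<phi> x)"
    if i: "integrable lborel (\<lambda>s. H (s, x))" for x
  proof (cases "x \<in> {a..b}")
    case True
    have eq: "H (s, x) = indicator {0..t} s *\<^sub>R G (s, x)" for s
      using True by (auto simp: H_def indicator_def R_iff)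
    have "set_integrable lborel {0..t} (\<lambda>s. G (s, x))" using i by (simp add: set_integrable_def eq)
    from set_borel_integral_eq_integral(2)[OF this]
    have "(LINT s|lborel. H (s, x)) = integral {0..t} (\<lambda>s. G (s, x))"
      by (simp add: set_lebesgue_integral_def eq)
    also have "((\<lambda>s. G (s, x)) has_integral (U t x - U 0 x)) {0..t}"
      using deriv[OF True] t
      by (intro fundamental_theorem_of_calculus) (auto simp: has_real_derivative_iff_has_vector_derivative)
    hence "integral {0..t} (\<lambda>s. G (s, x)) = U t x - U 0 x" by (rule integral_unique)
    finally show ?thesis using True by (simp add: \<psi>_def)
  qed (simp add: \<psi>_def)
  have contUd: "continuous_on {a..b} (\<lambda>x. (U t x - U 0 x) * \<phi> x)" by (intro continuous_intros contU \<phi>)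
  have "(LINT p|lborel. H p * \<psi> (snd p)) = (LINT p|(lborel \<Otimes>\<^sub>M lborel). (case p of (s, x) \<Rightarrow> H (s, x) * \<psi> x))"
    by (simp add: lborel_prod case_prod_beta')
  also have "\<dots> = (LINT x|lborel. (LINT s|lborel. H (s, x) * \<psi> x))"
    by (rule lborel_pair.integral_snd[symmetric]) (use Hp\<psi> in simp)
  also have "\<dots> = (LINT x|lborel. indicator {a..b} x *\<^sub>R ((U t x - U 0 x) * \<phi> x))"
  proof (rule integral_cong_AE)
    show "(\<lambda>x. LINT s|lborel. H (s, x) * \<psi> x) \<in> borel_measurable lborel"
      by (rule borel_measurable_integrable, rule lborel_pair.integrable_snd) (use Hp\<psi> in simp)
    show "(\<lambda>x. indicator {a..b} x *\<^sub>R ((U t x - U 0 x) * \<phi> x)) \<in> borel_measurable lborel"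
      by (rule borel_measurable_integrable, rule borel_integrable_compact[OF _ contUd]) simp
    have "AE x in lborel. integrable lborel (\<lambda>s. H (s, x))"
      by (rule lborel_pair.AE_integrable_snd) (use Hp in simp)
    thus "AE x in lborel. (LINT s|lborel. H (s, x) * \<psi> x) = indicator {a..b} x *\<^sub>R ((U t x - U 0 x) * \<phi> x)"
      by eventually_elim (rule inner)
  qed
  also have "\<dots> = integral {a..b} (\<lambda>x. (U t x - U 0 x) * \<phi> x)"
    using set_borel_integral_eq_integral(2)[of "{a..b}" "\<lambda>x. (U t x - U 0 x) * \<phi> x"] borel_integrable_compact[OF _ contUd]
    by (simp add: set_integrable_def set_lebesgue_integral_def)
  finally show ?thesis using conv by (simp add: F_eq)
qed

section \<open>Smoothness of the Kuramoto-Sivashinsky solution\<close>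

lemma fcoef_time_deriv:
  assumes "time_deriv I u ut" "creg I 0 u" "convex I" "\<tau> \<in> I"
  shows "((\<lambda>s. fcoef l (u s) k) has_real_derivative fcoef l (ut \<tau>) k) (at \<tau> within I)"
  unfolding fcoef_def interval_cbox
proof (rule leibniz_rule_field_derivative[OF _ _ _ assms(4,3)])
  show "((\<lambda>s. u s x * wk l k x) has_real_derivative ut s x * wk l k x) (at s within I)" if "s \<in> I" for s x
    using assms(1) that unfolding time_deriv_def by (intro DERIV_cmult_right) blast
  show "(\<lambda>x. u s x * wk l k x) integrable_on cbox (- l / 2) (l / 2)" if "s \<in> I" for s
  proof -
    have "continuous_on UNIV (u s)"
    proof -
      have "continuous_on UNIV (\<lambda>x::real. (s, x))" by (intro continuous_intros)
      thus ?thesis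
        using continuous_on_compose2[of "I \<times> UNIV" "\<lambda>p. u (fst p) (snd p)" UNIV "\<lambda>x. (s, x)"] assms(2) that
        by (auto simp: creg_0)
    qed
    hence "continuous_on (cbox (- l / 2) (l / 2)) (u s)" by (rule continuous_on_subset) simp
    thus ?thesis unfolding wk_eq by (intro integrable_continuous continuous_intros)
  qed
  have "continuous_on (I \<times> cbox (- l / 2) (l / 2)) (\<lambda>p. ut (fst p) (snd p))"
    using assms(1) unfolding time_deriv_def by (blast intro: continuous_on_subset)
  thus "continuous_on (I \<times> cbox (- l / 2) (l / 2)) (\<lambda>(s, x). ut s x * wk l k x)"
    unfolding wk_eq case_prod_beta by (intro continuous_intros)
qed

section \<open>Coefficient decay from classical and from Sobolev regularity\<close>

lemma creg_bounded:
  assumes "creg {0..T} n u" "r \<le> n"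
  shows "\<exists>M\<ge>0. \<forall>\<tau>\<in>{0..T}. \<forall>x\<in>{-l/2..l/2}. \<bar>pd r (u \<tau>) x\<bar> \<le> M"
proof -
  have "continuous_on ({0..T} \<times> {-l/2..l/2}) (\<lambda>p. pd r (u (fst p)) (snd p))"
    using assms unfolding creg_def by (blast intro: continuous_on_subset)
  hence "compact ((\<lambda>p. pd r (u (fst p)) (snd p)) ` ({0..T} \<times> {-l/2..l/2}))"
    by (intro compact_continuous_image compact_Times) auto
  then obtain M where "\<forall>p\<in>{0..T} \<times> {-l/2..l/2}. \<bar>pd r (u (fst p)) (snd p)\<bar> \<le> M"
    unfolding real_norm_def[symmetric] using compact_imp_bounded bounded_iff by (metis (no_types, lifting) imageI)
  hence "\<forall>\<tau>\<in>{0..T}. \<forall>x\<in>{-l/2..l/2}. \<bar>pd r (u \<tau>) x\<bar> \<le> max M 0" by force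
  thus ?thesis by (intro exI[of _ "max M 0"]) auto
qed

lemma fcoef_decay_uniform:
  assumes "0 < l" "creg {0..T} n u" "\<And>\<tau>. \<tau> \<in> {0..T} \<Longrightarrow> periodic l (u \<tau>)"
  shows "\<exists>K\<ge>0. \<forall>\<tau>\<in>{0..T}. \<forall>k. \<bar>fcoef l (u \<tau>) k\<bar> \<le> K * wt k ^ n"
proof -
  obtain M0 where M0: "M0 \<ge> 0" "\<forall>\<tau>\<in>{0..T}. \<forall>x\<in>{-l/2..l/2}. \<bar>pd 0 (u \<tau>) x\<bar> \<le> M0"
    using creg_bounded[OF assms(2), of 0 l] by auto
  obtain Mn where Mn: "Mn \<ge> 0" "\<forall>\<tau>\<in>{0..T}. \<forall>x\<in>{-l/2..l/2}. \<bar>pd n (u \<tau>) x\<bar> \<le> Mn"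
    using creg_bounded[OF assms(2), of n l] by auto
  have "\<bar>fcoef l (u \<tau>) k\<bar> \<le> decay_const l n * (M0 + Mn) * wt k ^ n" if "\<tau> \<in> {0..T}" for \<tau> k
  proof (rule fcoef_decay[OF assms(1) creg_imp_cper[OF assms(2) that assms(3)[OF that]]])
    fix x assume "x \<in> {-l/2..l/2}"
    with M0 Mn that have "\<bar>pd 0 (u \<tau>) x\<bar> \<le> M0" "\<bar>pd n (u \<tau>) x\<bar> \<le> Mn" by blast+
    thus "\<bar>u \<tau> x\<bar> \<le> M0 + Mn" "\<bar>pd n (u \<tau>) x\<bar> \<le> M0 + Mn" using M0(1) Mn(1) by auto
  qed
  moreover have "0 \<le> decay_const l n * (M0 + Mn)" using assms(1) M0(1) Mn(1) by (simp add: decay_const_def)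
  ultimately show ?thesis by blast
qed

text \<open>Comparison constant of \<open>(1 + jk k) ^ 2\<close> with the Sobolev weight
  \<open>1 + lam l k\<close>, see \<open>inverse_wt_square_le\<close>.\<close>

definition weight_const :: "real \<Rightarrow> real" where
  "weight_const l = 2 * (1 + (l / (2 * pi)) ^ 2)"

definition ks_rhs :: "real \<Rightarrow> (real \<Rightarrow> real) \<Rightarrow> nat \<Rightarrow> real" where
  "ks_rhs l f k = - (4 * lam l k ^ 2 - lam l k) * fcoef l f k - fcoef l (\<lambda>x. (pd (Suc 0) f x)^2) k / 2"

text \<open>Coefficients of the time derivative of \<open>\<Psi>\<close>: the rule of
  \<open>fcoef_pd_1\<close> applied to the right-hand side of the equation for
  \<open>\<Phi>\<close>.\<close>

definition ks_slope :: "real \<Rightarrow> (real \<Rightarrow> real) \<Rightarrow> nat \<Rightarrow> real" where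
  "ks_slope l f k = - sg k * freq l k * ks_rhs l f (pk k)"

context
  fixes l :: real
  assumes l_pos: "0 < l"
begin

lemma freq_power_wt_le:
  assumes "r \<le> 4"
  shows "freq l k ^ r * wt k ^ (r + s) \<le> (1 + 2 * pi / l) ^ 4 * wt k ^ s"
proof -
  have "(2 * pi / l) ^ r \<le> (1 + 2 * pi / l) ^ r" using l_pos by (intro power_mono) auto
  also have "\<dots> \<le> (1 + 2 * pi / l) ^ 4" using l_pos by (intro power_increasing assms) auto
  finally show ?thesis using freq_power_wt[OF l_pos, of k r s]
    by (meson mult_right_mono order_trans wt_nonneg zero_le_power)
qed

lemma conv_const_nonneg: "0 \<le> conv_const l p"
  using l_pos by (simp add: conv_const_def)

lemma weight_const_pos: "0 < weight_const l"
  by (simp add: weight_const_def add_pos_nonneg)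

lemma inverse_wt_square_le: "1 \<le> weight_const l * (1 + lam l k) * wt k ^ 2"
proof -
  define j where "j = real (jk k)"
  have c: "(l / (2 * pi)) ^ 2 * lam l k = j ^ 2"
    using l_pos by (simp add: lam_eq freq_def j_def power_mult_distrib power_divide)
  have "(1 + j) ^ 2 \<le> 2 * (1 + j ^ 2)"
    using sum_squares_bound[of 1 j] by (simp add: power2_eq_square algebra_simps)
  also have "\<dots> \<le> 2 * ((1 + (l / (2 * pi)) ^ 2) * (1 + lam l k))"
  proof -
    have "(1 + (l / (2 * pi)) ^ 2) * (1 + lam l k) = 1 + lam l k + (l / (2 * pi)) ^ 2 + (l / (2 * pi)) ^ 2 * lam l k"
      by (simp add: algebra_simps)
    moreover have "0 \<le> lam l k" "0 \<le> (l / (2 * pi)) ^ 2" using l_pos by auto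
    ultimately have "1 + j ^ 2 \<le> (1 + (l / (2 * pi)) ^ 2) * (1 + lam l k)" unfolding c by linarith
    thus ?thesis by (rule mult_left_mono) simp
  qed
  finally have "(1 + j) ^ 2 \<le> weight_const l * (1 + lam l k)" by (simp only: weight_const_def mult.assoc)
  moreover have "0 < (1 + j) ^ 2" by (simp add: j_def add_pos_nonneg)
  ultimately show ?thesis by (simp add: wt_def j_def[symmetric] power_one_over divide_simps)
qed

text \<open>The terms of the convergent Sobolev series are bounded; taking roots gives decay of the
  Sobolev order.\<close>

lemma Hsharp_decay:
  assumes "Hsharp l m f" "n \<le> m"
  shows "\<exists>K\<ge>0. \<forall>k. \<bar>fcoef l f k\<bar> \<le> K * wt k ^ n"
proof -
  let ?c = "fcoef l f"
  let ?D = "weight_const l"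
  have "summable (\<lambda>k. (1 + lam l k) ^ m * (?c k)^2)" using assms by (simp add: Hsharp_def)
  hence "(\<lambda>k. (1 + lam l k) ^ m * (?c k)^2) \<longlonglongrightarrow> 0" by (rule summable_LIMSEQ_zero)
  hence "Bseq (\<lambda>k. (1 + lam l k) ^ m * (?c k)^2)" using convergentI by (intro convergent_imp_Bseq) blast
  then obtain B where B: "B > 0" "\<And>k. \<bar>(1 + lam l k) ^ m * (?c k)^2\<bar> \<le> B" by (auto simp: Bseq_def)
  have "\<bar>?c k\<bar> \<le> sqrt (?D ^ n * B) * wt k ^ n" for k
  proof (rule power2_le_imp_le)
    have L: "0 \<le> lam l k" using l_pos by simp
    have "1 \<le> (?D * (1 + lam l k) * wt k ^ 2) ^ n" by (rule one_le_power[OF inverse_wt_square_le])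
    hence "(?c k)^2 \<le> (?c k)^2 * (?D * (1 + lam l k) * wt k ^ 2) ^ n" by (simp add: mult_le_cancel_left1)
    also have "\<dots> = ?D ^ n * ((1 + lam l k) ^ n * (?c k)^2) * (wt k ^ n) ^ 2"
      by (simp add: power_mult_distrib power_mult[symmetric] mult.commute)
    also have "\<dots> \<le> ?D ^ n * B * (wt k ^ n) ^ 2"
    proof (intro mult_right_mono mult_left_mono)
      have "(1 + lam l k) ^ n * (?c k)^2 \<le> (1 + lam l k) ^ m * (?c k)^2"
        using L assms(2) by (intro mult_right_mono power_increasing) auto
      thus "(1 + lam l k) ^ n * (?c k)^2 \<le> B" using B(2)[of k] by linarith
    qed (use weight_const_pos in auto)
    also have "\<dots> = (sqrt (?D ^ n * B) * wt k ^ n) ^ 2"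
      using B(1) weight_const_pos by (simp add: power_mult_distrib)
    finally show "\<bar>?c k\<bar> ^ 2 \<le> (sqrt (?D ^ n * B) * wt k ^ n) ^ 2" by simp
  qed (use B(1) weight_const_pos in auto)
  thus ?thesis using B(1) weight_const_pos by (intro exI[of _ "sqrt (?D ^ n * B)"]) auto
qed

lemma fcoef_pd_1_decay:
  assumes "cper l (Suc 0) f" "\<And>k. \<bar>fcoef l f k\<bar> \<le> K * wt k ^ (Suc p)"
  shows "\<bar>fcoef l (pd (Suc 0) f) k\<bar> \<le> 2 * pi / l * K * wt k ^ p"
proof -
  have K: "0 \<le> K" by (rule decay_bound_nonneg[OF assms(2)])
  have "\<bar>fcoef l (pd (Suc 0) f) k\<bar> = freq l k * \<bar>fcoef l f (pk k)\<bar>"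
    using freq_nonneg[OF l_pos, of k] by (simp add: fcoef_pd_1[OF l_pos assms(1)] abs_mult)
  also have "\<dots> \<le> freq l k * (K * wt k ^ (1 + p))"
    using assms(2)[of "pk k"] freq_nonneg[OF l_pos, of k] by (intro mult_left_mono) auto
  also have "\<dots> = K * (freq l k ^ 1 * wt k ^ (1 + p))" by simp
  also have "\<dots> \<le> K * ((2 * pi / l) ^ 1 * wt k ^ p)" by (intro mult_left_mono freq_power_wt l_pos K)
  finally show ?thesis by (simp add: mult_ac)
qed

lemma fcoef_mult_decay:
  assumes "cper l 2 f" "cper l 2 g" "\<And>k. \<bar>fcoef l f k\<bar> \<le> A * wt k ^ p" "\<And>k. \<bar>fcoef l g k\<bar> \<le> B * wt k ^ p" "2 \<le> p"
  shows "\<bar>fcoef l (\<lambda>x. f x * g x) k\<bar> \<le> conv_const l p * A * B * wt k ^ p"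
proof -
  have "f x = ser l (fcoef l f) 0 x" "g x = ser l (fcoef l g) 0 x" for x
    by (rule fourier_inversion[OF l_pos assms(1)], rule fourier_inversion[OF l_pos assms(2)])
  hence "(\<lambda>x. f x * g x) = (\<lambda>x. ser l (fcoef l f) 0 x * ser l (fcoef l g) 0 x)" by simp
  thus ?thesis using fcoef_product[OF l_pos assms(3,4,5)] by simp
qed

lemma fcoef_square_decay:
  assumes "cper l 2 v" "\<And>k. \<bar>fcoef l v k\<bar> \<le> A * wt k ^ p" "2 \<le> p"
  shows "\<bar>fcoef l (\<lambda>x. (v x)^2) k\<bar> \<le> conv_const l p * A * A * wt k ^ p"
  unfolding power2_eq_square by (rule fcoef_mult_decay[OF assms(1,1,2,2,3)])

section \<open>The mode equations of the Kuramoto-Sivashinsky flow and the bootstrap\<close>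

lemma ks_mode:
  assumes "ks_solution l Phi0 Phi" "0 \<le> \<tau>"
  shows "((\<lambda>s. fcoef l (Phi s) k) has_real_derivative ks_rhs l (Phi \<tau>) k) (at \<tau> within {0..})"
proof -
  obtain Phit where Phit: "time_deriv {0..} Phi Phit"
    "\<And>\<tau> x. 0 \<le> \<tau> \<Longrightarrow> Phit \<tau> x + 4 * pd 4 (Phi \<tau>) x + pd 2 (Phi \<tau>) x + (pd 1 (Phi \<tau>) x)^2 / 2 = 0"
    using assms(1) unfolding ks_solution_def by blast
  have reg: "creg {0..} 4 Phi" and per: "periodic l (Phi \<tau>)" using assms unfolding ks_solution_def by auto
  have c4: "cper l 4 (Phi \<tau>)" by (rule creg_imp_cper[OF reg _ per]) (use assms in auto)
  have c2: "cper l 2 (pd 2 (Phi \<tau>))" using c4 by (intro cper_pd_2) (simp add: eval_nat_numeral)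
  have c3: "cper l 3 (pd (Suc 0) (Phi \<tau>))" using cper_pd[of l 3 "Phi \<tau>"] c4 by (simp add: eval_nat_numeral)
  let ?J = "{-l/2..l/2}"
  let ?q = "\<lambda>x. (pd (Suc 0) (Phi \<tau>) x)^2"
  have cont: "continuous_on ?J (pd 4 (Phi \<tau>))" "continuous_on ?J (pd 2 (Phi \<tau>))" "continuous_on ?J ?q"
    using c4 cper_continuous[OF c2] cper_continuous[OF c3]
    by (auto simp: cper_def creg_const_iff intro: continuous_on_subset intro!: continuous_intros)
  have "Phit \<tau> = (\<lambda>x. (- 4) * pd 4 (Phi \<tau>) x + ((- 1) * pd 2 (Phi \<tau>) x + (- (1 / 2)) * ?q x))"
    using Phit(2)[OF assms(2)] by (auto simp: fun_eq_iff algebra_simps) (smt (verit))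
  hence "fcoef l (Phit \<tau>) k = fcoef l (\<lambda>x. (- 4) * pd 4 (Phi \<tau>) x) k + (fcoef l (\<lambda>x. (- 1) * pd 2 (Phi \<tau>) x) k + fcoef l (\<lambda>x. (- (1 / 2)) * ?q x) k)"
    by (simp only:) (subst fcoef_add, (intro continuous_intros cont)+, subst fcoef_add, (intro continuous_intros cont)+, rule refl)
  also have "\<dots> = (- 4) * fcoef l (pd 4 (Phi \<tau>)) k + ((- 1) * fcoef l (pd 2 (Phi \<tau>)) k + (- (1 / 2)) * fcoef l ?q k)"
    by (simp only: fcoef_cmult)
  also have "fcoef l (pd 4 (Phi \<tau>)) k = lam l k ^ 2 * fcoef l (Phi \<tau>) k" by (rule fcoef_pd_4[OF l_pos c4])
  also have "fcoef l (pd 2 (Phi \<tau>)) k = - lam l k * fcoef l (Phi \<tau>) k"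
    by (rule fcoef_pd_2[OF l_pos cper_mono[OF c4]]) simp
  finally have "fcoef l (Phit \<tau>) k = ks_rhs l (Phi \<tau>) k"
    by (simp add: ks_rhs_def algebra_simps)
  moreover have "creg {0..} 0 Phi" by (rule creg_mono[OF reg]) simp
  ultimately show ?thesis
    using fcoef_time_deriv[OF Phit(1), of \<tau> l k] assms(2) by (simp add: convex_real_interval)
qed

text \<open>The fourth-order damping is worth four powers of the weight. The summand 1 is the time
  weight \<open>\<gamma> = 1\<close> of the bootstrap and keeps the denominator positive on the
  unstable modes.\<close>

lemma inverse_parabolic_le: "1 / (4 * lam l k ^ 2 - lam l k + 1) \<le> 2 * weight_const l ^ 2 * wt k ^ 4"
proof -
  define L where "L = lam l k"
  \<comment> \<open>This is the difference of the two sides of the next inequality.\<close>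
  have "0 \<le> (1 - 2 * L) ^ 2 + 3 * L ^ 2" by simp
  hence *: "(1 + L) ^ 2 \<le> 2 * (4 * L ^ 2 - L + 1)" by (simp add: power2_eq_square algebra_simps)
  have pos: "0 < 4 * L ^ 2 - L + 1" using quad_ge[of L] by linarith
  have "1 \<le> (weight_const l * (1 + L) * wt k ^ 2) ^ 2"
    by (rule one_le_power) (use inverse_wt_square_le in \<open>simp add: L_def\<close>)
  also have "\<dots> = (1 + L) ^ 2 * (weight_const l ^ 2 * wt k ^ 4)" by (simp add: power_mult_distrib)
  also have "\<dots> \<le> 2 * (4 * L ^ 2 - L + 1) * (weight_const l ^ 2 * wt k ^ 4)"
    by (intro mult_right_mono *) auto
  finally have "1 \<le> 2 * weight_const l ^ 2 * wt k ^ 4 * (4 * L ^ 2 - L + 1)" by (simp only: mult_ac)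
  thus ?thesis unfolding L_def[symmetric] by (subst pos_divide_le_eq[OF pos])
qed

text \<open>Starting from order \<open>p + 1\<close>, the space derivative loses one power, the
  square keeps order \<open>p\<close> by the convolution bound, and the damping returns four. The
  initial value caps the result at 13.\<close>

lemma ks_bootstrap:
  assumes ks: "ks_solution l Phi0 Phi" and init: "\<And>k. \<bar>fcoef l Phi0 k\<bar> \<le> K0 * wt k ^ 13" and K0: "0 \<le> K0"
    and K: "\<And>\<tau> k. \<tau> \<in> {0..T} \<Longrightarrow> \<bar>fcoef l (Phi \<tau>) k\<bar> \<le> K * wt k ^ Suc p"
    and p: "2 \<le> p" "p + 4 \<le> 13"
  shows "\<exists>K'. \<forall>\<tau>\<in>{0..T}. \<forall>k. \<bar>fcoef l (Phi \<tau>) k\<bar> \<le> K' * wt k ^ (p + 4)"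
proof -
  define A where "A = 2 * pi / l * K"
  define C where "C = conv_const l p * A * A / 2"
  have reg: "creg {0..} 4 Phi" and per: "\<And>\<tau>. 0 \<le> \<tau> \<Longrightarrow> periodic l (Phi \<tau>)" and Phi0: "Phi 0 = Phi0"
    using ks unfolding ks_solution_def by auto
  have C0: "0 \<le> C" unfolding C_def
    using mult_nonneg_nonneg[OF conv_const_nonneg zero_le_square, of p A] by (simp add: mult.assoc)
  have c4: "cper l 4 (Phi \<tau>)" if "\<tau> \<in> {0..T}" for \<tau>
    by (rule creg_imp_cper[OF reg]) (use that per in auto)
  have sq: "\<bar>fcoef l (\<lambda>x. (pd (Suc 0) (Phi \<tau>) x)^2) k / 2\<bar> \<le> C * wt k ^ p" if "\<tau> \<in> {0..T}" for \<tau> k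
  proof -
    have "cper l 3 (pd (Suc 0) (Phi \<tau>))" using cper_pd[of l 3 "Phi \<tau>"] c4[OF that] by (simp add: eval_nat_numeral)
    hence c: "cper l 2 (pd (Suc 0) (Phi \<tau>))" by (rule cper_mono) simp
    have "\<bar>fcoef l (pd (Suc 0) (Phi \<tau>)) k\<bar> \<le> A * wt k ^ p" for k
      unfolding A_def by (rule fcoef_pd_1_decay[OF cper_mono[OF c4[OF that]] K[OF that]]) simp
    from fcoef_square_decay[OF c this p(1), of k] show ?thesis by (simp add: C_def)
  qed
  have "\<bar>fcoef l (Phi t) k\<bar> \<le> exp T * (K0 + C * (2 * weight_const l ^ 2)) * wt k ^ (p + 4)" if t: "t \<in> {0..T}" for t k
  proof -
    let ?\<mu> = "4 * lam l k ^ 2 - lam l k"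
    have "\<bar>fcoef l (Phi t) k\<bar> \<le> exp (1 * t) * (\<bar>fcoef l (Phi 0) k\<bar> + C * wt k ^ p / (?\<mu> + 1))"
    proof (rule ode_growth_bound[OF _ _ _ t])
      show "((\<lambda>s. fcoef l (Phi s) k) has_real_derivative ks_rhs l (Phi s) k) (at s within {0..T})" if "s \<in> {0..T}" for s
        by (rule has_field_derivative_subset[OF ks_mode[OF ks]]) (use that in auto)
      show "\<bar>ks_rhs l (Phi s) k + ?\<mu> * fcoef l (Phi s) k\<bar> \<le> C * wt k ^ p * exp (1 * s)" if "s \<in> {0..T}" for s
      proof -
        have "\<bar>ks_rhs l (Phi s) k + ?\<mu> * fcoef l (Phi s) k\<bar> = \<bar>fcoef l (\<lambda>x. (pd (Suc 0) (Phi s) x)^2) k / 2\<bar>"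
          by (simp add: ks_rhs_def algebra_simps)
        also have "\<dots> \<le> C * wt k ^ p * 1" using sq[OF that] by simp
        also have "\<dots> \<le> C * wt k ^ p * exp (1 * s)" using that C0 by (intro mult_left_mono) auto
        finally show ?thesis .
      qed
      show "0 < ?\<mu> + 1" using quad_ge[of "lam l k"] by linarith
    qed
    also have "\<dots> \<le> exp T * (K0 * wt k ^ (p + 4) + C * (2 * weight_const l ^ 2) * wt k ^ (p + 4))"
    proof (intro mult_mono add_mono)
      show "\<bar>fcoef l (Phi 0) k\<bar> \<le> K0 * wt k ^ (p + 4)"
        unfolding Phi0 by (rule decay_mono[OF init p(2)])
      have "C * wt k ^ p * (1 / (?\<mu> + 1)) \<le> C * wt k ^ p * (2 * weight_const l ^ 2 * wt k ^ 4)"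
        by (intro mult_left_mono inverse_parabolic_le) (use C0 in auto)
      thus "C * wt k ^ p / (?\<mu> + 1) \<le> C * (2 * weight_const l ^ 2) * wt k ^ (p + 4)"
        by (simp add: power_add mult_ac)
      show "0 \<le> \<bar>fcoef l (Phi 0) k\<bar> + C * wt k ^ p / (?\<mu> + 1)"
      proof -
        have "0 \<le> ?\<mu> + 1" using quad_ge[of "lam l k"] by linarith
        thus ?thesis
          by (rule add_nonneg_nonneg[OF abs_ge_zero divide_nonneg_nonneg[OF mult_nonneg_nonneg[OF C0]], rotated]) simp
      qed
    qed (use t in auto)
    finally show ?thesis by (simp add: algebra_simps)
  qed
  thus ?thesis by blast
qed

text \<open>Order 4 is what four continuous derivatives give; the orders then run through 7 and 10
  to 13.\<close>

lemma ks_decay: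
  assumes ks: "ks_solution l Phi0 Phi" and init: "Hsharp l m Phi0" "13 \<le> m"
  shows "\<exists>K. \<forall>\<tau>\<in>{0..T}. \<forall>k. \<bar>fcoef l (Phi \<tau>) k\<bar> \<le> K * wt k ^ 13"
proof -
  obtain K0 where K0: "0 \<le> K0" "\<And>k. \<bar>fcoef l Phi0 k\<bar> \<le> K0 * wt k ^ 13" using Hsharp_decay[OF init] by auto
  have "creg {0..T} 4 Phi" using ks creg_subset[of "{0..}" 4 Phi "{0..T}"] unfolding ks_solution_def by auto
  then obtain K where K: "\<forall>\<tau>\<in>{0..T}. \<forall>k. \<bar>fcoef l (Phi \<tau>) k\<bar> \<le> K * wt k ^ Suc 3"
    using fcoef_decay_uniform[OF l_pos, of T 4 Phi] ks unfolding ks_solution_def by (auto simp: eval_nat_numeral)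
  from ks_bootstrap[OF ks K0(2) K0(1), of T K 3] K obtain K1 where
    K1: "\<forall>\<tau>\<in>{0..T}. \<forall>k. \<bar>fcoef l (Phi \<tau>) k\<bar> \<le> K1 * wt k ^ Suc 6" by (auto simp: eval_nat_numeral)
  from ks_bootstrap[OF ks K0(2) K0(1), of T K1 6] K1 obtain K2 where
    K2: "\<forall>\<tau>\<in>{0..T}. \<forall>k. \<bar>fcoef l (Phi \<tau>) k\<bar> \<le> K2 * wt k ^ Suc 9" by (auto simp: eval_nat_numeral)
  from ks_bootstrap[OF ks K0(2) K0(1), of T K2 9] K2 show ?thesis by (auto simp: eval_nat_numeral)
qed

lemma ks_rhs_decay:
  assumes "cper l 4 f" and K: "\<And>k. \<bar>fcoef l f k\<bar> \<le> K * wt k ^ 13"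
  shows "\<bar>ks_rhs l f k\<bar> \<le> (5 * (1 + 2 * pi / l) ^ 4 * K + conv_const l 12 * (2 * pi / l * K) * (2 * pi / l * K)) * wt k ^ 9"
proof -
  have K0: "0 \<le> K" by (rule decay_bound_nonneg[OF K])
  let ?c = "1 + 2 * pi / l"
  have c: "1 \<le> ?c" using l_pos by simp

  have "lam l k ^ 2 * \<bar>fcoef l f k\<bar> \<le> lam l k ^ 2 * (K * wt k ^ 13)" by (intro mult_left_mono K) auto
  also have "\<dots> = K * (freq l k ^ 4 * wt k ^ (4 + 9))" by (simp add: lam_eq power_mult[symmetric])
  also have "\<dots> \<le> K * (?c ^ 4 * wt k ^ 9)" by (intro mult_left_mono freq_power_wt_le K0) auto
  finally have 1: "lam l k ^ 2 * \<bar>fcoef l f k\<bar> \<le> K * (?c ^ 4 * wt k ^ 9)" .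
  have "lam l k * \<bar>fcoef l f k\<bar> \<le> lam l k * (K * wt k ^ 13)" using l_pos by (intro mult_left_mono K) auto
  also have "\<dots> = K * (freq l k ^ 2 * wt k ^ (2 + 11))" by (simp add: lam_eq)
  also have "\<dots> \<le> K * (?c ^ 4 * wt k ^ 11)" by (intro mult_left_mono freq_power_wt_le K0) auto
  also have "\<dots> \<le> K * (?c ^ 4 * wt k ^ 9)" using c by (intro mult_left_mono wt_power_antimono K0) auto
  finally have 2: "lam l k * \<bar>fcoef l f k\<bar> \<le> K * (?c ^ 4 * wt k ^ 9)" .
  let ?A = "2 * pi / l * K"
  have "cper l 3 (pd (Suc 0) f)" using cper_pd[of l 3 f] assms(1) by (simp add: eval_nat_numeral)
  hence c2: "cper l 2 (pd (Suc 0) f)" by (rule cper_mono) simp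
  have K': "\<bar>fcoef l f k\<bar> \<le> K * wt k ^ Suc 12" for k using K[of k] by (simp add: eval_nat_numeral)
  have "\<bar>fcoef l (pd (Suc 0) f) k\<bar> \<le> ?A * wt k ^ 12" for k
    by (rule fcoef_pd_1_decay[OF cper_mono[OF assms(1)] K']) simp
  from fcoef_square_decay[OF c2 this, of k]
  have "\<bar>fcoef l (\<lambda>x. (pd (Suc 0) f x)^2) k\<bar> \<le> conv_const l 12 * ?A * ?A * wt k ^ 12" by simp
  hence 3: "\<bar>fcoef l (\<lambda>x. (pd (Suc 0) f x)^2) k\<bar> \<le> conv_const l 12 * ?A * ?A * wt k ^ 9"
    by (rule decay_mono) simp
  have "\<bar>ks_rhs l f k\<bar> \<le> 4 * (lam l k ^ 2 * \<bar>fcoef l f k\<bar>) + lam l k * \<bar>fcoef l f k\<bar> + \<bar>fcoef l (\<lambda>x. (pd (Suc 0) f x)^2) k\<bar>"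
  proof -
    have "ks_rhs l f k = - 4 * (lam l k ^ 2 * fcoef l f k) + lam l k * fcoef l f k - fcoef l (\<lambda>x. (pd (Suc 0) f x)^2) k / 2"
      by (simp add: ks_rhs_def algebra_simps)
    moreover have "lam l k ^ 2 * \<bar>fcoef l f k\<bar> = \<bar>lam l k ^ 2 * fcoef l f k\<bar>" by (simp add: abs_mult)
    moreover have "lam l k * \<bar>fcoef l f k\<bar> = \<bar>lam l k * fcoef l f k\<bar>" using l_pos by (simp add: abs_mult)
    ultimately show ?thesis by linarith
  qed
  also have "\<dots> \<le> 4 * (K * (?c ^ 4 * wt k ^ 9)) + K * (?c ^ 4 * wt k ^ 9) + conv_const l 12 * ?A * ?A * wt k ^ 9"
    using 1 2 3 by linarith
  also have "\<dots> = (5 * ?c ^ 4 * K + conv_const l 12 * ?A * ?A) * wt k ^ 9" by (simp only: distrib_right) simp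
  finally show ?thesis .
qed

text \<open>From order 13 one derivative leaves 12. The time derivative of \<open>\<Phi>\<close>
  loses four powers, and its space derivative one more, which gives 8. The bound depends on
  \<open>T\<close>, since each bootstrap step contributes a factor \<open>exp T\<close>.\<close>

lemma ks_regularity:
  assumes ks: "ks_solution l Phi0 Phi" and init: "Hsharp l m Phi0" "13 \<le> m"
  obtains \<psi> \<psi>' where
    "\<And>\<tau>. 0 \<le> \<tau> \<Longrightarrow> pd (Suc 0) (Phi \<tau>) = ser l (\<psi> \<tau>) 0"
    "\<And>\<tau> k. 0 \<le> \<tau> \<Longrightarrow> ((\<lambda>s. \<psi> s k) has_real_derivative \<psi>' \<tau> k) (at \<tau> within {0..})"
    "\<And>k. continuous_on {0..} (\<lambda>\<tau>. \<psi>' \<tau> k)"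
    "\<And>T. \<exists>P\<ge>0. \<forall>\<tau>\<in>{0..T}. \<forall>k. \<bar>\<psi> \<tau> k\<bar> \<le> P * wt k ^ 12 \<and> \<bar>\<psi>' \<tau> k\<bar> \<le> P * wt k ^ 8"
proof
  let ?\<psi> = "\<lambda>\<tau>. fcoef l (pd (Suc 0) (Phi \<tau>))"
  let ?\<psi>' = "\<lambda>\<tau>. ks_slope l (Phi \<tau>)"
  have reg: "creg {0..} 4 Phi" and per: "\<And>\<tau>. 0 \<le> \<tau> \<Longrightarrow> periodic l (Phi \<tau>)"
    using ks unfolding ks_solution_def by auto
  have c4: "cper l 4 (Phi \<tau>)" if "0 \<le> \<tau>" for \<tau>
    by (rule creg_imp_cper[OF reg]) (use that per in auto)
  have c3: "cper l 3 (pd (Suc 0) (Phi \<tau>))" if "0 \<le> \<tau>" for \<tau>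
    using cper_pd[of l 3 "Phi \<tau>"] c4[OF that] by (simp add: eval_nat_numeral)
  have \<psi>_eq: "?\<psi> \<tau> k = - sg k * freq l k * fcoef l (Phi \<tau>) (pk k)" if "0 \<le> \<tau>" for \<tau> k
    by (rule fcoef_pd_1[OF l_pos cper_mono[OF c4[OF that]]]) simp
  show "pd (Suc 0) (Phi \<tau>) = ser l (?\<psi> \<tau>) 0" if "0 \<le> \<tau>" for \<tau>
    by (rule ext, rule fourier_inversion[OF l_pos cper_mono[OF c3[OF that]]]) simp
  show "((\<lambda>s. ?\<psi> s k) has_real_derivative ?\<psi>' \<tau> k) (at \<tau> within {0..})" if "0 \<le> \<tau>" for \<tau> k
  proof (rule has_field_derivative_transform_within[where d = 1])
    show "((\<lambda>s. - sg k * freq l k * fcoef l (Phi s) (pk k)) has_real_derivative ?\<psi>' \<tau> k) (at \<tau> within {0..})"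
      unfolding ks_slope_def by (intro DERIV_cmult ks_mode[OF ks that])
  qed (use that \<psi>_eq in auto)
  show "continuous_on {0..} (\<lambda>\<tau>. ?\<psi>' \<tau> k)" for k
  proof -
    have "creg {0..} 3 (\<lambda>\<tau>. pd (Suc 0) (Phi \<tau>))" using reg by (simp add: eval_nat_numeral creg_Suc)
    hence "creg {0..} 0 (\<lambda>\<tau>. pd (Suc 0) (Phi \<tau>))" by (rule creg_mono) simp
    hence c1: "continuous_on ({0..} \<times> UNIV) (\<lambda>p. pd (Suc 0) (Phi (fst p)) (snd p))" by (simp add: creg_0)
    have "continuous_on ({0..} \<times> UNIV) (\<lambda>p. Phi (fst p) (snd p))"
      using creg_mono[OF reg, of 0] by (simp add: creg_0)
    moreover have "continuous_on ({0..} \<times> UNIV) (\<lambda>p. (pd (Suc 0) (Phi (fst p)) (snd p))^2)"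
      by (intro continuous_intros c1)
    ultimately show ?thesis unfolding ks_slope_def ks_rhs_def
      by (intro continuous_intros fcoef_continuous c1) auto
  qed
  fix T
  obtain K where K: "\<And>\<tau> k. \<tau> \<in> {0..T} \<Longrightarrow> \<bar>fcoef l (Phi \<tau>) k\<bar> \<le> K * wt k ^ 13"
    using ks_decay[OF ks init] by blast
  define K' where "K' = 5 * (1 + 2 * pi / l) ^ 4 * K + conv_const l 12 * (2 * pi / l * K) * (2 * pi / l * K)"
  define P where "P = \<bar>2 * pi / l * K\<bar> + \<bar>2 * pi / l * K'\<bar>"
  have "\<bar>?\<psi> \<tau> k\<bar> \<le> P * wt k ^ 12" if "\<tau> \<in> {0..T}" for \<tau> k
  proof -
    have "\<bar>?\<psi> \<tau> k\<bar> \<le> 2 * pi / l * K * wt k ^ 12"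
      by (rule fcoef_pd_1_decay[OF cper_mono[OF c4]]) (use that K in \<open>auto simp: eval_nat_numeral\<close>)
    also have "\<dots> \<le> P * wt k ^ 12" by (intro mult_right_mono) (unfold P_def, linarith, simp)
    finally show ?thesis .
  qed
  moreover have "\<bar>?\<psi>' \<tau> k\<bar> \<le> P * wt k ^ 8" if "\<tau> \<in> {0..T}" for \<tau> k
  proof -
    have r: "\<bar>ks_rhs l (Phi \<tau>) (pk k)\<bar> \<le> K' * wt k ^ 9"
      unfolding K'_def using ks_rhs_decay[OF c4 K[OF that], of "pk k"] that by simp
    have K'0: "0 \<le> K'" by (rule decay_bound_nonneg[OF r])
    have "\<bar>?\<psi>' \<tau> k\<bar> = freq l k * \<bar>ks_rhs l (Phi \<tau>) (pk k)\<bar>"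
      using freq_nonneg[OF l_pos, of k] by (simp add: ks_slope_def abs_mult)
    also have "\<dots> \<le> freq l k * (K' * wt k ^ 9)" by (intro mult_left_mono r freq_nonneg l_pos)
    also have "\<dots> = K' * (freq l k ^ 1 * wt k ^ (1 + 8))" by simp
    also have "\<dots> \<le> K' * ((2 * pi / l) ^ 1 * wt k ^ 8)" by (intro mult_left_mono freq_power_wt l_pos K'0)
    also have "\<dots> = 2 * pi / l * K' * wt k ^ 8" by simp
    also have "\<dots> \<le> P * wt k ^ 8"
      by (rule mult_right_mono, rule order_trans[OF abs_ge_self]) (simp_all add: P_def)
    finally show ?thesis .
  qed
  moreover have "0 \<le> P" by (simp add: P_def)
  ultimately show "\<exists>P\<ge>0. \<forall>\<tau>\<in>{0..T}. \<forall>k. \<bar>?\<psi> \<tau> k\<bar> \<le> P * wt k ^ 12 \<and> \<bar>?\<psi>' \<tau> k\<bar> \<le> P * wt k ^ 8" by blast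
qed

end

section \<open>Existence\<close>

definition zforce :: "real \<Rightarrow> real \<Rightarrow> (real \<Rightarrow> real) \<Rightarrow> (real \<Rightarrow> real) \<Rightarrow> (real \<Rightarrow> real) \<Rightarrow> nat \<Rightarrow> real" where
  "zforce l \<epsilon> \<Psi> \<Psi>t z k = - (hsym l \<epsilon> k * fcoef l \<Psi>t k)
     + msym l \<epsilon> k * fcoef l (pd (Suc 0) (\<lambda>x. (\<Psi> x)^2)) k
     + \<epsilon> * (fsym l \<epsilon> k * fcoef l (pd (Suc 0) (\<lambda>x. (z x)^2)) k)
     + 2 * (fsym l \<epsilon> k * fcoef l (pd (Suc 0) (\<lambda>x. \<Psi> x * z x)) k)"

definition zrhs :: "real \<Rightarrow> real \<Rightarrow> (real \<Rightarrow> real) \<Rightarrow> (real \<Rightarrow> real) \<Rightarrow> (real \<Rightarrow> real) \<Rightarrow> nat \<Rightarrow> real" where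
  "zrhs l \<epsilon> \<Psi> \<Psi>t z k = zforce l \<epsilon> \<Psi> \<Psi>t z k - (4 * lam l k ^ 2 - lam l k) * fcoef l z k"

text \<open>The 8 is the constant of \<open>hsym_le\<close>; 39 is the 13 of \<open>msym_le\<close>
  times the 3 that comes from \<open>X \<le> 1 + 2 * freq l k\<close>. The fourth power covers up to
  four frequency factors.\<close>

definition forcing_const :: "real \<Rightarrow> real \<Rightarrow> real" where
  "forcing_const l P = (1 + 2 * pi / l) ^ 4 * (8 * P + 39 * (conv_const l 12 * P * P))"

text \<open>The last condition lets the coupling consume at most a quarter of the weighted damping, for
  solutions of size \<open>Y\<close> and \<open>\<Psi>\<close> of size \<open>P\<close>; \<open>conv_const l 2\<close> serves the uniqueness and
  \<open>conv_const l 6\<close> the existence.\<close>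

definition good_params :: "real \<Rightarrow> real \<Rightarrow> real \<Rightarrow> real \<Rightarrow> real \<Rightarrow> bool" where
  "good_params l P Y \<epsilon> \<gamma> \<longleftrightarrow> 0 < \<epsilon> \<and> \<epsilon> \<le> 1 \<and> 3 \<le> \<gamma> \<and> \<epsilon> * Y \<le> 1 \<and>
     (\<forall>k. \<bar>fsym l \<epsilon> k\<bar> / bsym l \<epsilon> k * freq l k * ((conv_const l 2 + conv_const l 6) * (2 + 2 * P)) \<le> (rate l \<epsilon> k + \<gamma>) / 4)"

section \<open>The forcing and its Lipschitz bound\<close>

lemma zforce_continuous:
  fixes T :: real
  assumes "creg {0..T} (Suc 0) \<Psi>" "creg {0..T} 0 \<Psi>t" "creg {0..T} (Suc 0) z"
  shows "continuous_on {0..T} (\<lambda>s. zforce l \<epsilon> (\<Psi> s) (\<Psi>t s) (z s) k)"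
proof -
  have 1: "continuous_on ({0..T} \<times> UNIV) (\<lambda>p. pd (Suc 0) (\<lambda>x. u (fst p) x * v (fst p) x) (snd p))"
    if "creg {0..T} (Suc 0) u" "creg {0..T} (Suc 0) v" for u v
    using creg_mult[OF that] by (simp add: creg_def)
  have 2: "continuous_on ({0..T} \<times> UNIV) (\<lambda>p. \<Psi>t (fst p) (snd p))" using assms(2) by (simp add: creg_0)
  show ?thesis unfolding zforce_def power2_eq_square
    by (intro continuous_intros fcoef_continuous 1 2 assms)
qed

context
  fixes l :: real
  assumes l_pos: "0 < l"
begin

text \<open>The terms without \<open>\<zeta>\<close> cancel, and the difference of squares and the
  bilinear term share the factor \<open>z1 - z2\<close>. One product remains, so one convolution
  bound suffices.\<close>

lemma zforce_diff:
  assumes \<Psi>: "cper l 2 \<Psi>" and z1: "cper l 2 z1" and z2: "cper l 2 z2"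
  shows "zforce l \<epsilon> \<Psi> \<Psi>t z1 k - zforce l \<epsilon> \<Psi> \<Psi>t z2 k
     = - fsym l \<epsilon> k * sg k * freq l k * fcoef l (\<lambda>x. (\<epsilon> * (z1 x + z2 x) + 2 * \<Psi> x) * (z1 x - z2 x)) (pk k)"
proof -
  note c = cper_continuous[OF \<Psi>] cper_continuous[OF z1] cper_continuous[OF z2]
  have eq: "(\<lambda>x. (\<epsilon> * (z1 x + z2 x) + 2 * \<Psi> x) * (z1 x - z2 x))
     = (\<lambda>x. \<epsilon> * (z1 x * z1 x - z2 x * z2 x) + 2 * (\<Psi> x * z1 x - \<Psi> x * z2 x))"
    by (rule ext) (simp add: algebra_simps)
  have main: "fcoef l (\<lambda>x. (\<epsilon> * (z1 x + z2 x) + 2 * \<Psi> x) * (z1 x - z2 x)) j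
     = \<epsilon> * (fcoef l (\<lambda>x. z1 x * z1 x) j - fcoef l (\<lambda>x. z2 x * z2 x) j)
       + 2 * (fcoef l (\<lambda>x. \<Psi> x * z1 x) j - fcoef l (\<lambda>x. \<Psi> x * z2 x) j)" for j
  proof -
    have "fcoef l (\<lambda>x. \<epsilon> * (z1 x * z1 x - z2 x * z2 x) + 2 * (\<Psi> x * z1 x - \<Psi> x * z2 x)) j
       = fcoef l (\<lambda>x. \<epsilon> * (z1 x * z1 x - z2 x * z2 x)) j + fcoef l (\<lambda>x. 2 * (\<Psi> x * z1 x - \<Psi> x * z2 x)) j"
      by (rule fcoef_add) (intro continuous_intros c)+
    also have "\<dots> = \<epsilon> * fcoef l (\<lambda>x. z1 x * z1 x - z2 x * z2 x) j + 2 * fcoef l (\<lambda>x. \<Psi> x * z1 x - \<Psi> x * z2 x) j"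
      by (simp only: fcoef_cmult)
    also have "fcoef l (\<lambda>x. z1 x * z1 x - z2 x * z2 x) j = fcoef l (\<lambda>x. z1 x * z1 x) j - fcoef l (\<lambda>x. z2 x * z2 x) j"
      by (rule fcoef_diff) (intro continuous_intros c)+
    also have "fcoef l (\<lambda>x. \<Psi> x * z1 x - \<Psi> x * z2 x) j = fcoef l (\<lambda>x. \<Psi> x * z1 x) j - fcoef l (\<lambda>x. \<Psi> x * z2 x) j"
      by (rule fcoef_diff) (intro continuous_intros c)+
    finally show ?thesis unfolding eq .
  qed
  have d: "fcoef l (pd (Suc 0) (\<lambda>x. f x * g x)) k = - sg k * freq l k * fcoef l (\<lambda>x. f x * g x) (pk k)"
    if "cper l 2 f" "cper l 2 g" for f g
    by (rule fcoef_pd_1[OF l_pos cper_mono[OF cper_mult[OF that]]]) simp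
  show ?thesis unfolding zforce_def power2_eq_square main d[OF z1 z1] d[OF z2 z2] d[OF \<Psi> z1] d[OF \<Psi> z2]
    by (simp add: algebra_simps)
qed

lemma zforce_diff_bound:
  assumes \<Psi>: "cper l 2 \<Psi>" and z1: "cper l 2 z1" and z2: "cper l 2 z2" and p: "2 \<le> p" and eps: "0 \<le> \<epsilon>"
    and a: "\<And>k. \<bar>fcoef l \<Psi> k\<bar> \<le> P * wt k ^ p"
    and y: "\<And>k. \<bar>fcoef l z1 k\<bar> \<le> Y * wt k ^ p" "\<And>k. \<bar>fcoef l z2 k\<bar> \<le> Y * wt k ^ p"
    and d: "\<And>k. \<bar>fcoef l z1 k - fcoef l z2 k\<bar> \<le> D * wt k ^ p"
  shows "\<bar>zforce l \<epsilon> \<Psi> \<Psi>t z1 k - zforce l \<epsilon> \<Psi> \<Psi>t z2 k\<bar>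
     \<le> \<bar>fsym l \<epsilon> k\<bar> * freq l k * (conv_const l p * (2 * (\<epsilon> * Y) + 2 * P) * D * wt k ^ p)"
proof -
  note c = cper_continuous[OF \<Psi>] cper_continuous[OF z1] cper_continuous[OF z2]
  let ?f = "\<lambda>x. \<epsilon> * (z1 x + z2 x) + 2 * \<Psi> x" and ?g = "\<lambda>x. z1 x + (- 1) * z2 x"
  have cf: "cper l 2 ?f" and cg: "cper l 2 ?g" by (intro cper_add cper_cmult assms)+
  have "\<bar>fcoef l ?f k\<bar> \<le> (2 * (\<epsilon> * Y) + 2 * P) * wt k ^ p" for k
  proof -
    have "fcoef l ?f k = fcoef l (\<lambda>x. \<epsilon> * (z1 x + z2 x)) k + fcoef l (\<lambda>x. 2 * \<Psi> x) k"
      by (rule fcoef_add) (intro continuous_intros c)+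
    also have "fcoef l (\<lambda>x. \<epsilon> * (z1 x + z2 x)) k = \<epsilon> * (fcoef l z1 k + fcoef l z2 k)"
      by (simp only: fcoef_cmult, subst fcoef_add) (intro continuous_intros c refl)+
    also have "fcoef l (\<lambda>x. 2 * \<Psi> x) k = 2 * fcoef l \<Psi> k" by (rule fcoef_cmult)
    finally have eq: "fcoef l ?f k = \<epsilon> * (fcoef l z1 k + fcoef l z2 k) + 2 * fcoef l \<Psi> k" .
    have "\<bar>fcoef l z1 k + fcoef l z2 k\<bar> \<le> 2 * Y * wt k ^ p" using y[of k] by linarith
    hence "\<epsilon> * \<bar>fcoef l z1 k + fcoef l z2 k\<bar> \<le> \<epsilon> * (2 * Y * wt k ^ p)" by (rule mult_left_mono[OF _ eps])
    hence "\<bar>\<epsilon> * (fcoef l z1 k + fcoef l z2 k)\<bar> \<le> \<epsilon> * (2 * Y * wt k ^ p)" using eps by (simp add: abs_mult)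
    moreover have "(2 * (\<epsilon> * Y) + 2 * P) * wt k ^ p = \<epsilon> * (2 * Y * wt k ^ p) + 2 * (P * wt k ^ p)"
      by (simp add: algebra_simps)
    ultimately show ?thesis using a[of k] unfolding eq by linarith
  qed
  moreover have "\<bar>fcoef l ?g k\<bar> \<le> D * wt k ^ p" for k
  proof -
    have "fcoef l ?g k = fcoef l z1 k - fcoef l z2 k" using fcoef_diff[of l z1 z2 k] c by simp
    thus ?thesis using d by simp
  qed
  ultimately have "\<bar>fcoef l (\<lambda>x. ?f x * ?g x) (pk k)\<bar> \<le> conv_const l p * (2 * (\<epsilon> * Y) + 2 * P) * D * wt (pk k) ^ p"
    by (intro fcoef_mult_decay[OF l_pos cf cg] p)
  hence "\<bar>fcoef l (\<lambda>x. (\<epsilon> * (z1 x + z2 x) + 2 * \<Psi> x) * (z1 x - z2 x)) (pk k)\<bar> \<le> conv_const l p * (2 * (\<epsilon> * Y) + 2 * P) * D * wt k ^ p"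
    by simp
  hence "\<bar>fsym l \<epsilon> k\<bar> * freq l k * \<bar>fcoef l (\<lambda>x. (\<epsilon> * (z1 x + z2 x) + 2 * \<Psi> x) * (z1 x - z2 x)) (pk k)\<bar>
     \<le> \<bar>fsym l \<epsilon> k\<bar> * freq l k * (conv_const l p * (2 * (\<epsilon> * Y) + 2 * P) * D * wt k ^ p)"
    using l_pos by (intro mult_left_mono) auto
  thus ?thesis unfolding zforce_diff[OF \<Psi> z1 z2] using l_pos by (simp add: abs_mult)
qed

text \<open>With \<open>\<zeta> = 0\<close> only the data are left. Order 8 loses two powers to
  \<open>hsym\<close>; order 12 of the square loses four to \<open>lam\<close>, \<open>X\<close> and
  the derivative, so 6 is dictated by the first term.\<close>

lemma zforce_0_bound:
  assumes \<Psi>: "cper l 2 \<Psi>" and eps: "0 < \<epsilon>" "\<epsilon> \<le> 1" and P: "0 \<le> P"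
    and a: "\<And>k. \<bar>fcoef l \<Psi> k\<bar> \<le> P * wt k ^ 12" and a': "\<And>k. \<bar>fcoef l \<Psi>t k\<bar> \<le> P * wt k ^ 8"
  shows "\<bar>zforce l \<epsilon> \<Psi> \<Psi>t (\<lambda>x. 0) k\<bar> \<le> forcing_const l P * wt k ^ 6"
proof -
  let ?c = "(1 + 2 * pi / l) ^ 4"
  let ?Q = "conv_const l 12 * P * P"
  have Q: "0 \<le> ?Q" using conv_const_nonneg[OF l_pos] P by (intro mult_nonneg_nonneg)
  have f0: "0 \<le> freq l k" and L0: "0 \<le> lam l k" using l_pos by auto
  have X0: "0 \<le> Xe l \<epsilon> k" by (simp add: Xe_def lam_def eps less_imp_le)
  have "(\<lambda>x::real. (0::real)) = (\<lambda>x. 0 * \<Psi> x)" by simp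
  hence c0: "cper l (Suc 0) (\<lambda>x. 0)" using cper_cmult[OF \<Psi>, of 0] by (auto intro: cper_mono)
  have z: "fcoef l (pd (Suc 0) (\<lambda>x. 0)) k = 0" by (simp add: fcoef_pd_1[OF l_pos c0]) (simp add: fcoef_def)
  have 1: "\<bar>hsym l \<epsilon> k * fcoef l \<Psi>t k\<bar> \<le> 8 * P * ?c * wt k ^ 6"
  proof -
    have "\<bar>hsym l \<epsilon> k * fcoef l \<Psi>t k\<bar> \<le> (8 * lam l k) * (P * wt k ^ 8)"
      unfolding abs_mult by (intro mult_mono hsym_le eps a') (use L0 in auto)
    also have "\<dots> = 8 * P * (freq l k ^ 2 * wt k ^ (2 + 6))" by (simp add: lam_eq)
    also have "\<dots> \<le> 8 * P * (?c * wt k ^ 6)" using P by (intro mult_left_mono freq_power_wt_le l_pos) auto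
    finally show ?thesis by simp
  qed
  have "\<bar>fcoef l (\<lambda>x. (\<Psi> x)^2) (pk k)\<bar> \<le> ?Q * wt k ^ 12"
    using fcoef_square_decay[OF l_pos \<Psi> a, of "pk k"] by simp
  moreover have "cper l (Suc 0) (\<lambda>x. (\<Psi> x)^2)"
    unfolding power2_eq_square by (rule cper_mono[OF cper_mult[OF \<Psi> \<Psi>]]) simp
  ultimately have s: "\<bar>fcoef l (pd (Suc 0) (\<lambda>x. (\<Psi> x)^2)) k\<bar> \<le> freq l k * (?Q * wt k ^ 12)"
    using f0 by (simp add: fcoef_pd_1[OF l_pos] abs_mult mult_left_mono)
  have 2: "\<bar>msym l \<epsilon> k * fcoef l (pd (Suc 0) (\<lambda>x. (\<Psi> x)^2)) k\<bar> \<le> 39 * ?Q * ?c * wt k ^ 6"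
  proof -
    have "\<bar>msym l \<epsilon> k * fcoef l (pd (Suc 0) (\<lambda>x. (\<Psi> x)^2)) k\<bar> \<le> (13 * lam l k * Xe l \<epsilon> k) * (freq l k * (?Q * wt k ^ 12))"
      unfolding abs_mult by (intro mult_mono msym_le eps s mult_nonneg_nonneg L0 X0) auto
    also have "\<dots> \<le> (13 * lam l k * (1 + 2 * freq l k)) * (freq l k * (?Q * wt k ^ 12))"
      by (intro mult_right_mono mult_left_mono Xe_le eps l_pos mult_nonneg_nonneg f0 Q) (use L0 in auto)
    also have "\<dots> = 13 * ?Q * (freq l k ^ 3 * wt k ^ (3 + 9) + 2 * (freq l k ^ 4 * wt k ^ (4 + 8)))"
      by (simp add: lam_eq power2_eq_square power3_eq_cube power4_eq_xxxx algebra_simps)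
    also have "\<dots> \<le> 13 * ?Q * (?c * wt k ^ 9 + 2 * (?c * wt k ^ 8))"
      using Q by (intro mult_left_mono add_mono freq_power_wt_le l_pos) auto
    also have "\<dots> \<le> 13 * ?Q * (?c * wt k ^ 6 + 2 * (?c * wt k ^ 6))"
      using Q l_pos by (intro mult_left_mono add_mono wt_power_antimono) auto
    finally show ?thesis by (simp add: mult_ac)
  qed
  have "zforce l \<epsilon> \<Psi> \<Psi>t (\<lambda>x. 0) k = - (hsym l \<epsilon> k * fcoef l \<Psi>t k) + msym l \<epsilon> k * fcoef l (pd (Suc 0) (\<lambda>x. (\<Psi> x)^2)) k"
    by (simp add: zforce_def z)
  hence "\<bar>zforce l \<epsilon> \<Psi> \<Psi>t (\<lambda>x. 0) k\<bar> \<le> 8 * P * ?c * wt k ^ 6 + 39 * ?Q * ?c * wt k ^ 6" using 1 2 by linarith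
  also have "\<dots> = forcing_const l P * wt k ^ 6" by (simp add: forcing_const_def algebra_simps)
  finally show ?thesis .
qed

text \<open>The quantifiers carry the content: \<open>\<gamma>\<close> depends on \<open>P\<close>
  only and is fixed before \<open>Y\<close>, which in turn will contain
  \<open>exp (\<gamma> * T)\<close>. The threshold for \<open>\<epsilon>\<close> is chosen
  last.\<close>

lemma good_params_exist:
  assumes P: "0 \<le> P"
  obtains \<gamma> where "3 \<le> \<gamma>" "\<And>Y. 0 \<le> Y \<Longrightarrow> \<exists>\<epsilon>0>0. \<forall>\<epsilon>. 0 < \<epsilon> \<and> \<epsilon> \<le> \<epsilon>0 \<longrightarrow> good_params l P Y \<epsilon> \<gamma>"
proof -
  define M where "M = (conv_const l 2 + conv_const l 6) * (2 + 2 * P)"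
  have M: "0 \<le> M" using P conv_const_nonneg[OF l_pos] by (simp add: M_def)
  \<comment> \<open>Chosen such that the absorption constant times the Lipschitz factor
    \<open>M\<close> is at most a quarter; the \<open>+ 1\<close> avoids a division by 0.\<close>
  define \<delta> where "\<delta> = 1 / (4 * (M + 1))"
  have \<delta>: "0 < \<delta>" "\<delta> * M \<le> 1 / 4" using M by (auto simp: \<delta>_def divide_simps)
  define \<gamma> where "\<gamma> = 15 / 4 + 57 / \<delta> ^ 2"
  have "0 \<le> 57 / \<delta> ^ 2" by simp
  hence \<gamma>: "3 \<le> \<gamma>" unfolding \<gamma>_def by linarith
  show thesis
  proof (rule that[OF \<gamma>])
    fix Y :: real assume Y: "0 \<le> Y"
    define \<epsilon>0 where "\<epsilon>0 = min 1 (min (\<delta> / 60) (1 / (Y + 1)))"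
    have "0 < \<epsilon>0" using \<delta> Y by (simp add: \<epsilon>0_def)
    moreover have "good_params l P Y \<epsilon> \<gamma>" if e: "0 < \<epsilon>" "\<epsilon> \<le> \<epsilon>0" for \<epsilon>
    proof -
      have e1: "\<epsilon> \<le> 1" "60 * \<epsilon> \<le> \<delta>" and eY: "\<epsilon> \<le> 1 / (Y + 1)" using e by (auto simp: \<epsilon>0_def)
      have "\<epsilon> * Y \<le> 1 / (Y + 1) * Y" using eY Y by (intro mult_right_mono) auto
      also have "\<dots> \<le> 1" using Y by simp
      finally have "\<epsilon> * Y \<le> 1" .
      moreover have "\<bar>fsym l \<epsilon> k\<bar> / bsym l \<epsilon> k * freq l k * M \<le> (rate l \<epsilon> k + \<gamma>) / 4" for k
      proof -
        have rg: "0 \<le> rate l \<epsilon> k + \<gamma>" using rate_ge[OF e(1) e1(1), of l k] \<gamma> by linarith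
        have "\<bar>fsym l \<epsilon> k\<bar> / bsym l \<epsilon> k * freq l k * M \<le> \<delta> * (rate l \<epsilon> k + \<gamma>) * M"
          by (intro mult_right_mono fsym_absorption \<delta> e(1) e1 l_pos M) (simp add: \<gamma>_def)
        also have "\<dots> = \<delta> * M * (rate l \<epsilon> k + \<gamma>)" by simp
        also have "\<dots> \<le> 1 / 4 * (rate l \<epsilon> k + \<gamma>)" by (intro mult_right_mono \<delta> rg)
        finally show ?thesis by simp
      qed
      ultimately show ?thesis using e(1) e1(1) \<gamma> by (simp add: good_params_def M_def)
    qed
    ultimately show "\<exists>\<epsilon>0>0. \<forall>\<epsilon>. 0 < \<epsilon> \<and> \<epsilon> \<le> \<epsilon>0 \<longrightarrow> good_params l P Y \<epsilon> \<gamma>" by blast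
  qed
qed

lemma rate_plus_ge_1: "good_params l P Y \<epsilon> \<gamma> \<Longrightarrow> 1 \<le> rate l \<epsilon> k + \<gamma>"
  using rate_ge[of \<epsilon> l k] by (simp add: good_params_def)

text \<open>The factor \<open>rate l \<epsilon> k + \<gamma>\<close> on the right is what the
  division in \<open>ode_growth_bound\<close> cancels, leaving the Lipschitz constant
  \<open>1 / 4\<close> for every mode. Here the damping pays for the derivatives lost in the
  nonlinearity.\<close>

lemma zforce_contraction:
  assumes g: "good_params l P Y \<epsilon> \<gamma>" and P: "0 \<le> P" and p: "p = 2 \<or> p = 6"
    and \<Psi>: "cper l 2 \<Psi>" and z1: "cper l 2 z1" and z2: "cper l 2 z2"
    and a: "\<And>k. \<bar>fcoef l \<Psi> k\<bar> \<le> P * wt k ^ p"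
    and y: "\<And>k. \<bar>fcoef l z1 k\<bar> \<le> Y * wt k ^ p" "\<And>k. \<bar>fcoef l z2 k\<bar> \<le> Y * wt k ^ p"
    and d: "\<And>k. \<bar>fcoef l z1 k - fcoef l z2 k\<bar> \<le> D * wt k ^ p"
  shows "\<bar>zforce l \<epsilon> \<Psi> \<Psi>t z1 k - zforce l \<epsilon> \<Psi> \<Psi>t z2 k\<bar> / bsym l \<epsilon> k \<le> (rate l \<epsilon> k + \<gamma>) / 4 * (D * wt k ^ p)"
proof -
  have D: "0 \<le> D" by (rule decay_bound_nonneg[OF d])
  have Y: "0 \<le> Y" by (rule decay_bound_nonneg[OF y(1)])
  have e: "0 < \<epsilon>" "\<epsilon> \<le> 1" "\<epsilon> * Y \<le> 1" using g by (auto simp: good_params_def)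
  have b: "1 \<le> bsym l \<epsilon> k" by (rule bsym_ge_1[OF e(1,2)])
  let ?F = "\<bar>fsym l \<epsilon> k\<bar> / bsym l \<epsilon> k * freq l k"
  have F: "0 \<le> ?F" using b l_pos by simp
  have cc: "0 \<le> conv_const l 2" "0 \<le> conv_const l 6" by (rule conv_const_nonneg[OF l_pos])+
  have "\<bar>zforce l \<epsilon> \<Psi> \<Psi>t z1 k - zforce l \<epsilon> \<Psi> \<Psi>t z2 k\<bar> / bsym l \<epsilon> k
     \<le> \<bar>fsym l \<epsilon> k\<bar> * freq l k * (conv_const l p * (2 * (\<epsilon> * Y) + 2 * P) * D * wt k ^ p) / bsym l \<epsilon> k"
    by (rule divide_right_mono[OF zforce_diff_bound[OF \<Psi> z1 z2 _ _ a y d]]) (use p e b in auto)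
  also have "\<dots> = ?F * (conv_const l p * (2 * (\<epsilon> * Y) + 2 * P)) * (D * wt k ^ p)" by simp
  also have "\<dots> \<le> ?F * ((conv_const l 2 + conv_const l 6) * (2 + 2 * P)) * (D * wt k ^ p)"
  proof (intro mult_right_mono mult_left_mono mult_mono F)
    show "conv_const l p \<le> conv_const l 2 + conv_const l 6" using p cc by auto
  qed (use e Y P D cc in auto)
  also have "\<dots> \<le> (rate l \<epsilon> k + \<gamma>) / 4 * (D * wt k ^ p)"
    using g D by (intro mult_right_mono) (auto simp: good_params_def)
  finally show ?thesis .
qed

text \<open>The unknown is one function on pairs of a time and an index. The weight
  \<open>exp (\<gamma> * t) * wt k ^ 6\<close> makes Duhamel's map a contraction on the whole of
  \<open>[0, T]\<close>, without a short-time argument; \<open>Y\<close> is the size of the ball at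
  the final time.\<close>

lemma zeta_modes_exist:
  assumes T: "0 \<le> T" and Psi: "creg {0..T} 4 Psi" "\<And>\<tau>. \<tau> \<in> {0..T} \<Longrightarrow> periodic l (Psi \<tau>)" and Psit: "creg {0..T} 0 Psit"
    and a: "\<And>\<tau> k. \<tau> \<in> {0..T} \<Longrightarrow> \<bar>fcoef l (Psi \<tau>) k\<bar> \<le> P * wt k ^ 12"
    and a': "\<And>\<tau> k. \<tau> \<in> {0..T} \<Longrightarrow> \<bar>fcoef l (Psit \<tau>) k\<bar> \<le> P * wt k ^ 8"
    and P: "0 \<le> P" and g: "good_params l P Y \<epsilon> \<gamma>" and R: "R = 2 * forcing_const l P + 1" and Y: "R * exp (\<gamma> * T) \<le> Y"
  obtains y where "\<And>t k. t \<in> {0..T} \<Longrightarrow> \<bar>y t k\<bar> \<le> Y * wt k ^ 6" "\<And>k. y 0 k = 0"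
    "\<And>t k. t \<in> {0..T} \<Longrightarrow> ((\<lambda>s. y s k) has_real_derivative
       (zforce l \<epsilon> (Psi t) (Psit t) (ser l (y t) 0) k / bsym l \<epsilon> k - rate l \<epsilon> k * y t k)) (at t within {0..T})"
proof -
  let ?A = "forcing_const l P"
  have A: "0 \<le> ?A" using P conv_const_nonneg[OF l_pos, of 12] by (simp add: forcing_const_def)
  have R0: "0 < R" using A R by simp
  have e: "0 < \<epsilon>" "\<epsilon> \<le> 1" and \<gamma>: "3 \<le> \<gamma>" using g by (auto simp: good_params_def)
  \<comment> \<open>Outside \<open>{0..T}\<close> the weight is 0, hence elements of
    \<open>V\<close> vanish there and the pointwise conditions of the fixed point lemma make sense
    for all arguments.\<close>
  define w where "w p = (if fst p \<in> {0..T} then exp (\<gamma> * fst p) * wt (snd p) ^ 6 else 0)" for p :: "real \<times> nat"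
  define V where "V = {u :: real \<times> nat \<Rightarrow> real. (\<forall>p. \<bar>u p\<bar> \<le> R * w p) \<and> (\<forall>k. continuous_on {0..T} (\<lambda>t. u (t, k)))}"
  define Z where "Z u s = ser l (\<lambda>j. u (s, j)) 0" for u :: "real \<times> nat \<Rightarrow> real" and s
  define G where "G u k s = zforce l \<epsilon> (Psi s) (Psit s) (Z u s) k / bsym l \<epsilon> k" for u k s
  define \<Gamma> where "\<Gamma> u p = (if fst p \<in> {0..T} then duhamel (rate l \<epsilon> (snd p)) (G u (snd p)) (fst p) else 0)" for u p
  have b: "1 \<le> bsym l \<epsilon> k" for k by (rule bsym_ge_1[OF e])
  have r1: "1 \<le> rate l \<epsilon> k + \<gamma>" for k by (rule rate_plus_ge_1[OF g])
  have w_in: "w (t, k) = exp (\<gamma> * t) * wt k ^ 6" if "t \<in> {0..T}" for t k using that by (simp add: w_def)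
  have exp_le: "R * exp (\<gamma> * s) \<le> Y" if "s \<in> {0..T}" for s
    using that R0 \<gamma> by (intro order_trans[OF mult_left_mono Y]) auto
  have uY: "\<bar>u (s, k)\<bar> \<le> Y * wt k ^ 6" if "u \<in> V" "s \<in> {0..T}" for u s k
  proof -
    have "\<bar>u (s, k)\<bar> \<le> R * w (s, k)" using that(1) by (simp add: V_def del: split_paired_All)
    also have "\<dots> = R * exp (\<gamma> * s) * wt k ^ 6" by (simp add: w_in[OF that(2)])
    also have "\<dots> \<le> Y * wt k ^ 6" by (intro mult_right_mono exp_le that) auto
    finally show ?thesis .
  qed
  have Zc: "creg {0..T} 4 (Z u)" if "u \<in> V" for u
    unfolding Z_def
  proof (rule ser_creg[OF l_pos])
    show "\<bar>u (\<tau>, k)\<bar> \<le> Y * wt k ^ (4 + 2)" if "\<tau> \<in> {0..T}" for \<tau> k using uY[OF \<open>u \<in> V\<close> that] by simp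
    show "continuous_on {0..T} (\<lambda>\<tau>. u (\<tau>, k))" for k using that by (simp add: V_def del: split_paired_All)
  qed
  have Zper: "cper l 2 (Z u s)" if "u \<in> V" "s \<in> {0..T}" for u s
    by (rule creg_imp_cper[OF creg_mono[OF Zc[OF that(1)]] that(2)])
       (auto simp: Z_def periodic_def ser_periodic[OF l_pos])
  have Zf: "fcoef l (Z u s) k = u (s, k)" if "u \<in> V" "s \<in> {0..T}" for u s k
    unfolding Z_def
  proof (rule fcoef_ser[OF l_pos])
    show "\<bar>u (s, k)\<bar> \<le> Y * wt k ^ 2" for k
      by (rule decay_mono[OF uY[OF that]]) simp
  qed
  have Psic: "cper l 2 (Psi s)" if "s \<in> {0..T}" for s
    by (rule creg_imp_cper[OF creg_mono[OF Psi(1)] that Psi(2)[OF that]]) simp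
  have a6: "\<bar>fcoef l (Psi s) k\<bar> \<le> P * wt k ^ 6" if "s \<in> {0..T}" for s k
    by (rule decay_mono[OF a[OF that]]) simp
  have Gc: "continuous_on {0..T} (G u k)" if "u \<in> V" for u k
    unfolding G_def
    by (intro continuous_intros zforce_continuous creg_mono[OF Psi(1)] Psit creg_mono[OF Zc[OF that]])
       (use b[of k] in auto)
  have \<Gamma>_deriv: "((\<lambda>s. \<Gamma> u (s, k)) has_real_derivative (G u k t - rate l \<epsilon> k * \<Gamma> u (t, k))) (at t within {0..T})"
    if "u \<in> V" "t \<in> {0..T}" for u k t
    by (rule has_field_derivative_transform_within[where d = 1 and f = "duhamel (rate l \<epsilon> k) (G u k)"])
       (use that duhamel_deriv[OF Gc[OF that(1)] that(2)] in \<open>auto simp: \<Gamma>_def\<close>)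
  have \<Gamma>_0: "\<Gamma> u (0, k) = 0" for u k by (simp add: \<Gamma>_def)
  have G_diff: "\<bar>G u k s - G v k s\<bar> \<le> (rate l \<epsilon> k + \<gamma>) / 4 * (K * exp (\<gamma> * s) * wt k ^ 6)"
    if uv: "u \<in> V" "v \<in> V" and K: "\<And>p. \<bar>u p - v p\<bar> \<le> K * w p" and s: "s \<in> {0..T}" for u v K k s
  proof -
    have "\<bar>G u k s - G v k s\<bar> = \<bar>zforce l \<epsilon> (Psi s) (Psit s) (Z u s) k - zforce l \<epsilon> (Psi s) (Psit s) (Z v s) k\<bar> / bsym l \<epsilon> k"
      using b[of k] by (simp add: G_def diff_divide_distrib[symmetric])
    also have "\<dots> \<le> (rate l \<epsilon> k + \<gamma>) / 4 * (K * exp (\<gamma> * s) * wt k ^ 6)"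
      by (rule zforce_contraction[OF g P _ Psic[OF s] Zper[OF uv(1) s] Zper[OF uv(2) s] a6[OF s]])
         (use uY[OF uv(1) s] uY[OF uv(2) s] K[of "(s, _)"] in \<open>auto simp: Zf[OF _ s] uv w_in[OF s] mult.assoc\<close>)
    finally show ?thesis .
  qed
  have zero_V: "(\<lambda>p. 0) \<in> V" using R0 by (auto simp: V_def w_def simp del: split_paired_All)
  have Z0: "Z (\<lambda>p. 0) s = (\<lambda>x. 0)" for s by (simp add: Z_def ser_def fun_eq_iff)
  have G_0: "\<bar>G (\<lambda>p. 0) k s\<bar> \<le> ?A * exp (\<gamma> * s) * wt k ^ 6" if s: "s \<in> {0..T}" for k s
  proof -
    have "\<bar>G (\<lambda>p. 0) k s\<bar> = \<bar>zforce l \<epsilon> (Psi s) (Psit s) (\<lambda>x. 0) k\<bar> / bsym l \<epsilon> k"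
      using b[of k] by (simp add: G_def Z0)
    also have "\<dots> \<le> \<bar>zforce l \<epsilon> (Psi s) (Psit s) (\<lambda>x. 0) k\<bar> / 1"
      using b[of k] by (intro divide_left_mono) auto
    also have "\<dots> \<le> ?A * 1 * wt k ^ 6"
      using zforce_0_bound[OF Psic[OF s] e P a[OF s] a'[OF s]] by simp
    also have "\<dots> \<le> ?A * exp (\<gamma> * s) * wt k ^ 6"
      using s \<gamma> A by (intro mult_right_mono mult_left_mono) auto
    finally show ?thesis .
  qed
  have bound: "\<bar>\<Gamma> u p\<bar> \<le> R * w p" if u: "u \<in> V" for u p
  proof (cases "fst p \<in> {0..T}")
    case True
    obtain t k where p: "p = (t, k)" by (cases p)
    have t: "t \<in> {0..T}" using True p by simp
    let ?r = "rate l \<epsilon> k + \<gamma>"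
    have "\<bar>\<Gamma> u (t, k)\<bar> \<le> exp (\<gamma> * t) * (\<bar>\<Gamma> u (0, k)\<bar> + (?A + ?r / 4 * R) * wt k ^ 6 / ?r)"
    proof (rule ode_growth_bound[OF \<Gamma>_deriv[OF u] _ _ t])
      fix s assume s: "s \<in> {0..T}"
      \<comment> \<open>Comparison with the zero function: the Lipschitz bound thus also gives the
        invariance of the ball.\<close>
      have "\<bar>G u k s - G (\<lambda>p. 0) k s\<bar> \<le> ?r / 4 * (R * exp (\<gamma> * s) * wt k ^ 6)"
        by (rule G_diff[OF u zero_V _ s]) (use u in \<open>auto simp: V_def simp del: split_paired_All\<close>)
      hence "\<bar>G u k s\<bar> \<le> ?A * exp (\<gamma> * s) * wt k ^ 6 + ?r / 4 * (R * exp (\<gamma> * s) * wt k ^ 6)"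
        using G_0[OF s, of k] by linarith
      also have "\<dots> = (?A + ?r / 4 * R) * wt k ^ 6 * exp (\<gamma> * s)" by (simp add: algebra_simps)
      finally show "\<bar>G u k s - rate l \<epsilon> k * \<Gamma> u (s, k) + rate l \<epsilon> k * \<Gamma> u (s, k)\<bar> \<le> (?A + ?r / 4 * R) * wt k ^ 6 * exp (\<gamma> * s)"
        by simp
    qed (use r1[of k] in auto)
    also have "\<dots> = exp (\<gamma> * t) * ((?A / ?r + R / 4) * wt k ^ 6)"
      using r1[of k] by (simp add: \<Gamma>_0 field_simps)
    also have "\<dots> \<le> exp (\<gamma> * t) * (R * wt k ^ 6)"
    proof (intro mult_left_mono mult_right_mono)
      \<comment> \<open>Origin of \<open>R = 2 * A + 1\<close>: the condition
        \<open>A + R / 4 \<le> R\<close> has to hold, and \<open>R\<close> has to be positive even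
        without forcing.\<close>
      have "?A / ?r \<le> ?A / 1" using r1[of k] A by (intro divide_left_mono) auto
      moreover have "x + (2 * A' + 1) / 4 \<le> 2 * A' + 1" if "x \<le> A'" "0 \<le> A'" for x A' :: real
        using that by (simp add: field_simps)
      ultimately show "?A / ?r + R / 4 \<le> R" using A unfolding R div_by_1 by blast
    qed auto
    finally show ?thesis using w_in[OF t] by (simp add: p mult_ac)
  qed (auto simp: \<Gamma>_def w_def)
  have "\<exists>u\<in>V. \<Gamma> u = u"
  proof (rule weighted_contraction_fixpoint[where w = w and R = R, OF _ zero_V])
    show "0 \<le> w p" for p by (simp add: w_def)
    show "\<bar>u p\<bar> \<le> R * w p" if "u \<in> V" for u p using that by (simp add: V_def del: split_paired_All)
    show "\<Gamma> u \<in> V" if "u \<in> V" for u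
    proof -
      have "continuous_on {0..T} (\<lambda>t. \<Gamma> u (t, k))" for k
        by (rule DERIV_continuous_on[OF \<Gamma>_deriv[OF that]])
      thus ?thesis using bound[OF that] unfolding V_def by blast
    qed
    show "\<bar>\<Gamma> u p - \<Gamma> v p\<bar> \<le> K / 2 * w p"
      if uv: "u \<in> V" "v \<in> V" and K: "0 \<le> K" "\<And>p. \<bar>u p - v p\<bar> \<le> K * w p" for u v K p
    proof (cases "fst p \<in> {0..T}")
      case True
      obtain t k where p: "p = (t, k)" by (cases p)
      have t: "t \<in> {0..T}" using True p by simp
      let ?r = "rate l \<epsilon> k + \<gamma>"
      have "\<bar>\<Gamma> u (t, k) - \<Gamma> v (t, k)\<bar> \<le> exp (\<gamma> * t) * (\<bar>\<Gamma> u (0, k) - \<Gamma> v (0, k)\<bar> + (?r / 4 * (K * wt k ^ 6)) / ?r)"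
      proof (rule ode_growth_bound[OF DERIV_diff[OF \<Gamma>_deriv[OF uv(1)] \<Gamma>_deriv[OF uv(2)]] _ _ t])
        fix s assume s: "s \<in> {0..T}"
        show "\<bar>G u k s - rate l \<epsilon> k * \<Gamma> u (s, k) - (G v k s - rate l \<epsilon> k * \<Gamma> v (s, k)) + rate l \<epsilon> k * (\<Gamma> u (s, k) - \<Gamma> v (s, k))\<bar>
           \<le> ?r / 4 * (K * wt k ^ 6) * exp (\<gamma> * s)"
          using G_diff[OF uv K(2) s, of k] by (simp add: algebra_simps)
      qed (use r1[of k] in auto)
      also have "\<dots> = K / 4 * (exp (\<gamma> * t) * wt k ^ 6)"
        using r1[of k] by (simp add: \<Gamma>_0 field_simps)
      also have "\<dots> \<le> K / 2 * (exp (\<gamma> * t) * wt k ^ 6)" using K by (intro mult_right_mono) auto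
      finally show ?thesis using w_in[OF t] by (simp add: p)
    qed (auto simp: \<Gamma>_def w_def)
    show "u \<in> V" if sV: "\<And>n. s n \<in> V" and su: "\<And>n p. \<bar>s n p - u p\<bar> \<le> 4 * R / 2 ^ n * w p" for s u
    proof -
      have lim0: "(\<lambda>n. 4 * R / 2 ^ n * c) \<longlonglongrightarrow> 0" for c
      proof -
        have "(\<lambda>n. 4 * R * c * (1 / 2) ^ n) \<longlonglongrightarrow> 4 * R * c * 0"
          by (intro tendsto_mult tendsto_const LIMSEQ_power_zero) auto
        thus ?thesis by (simp add: power_one_over field_simps)
      qed
      have sl: "(\<lambda>n. s n p) \<longlonglongrightarrow> u p" for p
        by (rule LIM_zero_cancel, rule Lim_null_comparison[OF _ lim0[of "w p"]],
            rule always_eventually, unfold real_norm_def, intro allI su)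
      have "\<bar>u p\<bar> \<le> R * w p" for p
        by (rule LIMSEQ_le_const2[OF tendsto_rabs[OF sl]]) (use sV in \<open>auto simp: V_def simp del: split_paired_All\<close>)
      moreover have "continuous_on {0..T} (\<lambda>t. u (t, k))" for k
      proof (rule uniform_limit_theorem)
        show "uniform_limit {0..T} (\<lambda>n t. s n (t, k)) (\<lambda>t. u (t, k)) sequentially"
        proof (rule uniform_limitI)
          fix d :: real assume "0 < d"
          hence "eventually (\<lambda>n. 4 * R / 2 ^ n * exp (\<gamma> * T) < d) sequentially"
            using lim0 by (intro order_tendstoD) auto
          thus "\<forall>\<^sub>F n in sequentially. \<forall>t\<in>{0..T}. dist (s n (t, k)) (u (t, k)) < d"
          proof eventually_elim
            case (elim n)
            show ?case
            proof
              fix t assume t: "t \<in> {0..T}"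
              have "w (t, k) \<le> exp (\<gamma> * T) * 1"
                unfolding w_in[OF t] using t \<gamma> by (intro mult_mono) auto
              hence "4 * R / 2 ^ n * w (t, k) \<le> 4 * R / 2 ^ n * exp (\<gamma> * T)"
                using R0 by (intro mult_left_mono) auto
              thus "dist (s n (t, k)) (u (t, k)) < d" using su[of n "(t, k)"] elim by (simp add: dist_real_def)
            qed
          qed
        qed
        show "\<forall>\<^sub>F n in sequentially. continuous_on {0..T} (\<lambda>t. s n (t, k))" using sV by (auto simp: V_def simp del: split_paired_All)
      qed auto
      ultimately show ?thesis by (simp add: V_def del: split_paired_All)
    qed
  qed (use R0 in auto)
  then obtain u where u: "u \<in> V" "\<Gamma> u = u" by blast
  show thesis
  proof (rule that[of "\<lambda>t k. u (t, k)"])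
    show "\<bar>u (t, k)\<bar> \<le> Y * wt k ^ 6" if "t \<in> {0..T}" for t k by (rule uY[OF u(1) that])
    show "u (0, k) = 0" for k using \<Gamma>_0[of u k] u(2) by simp
    show "((\<lambda>s. u (s, k)) has_real_derivative zforce l \<epsilon> (Psi t) (Psit t) (ser l (\<lambda>k. u (t, k)) 0) k / bsym l \<epsilon> k - rate l \<epsilon> k * u (t, k)) (at t within {0..T})"
      if "t \<in> {0..T}" for t k
      using \<Gamma>_deriv[OF u(1) that, of k] unfolding u(2) G_def Z_def .
  qed
qed

end

section \<open>From the modes back to a classical solution\<close>

lemma symop_ser: "symop l c q x = ser l (\<lambda>k. c k * fcoef l q k) 0 x"
  by (simp add: symop_def ser_def wk_eq)

lemma wkd_4: "wkd l 4 k x = lam l k ^ 2 * wk l k x"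
proof -
  have "wkd l 4 k x = wkd l (Suc (Suc (Suc (Suc 0)))) k x" by (simp add: eval_nat_numeral)
  thus ?thesis by (simp only: wkd_2 wk_eq) (simp add: power2_eq_square)
qed

lemma wkd_2': "wkd l 2 k x = - lam l k * wk l k x"
  by (simp add: numeral_2_eq_2 wkd_2 wk_eq)

context
  fixes l :: real
  assumes l_pos: "0 < l"
begin

text \<open>One majorant, cubic in the frequency and free of \<open>\<epsilon>\<close>, serves all
  four symbols; 13 comes from \<open>msym_le\<close> and is the largest of their constants.\<close>

lemma symbols_cubic:
  assumes "0 < \<epsilon>" "\<epsilon> \<le> 1"
  shows "\<bar>hsym l \<epsilon> k\<bar> \<le> 13 * (1 + 2 * freq l k) ^ 3" "\<bar>msym l \<epsilon> k\<bar> \<le> 13 * (1 + 2 * freq l k) ^ 3"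
    "\<bar>fsym l \<epsilon> k\<bar> \<le> 13 * (1 + 2 * freq l k) ^ 3" "\<bar>bsym l \<epsilon> k\<bar> \<le> 13 * (1 + 2 * freq l k) ^ 3"
proof -
  let ?g = "1 + 2 * freq l k"
  have f: "0 \<le> freq l k" using l_pos by simp
  hence g: "1 \<le> ?g" by simp
  have lam: "lam l k \<le> ?g ^ 2" using f by (simp add: lam_eq power2_eq_square algebra_simps)
  have X: "0 \<le> Xe l \<epsilon> k" "Xe l \<epsilon> k \<le> ?g" using Xe_le[OF assms l_pos] Xe_ge_1[of \<epsilon> l k] assms by auto
  have g23: "?g ^ 2 \<le> ?g ^ 3" using g by (intro power_increasing) auto
  have g0: "0 \<le> ?g ^ 3" using g by simp
  show "\<bar>hsym l \<epsilon> k\<bar> \<le> 13 * ?g ^ 3" using hsym_le[OF assms, of l k] lam g23 g0 by linarith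
  have "lam l k * Xe l \<epsilon> k \<le> ?g ^ 2 * ?g" by (intro mult_mono lam X) auto
  hence "13 * lam l k * Xe l \<epsilon> k \<le> 13 * ?g ^ 3" by (simp add: power3_eq_cube power2_eq_square)
  thus "\<bar>msym l \<epsilon> k\<bar> \<le> 13 * ?g ^ 3" using msym_le[OF assms, of l k] by linarith
  have X3: "Xe l \<epsilon> k ^ 3 \<le> ?g ^ 3" "Xe l \<epsilon> k ^ 2 \<le> ?g ^ 2" by (intro power_mono X)+
  show "\<bar>fsym l \<epsilon> k\<bar> \<le> 13 * ?g ^ 3" using fsym_le[OF assms, of l k] X3 g0 by linarith
  show "\<bar>bsym l \<epsilon> k\<bar> \<le> 13 * ?g ^ 3"
    using bsym_le[OF assms, of l k] bsym_ge_1[OF assms, of l k] X3 g0 g23 by linarith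
qed

text \<open>Of the five powers three pay for the symbol and two remain for summability.\<close>

lemma cubic_symbol_decay:
  assumes c: "\<bar>c\<bar> \<le> C * (1 + 2 * freq l k) ^ 3" and q: "\<bar>q\<bar> \<le> B * wt k ^ 5"
  shows "\<bar>c * q\<bar> \<le> C * (1 + 4 * pi / l) ^ 3 * B * wt k ^ 2"
proof -
  have f: "0 \<le> freq l k" using l_pos by simp
  have B: "0 \<le> B" by (rule decay_bound_nonneg[OF q])
  have C: "0 \<le> C" by (rule ccontr) (use order_trans[OF abs_ge_zero c] mult_neg_pos[of C "(1 + 2 * freq l k) ^ 3"] f in \<open>auto simp: add_pos_nonneg\<close>)
  have "((1 + 2 * freq l k) * wt k) ^ 3 \<le> (1 + 4 * pi / l) ^ 3"
    using f by (intro power_mono one_plus_freq_wt l_pos) auto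
  hence *: "C * B * wt k ^ 2 * ((1 + 2 * freq l k) * wt k) ^ 3 \<le> C * B * wt k ^ 2 * (1 + 4 * pi / l) ^ 3"
    using C B by (intro mult_left_mono) auto
  have "\<bar>c * q\<bar> \<le> (C * (1 + 2 * freq l k) ^ 3) * (B * wt k ^ 5)"
    unfolding abs_mult using f C by (intro mult_mono c q) auto
  also have "\<dots> = C * B * wt k ^ 2 * ((1 + 2 * freq l k) * wt k) ^ 3"
    by (simp add: power_mult_distrib power_add[symmetric])
  also note *
  finally show ?thesis by (simp add: mult_ac)
qed

lemma symop_sums:
  assumes "\<And>k. \<bar>c k * fcoef l q k\<bar> \<le> K * wt k ^ 2"
  shows "symop_ok l c q" "(\<lambda>k. c k * fcoef l q k * wk l k x) sums symop l c q x"
proof -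
  have s: "summable (\<lambda>k. c k * fcoef l q k * wk l k x)" for x
    unfolding wk_eq by (rule ser_summable[OF l_pos, of _ K]) (use assms in \<open>simp add: power2_eq_square\<close>)
  thus "symop_ok l c q" by (simp add: symop_ok_def)
  show "(\<lambda>k. c k * fcoef l q k * wk l k x) sums symop l c q x"
    unfolding symop_def by (rule summable_sums[OF s])
qed

text \<open>Order 6 is just enough: products keep it, the derivative leaves 5, and a cubic symbol
  leaves 2; the same 2 remain after four derivatives. Every series in the equation thus converges
  absolutely and may be differentiated termwise, and the equation holds term by term.\<close>

lemma zeta_solution_of_modes:
  assumes T: "0 < T" and eps: "0 < \<epsilon>" "\<epsilon> \<le> 1"
    and Psi: "creg {0..T} 4 Psi" "\<And>\<tau>. \<tau> \<in> {0..T} \<Longrightarrow> periodic l (Psi \<tau>)" and Psit: "creg {0..T} 0 Psit"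
    and a: "\<And>\<tau> k. \<tau> \<in> {0..T} \<Longrightarrow> \<bar>fcoef l (Psi \<tau>) k\<bar> \<le> P * wt k ^ 12"
    and a': "\<And>\<tau> k. \<tau> \<in> {0..T} \<Longrightarrow> \<bar>fcoef l (Psit \<tau>) k\<bar> \<le> P * wt k ^ 8"
    and y: "\<And>t k. t \<in> {0..T} \<Longrightarrow> \<bar>y t k\<bar> \<le> Y * wt k ^ 6" "\<And>k. y 0 k = 0"
    and y': "\<And>t k. t \<in> {0..T} \<Longrightarrow> ((\<lambda>s. y s k) has_real_derivative
       (zforce l \<epsilon> (Psi t) (Psit t) (ser l (y t) 0) k / bsym l \<epsilon> k - rate l \<epsilon> k * y t k)) (at t within {0..T})"
  shows "zeta_solution l \<epsilon> T Psi Psit (\<lambda>t. ser l (y t) 0)"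
proof -
  define z where "z t = ser l (y t) 0" for t
  define F where "F k t = zforce l \<epsilon> (Psi t) (Psit t) (z t) k" for k t
  define dy where "dy t k = F k t / bsym l \<epsilon> k - rate l \<epsilon> k * y t k" for t k
  have dy: "((\<lambda>s. y s k) has_real_derivative dy t k) (at t within {0..T})" if "t \<in> {0..T}" for t k
    using y'[OF that] by (simp add: dy_def F_def z_def)
  have P: "0 \<le> P" using decay_bound_nonneg[OF a[of 0 0]] T by simp
  have Y: "0 \<le> Y" using decay_bound_nonneg[OF y(1)[of 0 0]] T by simp
  have b: "1 \<le> bsym l \<epsilon> k" for k by (rule bsym_ge_1[OF eps])
  have yc: "continuous_on {0..T} (\<lambda>t. y t k)" for k using dy by (rule DERIV_continuous_on)
  have zc: "creg {0..T} 4 z"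
    unfolding z_def by (rule ser_creg[OF l_pos _ yc, of _ Y]) (use y in simp)
  have zper: "periodic l (z t)" for t by (simp add: z_def periodic_def ser_periodic[OF l_pos])
  have z2: "cper l 2 (z t)" if "t \<in> {0..T}" for t
    by (rule creg_imp_cper[OF creg_mono[OF zc] that zper]) simp
  have Psi2: "cper l 2 (Psi t)" if "t \<in> {0..T}" for t
    by (rule creg_imp_cper[OF creg_mono[OF Psi(1)] that Psi(2)[OF that]]) simp
  have y2: "\<bar>y t k\<bar> \<le> Y * wt k ^ n" if "t \<in> {0..T}" "n \<le> 6" for t k n
    by (rule decay_mono[OF y(1)[OF that(1)] that(2)])
  have zf: "fcoef l (z t) k = y t k" if "t \<in> {0..T}" for t k
    unfolding z_def by (rule fcoef_ser[OF l_pos, of _ Y]) (use y2[OF that] in auto)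
  have a6: "\<bar>fcoef l (Psi t) k\<bar> \<le> P * wt k ^ 6" if "t \<in> {0..T}" for t k
    by (rule decay_mono[OF a[OF that]]) simp
  define B where "B = P + 2 * pi / l * conv_const l 6 * (P + Y) * (P + Y)"
  define K where "K = 13 * (1 + 4 * pi / l) ^ 3 * B"
  have Q: "\<bar>fcoef l (pd (Suc 0) (\<lambda>x. u x * v x)) k\<bar> \<le> B * wt k ^ 5"
    if "cper l 2 u" "cper l 2 v" and uv: "\<And>k. \<bar>fcoef l u k\<bar> \<le> (P + Y) * wt k ^ 6" "\<And>k. \<bar>fcoef l v k\<bar> \<le> (P + Y) * wt k ^ 6" for u v k
  proof -
    have "\<bar>fcoef l (\<lambda>x. u x * v x) k\<bar> \<le> conv_const l 6 * (P + Y) * (P + Y) * wt k ^ Suc 5" for k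
      using fcoef_mult_decay[OF l_pos that(1,2) uv, of k] by (simp add: eval_nat_numeral)
    from fcoef_pd_1_decay[OF l_pos cper_mono[OF cper_mult[OF that(1,2)]] this, of k]
    have "\<bar>fcoef l (pd (Suc 0) (\<lambda>x. u x * v x)) k\<bar> \<le> 2 * pi / l * (conv_const l 6 * (P + Y) * (P + Y)) * wt k ^ 5" by simp
    also have "\<dots> \<le> B * wt k ^ 5" using P by (intro mult_right_mono) (auto simp: B_def mult.assoc)
    finally show ?thesis .
  qed
  have aPY: "\<bar>fcoef l (Psi t) k\<bar> \<le> (P + Y) * wt k ^ 6" "\<bar>fcoef l (z t) k\<bar> \<le> (P + Y) * wt k ^ 6" if "t \<in> {0..T}" for t k
  proof -
    have "0 \<le> P * wt k ^ 6" "0 \<le> Y * wt k ^ 6" using P Y by auto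
    thus "\<bar>fcoef l (Psi t) k\<bar> \<le> (P + Y) * wt k ^ 6" "\<bar>fcoef l (z t) k\<bar> \<le> (P + Y) * wt k ^ 6"
      using a6[OF that, of k] y(1)[OF that, of k] unfolding zf[OF that] distrib_right by linarith+
  qed
  have B: "P \<le> B" using l_pos P Y conv_const_nonneg[OF l_pos] by (simp add: B_def)
  have H: "\<bar>hsym l \<epsilon> k * fcoef l (Psit t) k\<bar> \<le> K * wt k ^ 2" if "t \<in> {0..T}" for t k
    unfolding K_def
  proof (rule cubic_symbol_decay[OF symbols_cubic(1)[OF eps]])
    have "P * wt k ^ 8 \<le> B * wt k ^ 5" using P B by (intro mult_mono wt_power_antimono) auto
    thus "\<bar>fcoef l (Psit t) k\<bar> \<le> B * wt k ^ 5" using a'[OF that, of k] by linarith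
  qed
  have M: "\<bar>msym l \<epsilon> k * fcoef l (pd (Suc 0) (\<lambda>x. (Psi t x)^2)) k\<bar> \<le> K * wt k ^ 2" if "t \<in> {0..T}" for t k
    unfolding K_def power2_eq_square[of "Psi _ _"]
    by (rule cubic_symbol_decay[OF symbols_cubic(2)[OF eps] Q[OF Psi2[OF that] Psi2[OF that] aPY(1)[OF that] aPY(1)[OF that]]])
  have Fz: "\<bar>fsym l \<epsilon> k * fcoef l (pd (Suc 0) (\<lambda>x. (z t x)^2)) k\<bar> \<le> K * wt k ^ 2" if "t \<in> {0..T}" for t k
    unfolding K_def power2_eq_square[of "z _ _"]
    by (rule cubic_symbol_decay[OF symbols_cubic(3)[OF eps] Q[OF z2[OF that] z2[OF that] aPY(2)[OF that] aPY(2)[OF that]]])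
  have FP: "\<bar>fsym l \<epsilon> k * fcoef l (pd (Suc 0) (\<lambda>x. Psi t x * z t x)) k\<bar> \<le> K * wt k ^ 2" if "t \<in> {0..T}" for t k
    unfolding K_def
    by (rule cubic_symbol_decay[OF symbols_cubic(3)[OF eps] Q[OF Psi2[OF that] z2[OF that] aPY(1)[OF that] aPY(2)[OF that]]])
  define KY where "KY = 13 * (1 + 4 * pi / l) ^ 3 * Y"
  have By: "\<bar>bsym l \<epsilon> k * fcoef l (z t) k\<bar> \<le> KY * wt k ^ 2" if "t \<in> {0..T}" for t k
    unfolding KY_def
    by (rule cubic_symbol_decay[OF symbols_cubic(4)[OF eps]]) (simp add: zf[OF that] y2[OF that])
  define L where "L = 5 * (1 + 2 * pi / l) ^ 4 * Y"
  have lin: "\<bar>(4 * lam l k ^ 2 - lam l k) * y t k\<bar> \<le> L * wt k ^ 2" if "t \<in> {0..T}" for t k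
  proof -
    have l0: "0 \<le> lam l k" using l_pos by simp
    have "lam l k ^ 2 * \<bar>y t k\<bar> \<le> lam l k ^ 2 * (Y * wt k ^ 6)" by (intro mult_left_mono y that) auto
    also have "\<dots> = Y * (freq l k ^ 4 * wt k ^ (4 + 2))" by (simp add: lam_eq power_mult[symmetric])
    also have "\<dots> \<le> Y * ((1 + 2 * pi / l) ^ 4 * wt k ^ 2)" by (intro mult_left_mono freq_power_wt_le l_pos Y) auto
    finally have 1: "lam l k ^ 2 * \<bar>y t k\<bar> \<le> Y * ((1 + 2 * pi / l) ^ 4 * wt k ^ 2)" .
    have "lam l k * \<bar>y t k\<bar> \<le> lam l k * (Y * wt k ^ 4)" by (intro mult_left_mono y2 that l0) auto
    also have "\<dots> = Y * (freq l k ^ 2 * wt k ^ (2 + 2))" by (simp add: lam_eq)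
    also have "\<dots> \<le> Y * ((1 + 2 * pi / l) ^ 4 * wt k ^ 2)" by (intro mult_left_mono freq_power_wt_le l_pos Y) auto
    finally have 2: "lam l k * \<bar>y t k\<bar> \<le> Y * ((1 + 2 * pi / l) ^ 4 * wt k ^ 2)" .
    have "\<bar>(4 * lam l k ^ 2 - lam l k) * y t k\<bar> = \<bar>4 * lam l k ^ 2 - lam l k\<bar> * \<bar>y t k\<bar>" by (rule abs_mult)
    also have "\<dots> \<le> (4 * lam l k ^ 2 + lam l k) * \<bar>y t k\<bar>"
    proof (rule mult_right_mono)
      have "0 \<le> lam l k ^ 2" by simp
      thus "\<bar>4 * lam l k ^ 2 - lam l k\<bar> \<le> 4 * lam l k ^ 2 + lam l k" using l0 by linarith
    qed simp
    also have "\<dots> = 4 * (lam l k ^ 2 * \<bar>y t k\<bar>) + lam l k * \<bar>y t k\<bar>" by (simp add: algebra_simps)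
    also have "\<dots> \<le> 5 * (Y * ((1 + 2 * pi / l) ^ 4 * wt k ^ 2))" using 1 2 by linarith
    finally show ?thesis by (simp add: L_def mult_ac)
  qed
  have Fb: "\<bar>F k t\<bar> \<le> 5 * K * wt k ^ 2" if "t \<in> {0..T}" for k t
  proof -
    have "\<bar>\<epsilon> * (fsym l \<epsilon> k * fcoef l (pd (Suc 0) (\<lambda>x. (z t x)^2)) k)\<bar> \<le> 1 * (K * wt k ^ 2)"
      unfolding abs_mult[of \<epsilon>] by (intro mult_mono Fz that) (use eps in auto)
    thus ?thesis using H[OF that, of k] M[OF that, of k] FP[OF that, of k]
      unfolding F_def zforce_def by linarith
  qed
  \<comment> \<open>The differentiated coefficients are estimated through the equation itself, whose
    right-hand side has order 2. Since \<open>bsym\<close> is at least 1, the same bound then serves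
    \<open>dy\<close>.\<close>
  have bdy: "bsym l \<epsilon> k * dy t k = F k t - (4 * lam l k ^ 2 - lam l k) * y t k" for t k
    using b[of k] by (simp add: dy_def rate_def right_diff_distrib)
  have bdyb: "\<bar>bsym l \<epsilon> k * dy t k\<bar> \<le> (5 * K + L) * wt k ^ 2" if "t \<in> {0..T}" for t k
    using Fb[OF that, of k] lin[OF that, of k] unfolding bdy by (simp add: distrib_right)
  have dyb: "\<bar>dy t k\<bar> \<le> (5 * K + L) * wt k ^ 2" if "t \<in> {0..T}" for t k
  proof -
    have "1 * \<bar>dy t k\<bar> \<le> bsym l \<epsilon> k * \<bar>dy t k\<bar>" using b by (intro mult_right_mono) auto
    also have "\<dots> = \<bar>bsym l \<epsilon> k * dy t k\<bar>" using b[of k] by (simp add: abs_mult)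
    finally show ?thesis using bdyb[OF that, of k] by linarith
  qed
  have Fc: "continuous_on {0..T} (F k)" for k
    unfolding F_def by (intro zforce_continuous creg_mono[OF Psi(1)] Psit creg_mono[OF zc]) auto
  have dyc: "continuous_on {0..T} (\<lambda>t. dy t k)" for k
    unfolding dy_def by (intro continuous_intros Fc yc) (use b[of k] in auto)
  have td: "time_deriv {0..T} z (\<lambda>t. ser l (dy t) 0)"
    unfolding time_deriv_def
  proof (intro conjI ballI allI)
    show "((\<lambda>s. z s x) has_real_derivative ser l (dy t) 0 x) (at t within {0..T})" if "t \<in> {0..T}" for t x
      unfolding z_def
    proof (rule ser_time_deriv[OF l_pos _ that dy])
      show "\<bar>y \<tau> k\<bar> \<le> Y * wt k ^ (0 + 2)" if "\<tau> \<in> {0..T}" for \<tau> k using y2[OF that, of 2 k] by (simp add: power2_eq_square)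
      show "\<bar>dy \<tau> k\<bar> \<le> (5 * K + L) * wt k ^ (0 + 2)" if "\<tau> \<in> {0..T}" for \<tau> k using dyb[OF that, of k] by (simp add: power2_eq_square)
    qed auto
    show "continuous_on ({0..T} \<times> UNIV) (\<lambda>p. ser l (dy (fst p)) 0 (snd p))"
    proof (rule ser_continuous2[OF l_pos _ dyc])
      show "\<bar>dy \<tau> k\<bar> \<le> (5 * K + L) * wt k ^ (0 + 2)" if "\<tau> \<in> {0..T}" for \<tau> k using dyb[OF that, of k] by (simp add: power2_eq_square)
    qed
  qed
  have Bd: "((\<lambda>s. symop l (bsym l \<epsilon>) (z s) x) has_real_derivative ser l (\<lambda>k. bsym l \<epsilon> k * dy t k) 0 x) (at t within {0..T})"
    if t: "t \<in> {0..T}" for t x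
  proof (rule has_field_derivative_transform_within[where d = 1 and f = "\<lambda>s. ser l (\<lambda>k. bsym l \<epsilon> k * y s k) 0 x"])
    show "((\<lambda>s. ser l (\<lambda>k. bsym l \<epsilon> k * y s k) 0 x) has_real_derivative ser l (\<lambda>k. bsym l \<epsilon> k * dy t k) 0 x) (at t within {0..T})"
    proof (rule ser_time_deriv[OF l_pos _ t])
      show "((\<lambda>s. bsym l \<epsilon> k * y s k) has_real_derivative bsym l \<epsilon> k * dy \<tau> k) (at \<tau> within {0..T})" if "\<tau> \<in> {0..T}" for k \<tau>
        by (intro DERIV_cmult dy that)
      show "\<bar>bsym l \<epsilon> k * y \<tau> k\<bar> \<le> KY * wt k ^ (0 + 2)" if "\<tau> \<in> {0..T}" for \<tau> k
        using By[OF that, of k] zf[OF that, of k] by (simp add: power2_eq_square)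
      show "\<bar>bsym l \<epsilon> k * dy \<tau> k\<bar> \<le> (5 * K + L) * wt k ^ (0 + 2)" if "\<tau> \<in> {0..T}" for \<tau> k
        using bdyb[OF that, of k] by (simp add: power2_eq_square)
    qed simp
    show "ser l (\<lambda>k. bsym l \<epsilon> k * y s k) 0 x = symop l (bsym l \<epsilon>) (z s) x" if "s \<in> {0..T}" for s
      by (simp add: symop_ser zf[OF that])
  qed (use t in auto)
  have eq: "ser l (\<lambda>k. bsym l \<epsilon> k * dy t k) 0 x + symop l (hsym l \<epsilon>) (Psit t) x
     = - 4 * pd 4 (z t) x - pd 2 (z t) x
       + symop l (msym l \<epsilon>) (pd (Suc 0) (\<lambda>y. (Psi t y)^2)) x
       + \<epsilon> * symop l (fsym l \<epsilon>) (pd (Suc 0) (\<lambda>y. (z t y)^2)) x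
       + 2 * symop l (fsym l \<epsilon>) (pd (Suc 0) (\<lambda>y. Psi t y * z t y)) x" (is "?lhs = ?rhs")
    if t: "t \<in> {0..T}" for t x
  proof (rule sums_unique2)
    have pd4: "pd 4 (z t) x = ser l (y t) 4 x" "pd 2 (z t) x = ser l (y t) 2 x"
      unfolding z_def by (subst pd_ser[OF l_pos, of _ Y]; use y2[OF t] in simp)+
    have s4: "(\<lambda>k. y t k * wkd l 4 k x) sums ser l (y t) 4 x"
      unfolding ser_def by (rule summable_sums, rule ser_summable[OF l_pos, of _ Y]) (use y2[OF t] in simp)
    have s2: "(\<lambda>k. y t k * wkd l 2 k x) sums ser l (y t) 2 x"
      unfolding ser_def by (rule summable_sums, rule ser_summable[OF l_pos, of _ Y]) (use y2[OF t] in simp)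
    have sb: "(\<lambda>k. bsym l \<epsilon> k * dy t k * wkd l 0 k x) sums ser l (\<lambda>k. bsym l \<epsilon> k * dy t k) 0 x"
      unfolding ser_def by (rule summable_sums, rule ser_summable[OF l_pos, of _ "5 * K + L"]) (use bdyb[OF t] in \<open>simp add: power2_eq_square\<close>)
    let ?r = "\<lambda>k. - 4 * (y t k * wkd l 4 k x) - y t k * wkd l 2 k x
       + msym l \<epsilon> k * fcoef l (pd (Suc 0) (\<lambda>y. (Psi t y)^2)) k * wk l k x
       + \<epsilon> * (fsym l \<epsilon> k * fcoef l (pd (Suc 0) (\<lambda>y. (z t y)^2)) k * wk l k x)
       + 2 * (fsym l \<epsilon> k * fcoef l (pd (Suc 0) (\<lambda>y. Psi t y * z t y)) k * wk l k x)"
    show "?r sums ?rhs" unfolding pd4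
      by (intro sums_add sums_diff sums_mult s4 s2 symop_sums(2)[OF M[OF t]] symop_sums(2)[OF Fz[OF t]] symop_sums(2)[OF FP[OF t]])
    have "?r k = bsym l \<epsilon> k * dy t k * wkd l 0 k x + hsym l \<epsilon> k * fcoef l (Psit t) k * wk l k x" for k
      unfolding bdy F_def zforce_def wkd_4 wkd_2' wk_eq by (simp add: algebra_simps)
    thus "?r sums ?lhs" using sums_add[OF sb symop_sums(2)[OF H[OF t]]] by simp
  qed
  show ?thesis
    unfolding zeta_solution_def z_def[symmetric]
  proof (intro conjI ballI allI)
    show "\<exists>zt. time_deriv {0..T} z zt" using td by blast
    show "z 0 x = 0" for x by (simp add: z_def ser_def y(2))
    fix t assume t: "t \<in> {0..T}"
    show "symop_ok l (bsym l \<epsilon>) (z t)" by (rule symop_sums(1)[OF By[OF t]])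
    show "symop_ok l (hsym l \<epsilon>) (Psit t)" by (rule symop_sums(1)[OF H[OF t]])
    show "symop_ok l (msym l \<epsilon>) (pd 1 (\<lambda>x. (Psi t x)^2))" using symop_sums(1)[OF M[OF t]] by simp
    show "symop_ok l (fsym l \<epsilon>) (pd 1 (\<lambda>x. (z t x)^2))" using symop_sums(1)[OF Fz[OF t]] by simp
    show "symop_ok l (fsym l \<epsilon>) (pd 1 (\<lambda>x. Psi t x * z t x))" using symop_sums(1)[OF FP[OF t]] by simp
    fix x
    show "\<exists>d. ((\<lambda>s. symop l (bsym l \<epsilon>) (z s) x) has_real_derivative d) (at t within {0..T})
             \<and> d + symop l (hsym l \<epsilon>) (Psit t) x
               = - 4 * pd 4 (z t) x - pd 2 (z t) x
                 + symop l (msym l \<epsilon>) (pd 1 (\<lambda>y. (Psi t y)^2)) x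
                 + \<epsilon> * symop l (fsym l \<epsilon>) (pd 1 (\<lambda>y. (z t y)^2)) x
                 + 2 * symop l (fsym l \<epsilon>) (pd 1 (\<lambda>y. Psi t y * z t y)) x"
      using Bd[OF t] eq[OF t] by auto
  qed (use zper zc in auto)
qed

end

section \<open>Uniqueness\<close>

lemma sum_four_squares_le: "(a + b + c + d) ^ 2 \<le> 4 * (a ^ 2 + b ^ 2 + c ^ 2 + d ^ 2 :: real)"
proof -
  have "0 \<le> (a - b) ^ 2 + (a - c) ^ 2 + (a - d) ^ 2 + (b - c) ^ 2 + (b - d) ^ 2 + (c - d) ^ 2" by simp
  thus ?thesis by (simp add: power2_eq_square algebra_simps)
qed

context
  fixes l :: real
  assumes l_pos: "0 < l"
begin

text \<open>A cubic symbol applied to a \<open>C^3\<close> function has square summable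
  coefficients, by Bessel's inequality for the function and its third derivative. Three derivatives
  are what the square of a classical solution still has after the differentiation in the
  equation.\<close>

lemma symbol_square_sum_bound:
  assumes u: "creg {0..T} 3 u" "\<And>\<tau>. \<tau> \<in> {0..T} \<Longrightarrow> periodic l (u \<tau>)"
    and c: "\<And>k. \<bar>c k\<bar> \<le> C * (1 + 2 * freq l k) ^ 3"
  shows "\<exists>B\<ge>0. \<forall>s\<in>{0..T}. \<forall>N. (\<Sum>k<N. (c k * fcoef l (u s) k)^2) \<le> B"
proof -
  have C: "0 \<le> C"
    using order_trans[OF abs_ge_zero c[of 0]] by (simp add: freq_def)
  obtain M0 where M0: "M0 \<ge> 0" "\<forall>\<tau>\<in>{0..T}. \<forall>x\<in>{-l/2..l/2}. \<bar>pd 0 (u \<tau>) x\<bar> \<le> M0"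
    using creg_bounded[OF u(1), of 0 l] by auto
  obtain M3 where M3: "M3 \<ge> 0" "\<forall>\<tau>\<in>{0..T}. \<forall>x\<in>{-l/2..l/2}. \<bar>pd 3 (u \<tau>) x\<bar> \<le> M3"
    using creg_bounded[OF u(1), of 3 l] by auto
  have sq: "(\<Sum>k\<in>A. (fcoef l f k)^2) \<le> M^2 * l"
    if f: "continuous_on {-l/2..l/2} f" "\<And>x. x \<in> {-l/2..l/2} \<Longrightarrow> \<bar>f x\<bar> \<le> M" and A: "finite A" for f M A
  proof -
    have "(\<Sum>k\<in>A. (fcoef l f k)^2) \<le> integral {-l/2..l/2} (\<lambda>x. (f x)^2)" by (rule bessel[OF l_pos f(1) A])
    also have "\<dots> \<le> integral {-l/2..l/2} (\<lambda>x. M^2)"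
    proof (rule integral_le)
      show "(f x)^2 \<le> M^2" if "x \<in> {-l/2..l/2}" for x
        using power_mono[OF f(2)[OF that], of 2] by simp
    qed (intro integrable_continuous_interval continuous_intros f)+
    also have "\<dots> = M^2 * l" using l_pos by simp
    finally show ?thesis .
  qed
  define B where "B = 32 * C^2 * (M0^2 * l + 64 * (M3^2 * l))"
  have "(\<Sum>k<N. (c k * fcoef l (u s) k)^2) \<le> B" if s: "s \<in> {0..T}" for s N
  proof -
    have c3: "cper l 3 (u s)" by (rule creg_imp_cper[OF u(1) s u(2)[OF s]])
    have pc: "continuous_on {-l/2..l/2} (pd 3 (u s))"
      using c3 by (auto simp: cper_def creg_const_iff intro: continuous_on_subset)
    have summand: "(c k * fcoef l (u s) k)^2 \<le> 32 * C^2 * ((fcoef l (u s) k)^2 + 64 * (fcoef l (pd 3 (u s)) ((pk ^^ 3) k))^2)" for k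
    proof -
      let ?f = "freq l k"
      have f: "0 \<le> ?f" using l_pos by simp
      \<comment> \<open>With \<open>x = 2 * freq l k\<close> this is
        \<open>4 * (1 + x ^ 3) - (1 + x) ^ 3\<close>.\<close>
      have "0 \<le> 3 * (1 + 2 * ?f) * (1 - 2 * ?f)^2" using f by simp
      hence "(1 + 2 * ?f)^3 \<le> 4 * (1 + 8 * ?f^3)"
        by (simp add: power2_eq_square power3_eq_cube algebra_simps)
      hence "((1 + 2 * ?f)^3)^2 \<le> (4 * (1 + 8 * ?f^3))^2" using f by (intro power_mono) auto
      also have "\<dots> \<le> 32 * (1 + 64 * (?f^3)^2)"
      proof -
        have "0 \<le> 16 * (1 - 8 * ?f^3)^2" by simp
        thus ?thesis by (simp add: power2_eq_square algebra_simps)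
      qed
      finally have g: "((1 + 2 * ?f)^3)^2 \<le> 32 * (1 + 64 * (?f^3)^2)" .
      have "(c k)^2 \<le> (C * (1 + 2 * ?f)^3)^2" using power_mono[OF c[of k], of 2] by simp
      also have "\<dots> \<le> C^2 * (32 * (1 + 64 * (?f^3)^2))"
        unfolding power_mult_distrib by (intro mult_left_mono g) auto
      finally have "(c k)^2 * (fcoef l (u s) k)^2 \<le> C^2 * (32 * (1 + 64 * (?f^3)^2)) * (fcoef l (u s) k)^2"
        by (intro mult_right_mono) auto
      also have "\<dots> = 32 * C^2 * ((fcoef l (u s) k)^2 + 64 * (?f^3 * \<bar>fcoef l (u s) k\<bar>)^2)"
        by (simp add: power_mult_distrib algebra_simps)
      also have "?f^3 * \<bar>fcoef l (u s) k\<bar> = \<bar>fcoef l (pd 3 (u s)) ((pk ^^ 3) k)\<bar>" by (rule abs_fcoef_pd[OF l_pos c3])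
      finally show ?thesis by (simp add: power_mult_distrib)
    qed
    \<comment> \<open>The permuted coefficients form a Bessel sum over a finite index set, because
      no index is hit twice.\<close>
    have inj: "inj (pk ^^ 3)" using inj_pk by (simp add: eval_nat_numeral inj_compose)
    have "(\<Sum>k<N. (c k * fcoef l (u s) k)^2) \<le> (\<Sum>k<N. 32 * C^2 * ((fcoef l (u s) k)^2 + 64 * (fcoef l (pd 3 (u s)) ((pk ^^ 3) k))^2))"
      by (intro sum_mono summand)
    also have "\<dots> = 32 * C^2 * ((\<Sum>k<N. (fcoef l (u s) k)^2) + 64 * (\<Sum>k<N. (fcoef l (pd 3 (u s)) ((pk ^^ 3) k))^2))"
      by (simp only: sum_distrib_left[symmetric] sum.distrib)
    also have "(\<Sum>k<N. (fcoef l (pd 3 (u s)) ((pk ^^ 3) k))^2) = (\<Sum>k\<in>(pk ^^ 3) ` {..<N}. (fcoef l (pd 3 (u s)) k)^2)"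
      by (subst sum.reindex) (use inj in \<open>auto intro: inj_on_subset\<close>)
    also have "32 * C^2 * ((\<Sum>k<N. (fcoef l (u s) k)^2) + 64 * (\<Sum>k\<in>(pk ^^ 3) ` {..<N}. (fcoef l (pd 3 (u s)) k)^2)) \<le> B"
      unfolding B_def
      by (intro mult_left_mono add_mono sq pc cper_continuous[OF c3]) (use M0 M3 s in auto)
    finally show ?thesis .
  qed
  moreover have "0 \<le> B" using l_pos by (simp add: B_def)
  ultimately show ?thesis by blast
qed

text \<open>Uniformity in time and in the number of modes makes the partial sums of the forcing
  Cauchy in the mean in \<open>zeta_modes\<close>.\<close>

lemma zforce_square_sum_bound:
  assumes Psi: "creg {0..T} 4 Psi" "\<And>\<tau>. \<tau> \<in> {0..T} \<Longrightarrow> periodic l (Psi \<tau>)"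
    and Psit: "creg {0..T} 3 Psit" "\<And>\<tau>. \<tau> \<in> {0..T} \<Longrightarrow> periodic l (Psit \<tau>)"
    and z: "creg {0..T} 4 z" "\<And>\<tau>. \<tau> \<in> {0..T} \<Longrightarrow> periodic l (z \<tau>)"
    and eps: "0 < \<epsilon>" "\<epsilon> \<le> 1"
  shows "\<exists>B\<ge>0. \<forall>s\<in>{0..T}. \<forall>N. (\<Sum>k<N. (zforce l \<epsilon> (Psi s) (Psit s) (z s) k)^2) \<le> B"
proof -
  note sym = symbols_cubic[OF l_pos eps]
  have q: "creg {0..T} 3 (\<lambda>s. pd (Suc 0) (\<lambda>x. u s x * v s x))" "\<And>\<tau>. \<tau> \<in> {0..T} \<Longrightarrow> periodic l (pd (Suc 0) (\<lambda>x. u \<tau> x * v \<tau> x))"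
    if u: "creg {0..T} 4 u" "\<And>\<tau>. \<tau> \<in> {0..T} \<Longrightarrow> periodic l (u \<tau>)" and v: "creg {0..T} 4 v" "\<And>\<tau>. \<tau> \<in> {0..T} \<Longrightarrow> periodic l (v \<tau>)" for u v
  proof -
    have "creg {0..T} (Suc 3) (\<lambda>s x. u s x * v s x)" using creg_mult[OF u(1) v(1)] by (simp add: eval_nat_numeral)
    thus "creg {0..T} 3 (\<lambda>s. pd (Suc 0) (\<lambda>x. u s x * v s x))" unfolding creg_Suc by blast
    fix \<tau> assume t: "\<tau> \<in> {0..T}"
    have "cper l (Suc 3) (\<lambda>x. u \<tau> x * v \<tau> x)"
      using cper_mult[OF creg_imp_cper[OF u(1) t u(2)[OF t]] creg_imp_cper[OF v(1) t v(2)[OF t]]] by (simp add: eval_nat_numeral)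
    from cper_pd[OF this] show "periodic l (pd (Suc 0) (\<lambda>x. u \<tau> x * v \<tau> x))" by (simp add: cper_def)
  qed
  note qPP = q[OF Psi Psi] and qzz = q[OF z z] and qPz = q[OF Psi z]
  obtain B1 where B1: "B1 \<ge> 0" "\<forall>s\<in>{0..T}. \<forall>N. (\<Sum>k<N. (hsym l \<epsilon> k * fcoef l (Psit s) k)^2) \<le> B1"
    using symbol_square_sum_bound[OF Psit sym(1)] by blast
  obtain B2 where B2: "B2 \<ge> 0" "\<forall>s\<in>{0..T}. \<forall>N. (\<Sum>k<N. (msym l \<epsilon> k * fcoef l (pd (Suc 0) (\<lambda>x. Psi s x * Psi s x)) k)^2) \<le> B2"
    using symbol_square_sum_bound[OF qPP sym(2)] by blast
  obtain B3 where B3: "B3 \<ge> 0" "\<forall>s\<in>{0..T}. \<forall>N. (\<Sum>k<N. (fsym l \<epsilon> k * fcoef l (pd (Suc 0) (\<lambda>x. z s x * z s x)) k)^2) \<le> B3"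
    using symbol_square_sum_bound[OF qzz sym(3)] by blast
  obtain B4 where B4: "B4 \<ge> 0" "\<forall>s\<in>{0..T}. \<forall>N. (\<Sum>k<N. (fsym l \<epsilon> k * fcoef l (pd (Suc 0) (\<lambda>x. Psi s x * z s x)) k)^2) \<le> B4"
    using symbol_square_sum_bound[OF qPz sym(3)] by blast
  define B where "B = 4 * (B1 + B2 + B3 + 4 * B4)"
  have "(\<Sum>k<N. (zforce l \<epsilon> (Psi s) (Psit s) (z s) k)^2) \<le> B" if s: "s \<in> {0..T}" for s N
  proof -
    let ?h = "\<lambda>k. hsym l \<epsilon> k * fcoef l (Psit s) k"
    let ?m = "\<lambda>k. msym l \<epsilon> k * fcoef l (pd (Suc 0) (\<lambda>x. Psi s x * Psi s x)) k"
    let ?z = "\<lambda>k. fsym l \<epsilon> k * fcoef l (pd (Suc 0) (\<lambda>x. z s x * z s x)) k"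
    let ?p = "\<lambda>k. fsym l \<epsilon> k * fcoef l (pd (Suc 0) (\<lambda>x. Psi s x * z s x)) k"
    have "(zforce l \<epsilon> (Psi s) (Psit s) (z s) k)^2 \<le> 4 * ((?h k)^2 + (?m k)^2 + (?z k)^2 + 4 * (?p k)^2)" for k
    proof -
      have "(zforce l \<epsilon> (Psi s) (Psit s) (z s) k)^2 \<le> 4 * ((- ?h k)^2 + (?m k)^2 + (\<epsilon> * ?z k)^2 + (2 * ?p k)^2)"
        unfolding zforce_def power2_eq_square[of "Psi s _"] power2_eq_square[of "z s _"] by (rule sum_four_squares_le)
      moreover have "(\<epsilon> * ?z k)^2 \<le> 1 * (?z k)^2"
        unfolding power_mult_distrib using eps by (intro mult_right_mono) (auto simp: power_le_one)
      ultimately show ?thesis by (simp add: power_mult_distrib)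
    qed
    hence "(\<Sum>k<N. (zforce l \<epsilon> (Psi s) (Psit s) (z s) k)^2) \<le> (\<Sum>k<N. 4 * ((?h k)^2 + (?m k)^2 + (?z k)^2 + 4 * (?p k)^2))"
      by (intro sum_mono)
    also have "\<dots> = 4 * ((\<Sum>k<N. (?h k)^2) + (\<Sum>k<N. (?m k)^2) + (\<Sum>k<N. (?z k)^2) + 4 * (\<Sum>k<N. (?p k)^2))"
      by (simp only: sum_distrib_left[symmetric] sum.distrib)
    also have "\<dots> \<le> B"
      unfolding B_def by (intro mult_left_mono add_mono) (use B1 B2 B3 B4 s in auto)
    finally show ?thesis .
  qed
  moreover have "0 \<le> B" using B1(1) B2(1) B3(1) B4(1) by (simp add: B_def)
  ultimately show ?thesis by blast
qed

text \<open>\<open>\<bar>x\<bar> \<le> \<eta> + x ^ 2 / \<eta>\<close> is integrated and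
  orthonormality evaluates the square. The free parameter replaces the Cauchy-Schwarz inequality:
  with \<open>\<eta>\<close> fixed small, a small sum of squares makes the mean small.\<close>

lemma rect_integral_abs_le:
  assumes t: "0 \<le> t" and q: "\<And>k. continuous_on {0..t} (q k)" and A: "finite A" and \<eta>: "0 < \<eta>"
  shows "integral (cbox (0, -l/2) (t, l/2)) (\<lambda>p. \<bar>\<Sum>k\<in>A. q k (fst p) * wk l k (snd p)\<bar>)
     \<le> \<eta> * (t * l) + (\<Sum>k\<in>A. integral {0..t} (\<lambda>s. (q k s)^2)) / \<eta>"
proof -
  let ?R = "cbox (0, -l/2) (t, l/2)"
  let ?g = "\<lambda>p. \<Sum>k\<in>A. q k (fst p) * wk l k (snd p)"
  have cq: "continuous_on ?R (\<lambda>p. q k (fst p))" for k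
    by (rule continuous_on_compose2[OF q]) (auto intro!: continuous_intros simp: cbox_Pair_eq)
  have cg: "continuous_on ?R ?g" unfolding wk_eq by (intro continuous_intros cq)
  have pw: "\<bar>x\<bar> \<le> \<eta> + x^2 / \<eta>" for x :: real
  proof -
    have "0 \<le> (\<bar>x\<bar> - \<eta>)^2 + \<bar>x\<bar> * \<eta>" using \<eta> by simp
    hence "\<bar>x\<bar> * \<eta> \<le> \<eta>^2 + x^2" by (simp add: power2_diff mult.commute add.commute)
    thus ?thesis using \<eta> by (simp add: field_simps power2_eq_square)
  qed
  have i1: "continuous_on ?R (\<lambda>p. \<bar>?g p\<bar>)" by (intro continuous_intros cg)
  have i2: "continuous_on ?R (\<lambda>p. \<eta> + (?g p)^2 / \<eta>)" by (intro continuous_intros cg) (use \<eta> in simp)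
  have "integral ?R (\<lambda>p. \<bar>?g p\<bar>) \<le> integral ?R (\<lambda>p. \<eta> + (?g p)^2 / \<eta>)"
    by (rule integral_le[OF integrable_continuous[OF i1] integrable_continuous[OF i2] pw])
  also have "\<dots> = integral {0..t} (\<lambda>s. integral {-l/2..l/2} (\<lambda>x. \<eta> + (?g (s, x))^2 / \<eta>))"
    unfolding interval_cbox by (rule integral_prod_continuous[OF i2])
  also have "\<dots> = integral {0..t} (\<lambda>s. \<eta> * l + (\<Sum>k\<in>A. (q k s)^2) / \<eta>)"
  proof (rule integral_cong)
    fix s
    let ?J = "{-l/2..l/2}"
    have "integral ?J (\<lambda>x. \<eta> + (?g (s, x))^2 / \<eta>) = integral ?J (\<lambda>x. \<eta>) + integral ?J (\<lambda>x. (?g (s, x))^2 / \<eta>)"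
      by (rule integral_add) (use \<eta> in \<open>auto intro!: integrable_continuous_interval continuous_intros simp: wk_eq\<close>)
    also have "integral ?J (\<lambda>x. \<eta>) = \<eta> * l" using l_pos by simp
    also have "integral ?J (\<lambda>x. (?g (s, x))^2 / \<eta>) = (\<Sum>k\<in>A. (q k s)^2) / \<eta>"
      unfolding integral_divide using integral_wk_sum_square[OF l_pos A, of "\<lambda>k. q k s"] by simp
    finally show "integral ?J (\<lambda>x. \<eta> + (?g (s, x))^2 / \<eta>) = \<eta> * l + (\<Sum>k\<in>A. (q k s)^2) / \<eta>" .
  qed
  also have "\<dots> = integral {0..t} (\<lambda>s. \<eta> * l) + integral {0..t} (\<lambda>s. (\<Sum>k\<in>A. (q k s)^2) / \<eta>)"
    by (rule integral_add) (use \<eta> in \<open>auto intro!: integrable_continuous_interval continuous_intros q\<close>)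
  also have "integral {0..t} (\<lambda>s. \<eta> * l) = \<eta> * (t * l)" using t by simp
  also have "integral {0..t} (\<lambda>s. (\<Sum>k\<in>A. (q k s)^2) / \<eta>) = (\<Sum>k\<in>A. integral {0..t} (\<lambda>s. (q k s)^2)) / \<eta>"
    unfolding integral_divide
    by (subst integral_sum[OF A]) (auto intro!: integrable_continuous_interval continuous_intros q)
  finally show ?thesis .
qed

text \<open>The time derivative of \<open>B \<zeta>\<close> is given at each \<open>x\<close>
  separately, with no continuity in \<open>x\<close>, so it cannot be taken under the coefficient
  integral. The equation is averaged over time and space first; the result is an integral equation
  for one coefficient with continuous integrand.\<close>

lemma zeta_modes:
  assumes T: "0 < T" and eps: "0 < \<epsilon>" "\<epsilon> \<le> 1"
    and Psi: "creg {0..T} 4 Psi" "\<And>\<tau>. \<tau> \<in> {0..T} \<Longrightarrow> periodic l (Psi \<tau>)"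
    and Psit: "creg {0..T} 3 Psit" "\<And>\<tau>. \<tau> \<in> {0..T} \<Longrightarrow> periodic l (Psit \<tau>)"
    and sol: "zeta_solution l \<epsilon> T Psi Psit z" and t: "t \<in> {0..T}"
  shows "((\<lambda>s. fcoef l (z s) j) has_real_derivative (zrhs l \<epsilon> (Psi t) (Psit t) (z t) j / bsym l \<epsilon> j)) (at t within {0..T})"
proof -
  have zp: "\<And>\<tau>. \<tau> \<in> {0..T} \<Longrightarrow> periodic l (z \<tau>)" and z0: "\<And>x. z 0 x = 0" and zc: "creg {0..T} 4 z"
    and ok: "\<And>\<tau>. \<tau> \<in> {0..T} \<Longrightarrow> symop_ok l (bsym l \<epsilon>) (z \<tau>)" "\<And>\<tau>. \<tau> \<in> {0..T} \<Longrightarrow> symop_ok l (hsym l \<epsilon>) (Psit \<tau>)"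
      "\<And>\<tau>. \<tau> \<in> {0..T} \<Longrightarrow> symop_ok l (msym l \<epsilon>) (pd (Suc 0) (\<lambda>x. (Psi \<tau> x)^2))"
      "\<And>\<tau>. \<tau> \<in> {0..T} \<Longrightarrow> symop_ok l (fsym l \<epsilon>) (pd (Suc 0) (\<lambda>x. (z \<tau> x)^2))"
      "\<And>\<tau>. \<tau> \<in> {0..T} \<Longrightarrow> symop_ok l (fsym l \<epsilon>) (pd (Suc 0) (\<lambda>x. Psi \<tau> x * z \<tau> x))"
    and eq: "\<And>\<tau> x. \<tau> \<in> {0..T} \<Longrightarrow> \<exists>d. ((\<lambda>s. symop l (bsym l \<epsilon>) (z s) x) has_real_derivative d) (at \<tau> within {0..T})
             \<and> d + symop l (hsym l \<epsilon>) (Psit \<tau>) x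
               = - 4 * pd 4 (z \<tau>) x - pd 2 (z \<tau>) x
                 + symop l (msym l \<epsilon>) (pd (Suc 0) (\<lambda>y. (Psi \<tau> y)^2)) x
                 + \<epsilon> * symop l (fsym l \<epsilon>) (pd (Suc 0) (\<lambda>y. (z \<tau> y)^2)) x
                 + 2 * symop l (fsym l \<epsilon>) (pd (Suc 0) (\<lambda>y. Psi \<tau> y * z \<tau> y)) x"
    using sol unfolding zeta_solution_def One_nat_def by blast+
  define F where "F k s = zforce l \<epsilon> (Psi s) (Psit s) (z s) k" for k s
  define E where "E s = zrhs l \<epsilon> (Psi s) (Psit s) (z s) j" for s
  let ?y = "\<lambda>s. fcoef l (z s)"
  let ?J = "{-l/2..l/2}"
  have b: "1 \<le> bsym l \<epsilon> k" for k by (rule bsym_ge_1[OF eps])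
  have Fc: "continuous_on {0..T} (F k)" for k
    unfolding F_def by (intro zforce_continuous creg_mono[OF Psi(1)] creg_mono[OF Psit(1)] creg_mono[OF zc]) auto
  have yc: "continuous_on {0..T} (\<lambda>s. ?y s k)" for k
    by (rule fcoef_continuous) (use creg_mono[OF zc, of 0] in \<open>simp add: creg_0\<close>)
  have Ec: "continuous_on {0..T} E"
    using Fc[of j] unfolding E_def zrhs_def F_def by (intro continuous_intros yc)
  have z4: "cper l 4 (z s)" if "s \<in> {0..T}" for s by (rule creg_imp_cper[OF zc that zp[OF that]])
  have Fsum: "(\<lambda>k. F k s * wk l k x) sums
      (- symop l (hsym l \<epsilon>) (Psit s) x + symop l (msym l \<epsilon>) (pd (Suc 0) (\<lambda>y. (Psi s y)^2)) x
        + \<epsilon> * symop l (fsym l \<epsilon>) (pd (Suc 0) (\<lambda>y. (z s y)^2)) x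
        + 2 * symop l (fsym l \<epsilon>) (pd (Suc 0) (\<lambda>y. Psi s y * z s y)) x)" if s: "s \<in> {0..T}" for s x
  proof -
    have su: "(\<lambda>k. c k * fcoef l q k * wk l k x) sums symop l c q x" if "symop_ok l c q" for c q
      using that unfolding symop_ok_def symop_def by (blast intro: summable_sums)
    have "F k s * wk l k x = - (hsym l \<epsilon> k * fcoef l (Psit s) k * wk l k x)
        + msym l \<epsilon> k * fcoef l (pd (Suc 0) (\<lambda>y. (Psi s y)^2)) k * wk l k x
        + \<epsilon> * (fsym l \<epsilon> k * fcoef l (pd (Suc 0) (\<lambda>y. (z s y)^2)) k * wk l k x)
        + 2 * (fsym l \<epsilon> k * fcoef l (pd (Suc 0) (\<lambda>y. Psi s y * z s y)) k * wk l k x)" for k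
      by (simp add: F_def zforce_def algebra_simps)
    thus ?thesis by (simp only:) (intro sums_add sums_minus sums_mult su ok s)
  qed
  define U where "U s x = symop l (bsym l \<epsilon>) (z s) x" for s x
  define G where "G p = - 4 * pd 4 (z (fst p)) (snd p) - pd 2 (z (fst p)) (snd p) + (\<Sum>k. F k (fst p) * wk l k (snd p))" for p
  define S where "S n p = - 4 * pd 4 (z (fst p)) (snd p) - pd 2 (z (fst p)) (snd p) + (\<Sum>k<n. F k (fst p) * wk l k (snd p))" for n p
  have Ud: "((\<lambda>s. U s x) has_real_derivative G (s, x)) (at s within {0..T})" if s: "s \<in> {0..T}" for s x
  proof -
    obtain d where d: "((\<lambda>s. U s x) has_real_derivative d) (at s within {0..T})"
       "d + symop l (hsym l \<epsilon>) (Psit s) x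
               = - 4 * pd 4 (z s) x - pd 2 (z s) x
                 + symop l (msym l \<epsilon>) (pd (Suc 0) (\<lambda>y. (Psi s y)^2)) x
                 + \<epsilon> * symop l (fsym l \<epsilon>) (pd (Suc 0) (\<lambda>y. (z s y)^2)) x
                 + 2 * symop l (fsym l \<epsilon>) (pd (Suc 0) (\<lambda>y. Psi s y * z s y)) x"
      using eq[OF s, of x] unfolding U_def by blast
    have "d = G (s, x)" using d(2) sums_unique[OF Fsum[OF s, of x]] by (simp add: G_def)
    thus ?thesis using d(1) by simp
  qed
  obtain Ky where Ky: "Ky \<ge> 0" "\<forall>\<tau>\<in>{0..T}. \<forall>k. \<bar>?y \<tau> k\<bar> \<le> Ky * wt k ^ 4"
    using fcoef_decay_uniform[OF l_pos zc zp] by blast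
  \<comment> \<open>\<open>bsym\<close> is only quadratic in the frequency, so the order 4 of a
    classical solution leaves 2. Hence \<open>U s\<close> is a continuous function whose
    coefficients are the expected ones.\<close>
  have By: "\<bar>bsym l \<epsilon> k * ?y s k\<bar> \<le> 3 * (1 + 4 * pi / l) ^ 2 * Ky * wt k ^ 2" if s: "s \<in> {0..T}" for s k
  proof -
    have f: "0 \<le> freq l k" using l_pos by simp
    have w: "((1 + 2 * freq l k) * wt k) ^ 2 \<le> (1 + 4 * pi / l) ^ 2"
      using f by (intro power_mono one_plus_freq_wt l_pos) auto
    have "Xe l \<epsilon> k ^ 2 \<le> (1 + 2 * freq l k) ^ 2"
      using Xe_ge_1[of \<epsilon> l k] eps by (intro power_mono Xe_le l_pos) auto
    hence bb: "\<bar>bsym l \<epsilon> k\<bar> \<le> 3 * (1 + 2 * freq l k) ^ 2" using bsym_le[OF eps, of l k] b[of k] by linarith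
    have "\<bar>bsym l \<epsilon> k * ?y s k\<bar> \<le> (3 * (1 + 2 * freq l k) ^ 2) * (Ky * wt k ^ 4)"
      unfolding abs_mult using f s Ky by (intro mult_mono bb) auto
    also have "\<dots> = 3 * Ky * wt k ^ 2 * ((1 + 2 * freq l k) * wt k) ^ 2"
      by (simp add: power_mult_distrib power_add[symmetric])
    also have "\<dots> \<le> 3 * Ky * wt k ^ 2 * (1 + 4 * pi / l) ^ 2" using Ky by (intro mult_left_mono w) auto
    finally show ?thesis by (simp add: mult_ac)
  qed
  have U_ser: "U s = ser l (\<lambda>k. bsym l \<epsilon> k * ?y s k) 0" for s by (simp add: U_def symop_ser fun_eq_iff)
  have U_cont: "continuous_on A (U s)" if "s \<in> {0..T}" for s A
    unfolding U_ser by (rule ser_continuous[OF l_pos, of _ "3 * (1 + 4 * pi / l) ^ 2 * Ky"]) (use By[OF that] in \<open>simp add: power2_eq_square\<close>)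
  have Uf: "fcoef l (U s) j = bsym l \<epsilon> j * ?y s j" if "s \<in> {0..T}" for s
    unfolding U_ser by (rule fcoef_ser[OF l_pos By[OF that]])
  have "z 0 = (\<lambda>x. 0)" using z0 by auto
  hence y0: "?y 0 k = 0" for k by (simp add: fcoef_def)
  obtain B where B: "B \<ge> 0" "\<forall>s\<in>{0..T}. \<forall>N. (\<Sum>k<N. (F k s)^2) \<le> B"
    using zforce_square_sum_bound[OF Psi Psit zc zp eps] unfolding F_def by blast
  have main: "bsym l \<epsilon> j * ?y t j = integral {0..t} E" if t: "t \<in> {0..T}" for t
  proof -
    let ?R = "cbox (0, -l/2) (t, l/2)"
    have sub: "{0..t} \<subseteq> {0..T}" "0 \<le> t" using t by auto
    have Rsub: "?R \<subseteq> {0..T} \<times> UNIV" using t by (auto simp: cbox_Pair_eq)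
    have pdc: "continuous_on ?R (\<lambda>p. pd r (z (fst p)) (snd p))" if "r \<le> 4" for r
      using zc that Rsub unfolding creg_def by (blast intro: continuous_on_subset)
    have Fc': "continuous_on {0..t} (F k)" for k by (rule continuous_on_subset[OF Fc sub(1)])
    have FcR: "continuous_on ?R (\<lambda>p. F k (fst p))" for k
      by (rule continuous_on_compose2[OF Fc']) (auto intro!: continuous_intros simp: cbox_Pair_eq)
    have Sc: "continuous_on ?R (S n)" for n
      unfolding S_def[abs_def] wk_eq by (intro continuous_intros pdc FcR) auto
    let ?e = "\<lambda>k. integral {0..t} (\<lambda>s. (F k s)^2)"
    \<comment> \<open>The bound of the square sums at each time, integrated over time; the tails of
      this series measure the partial sums on the rectangle.\<close>
    have "summable ?e"
    proof (rule summableI_nonneg_bounded)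
      show "0 \<le> ?e k" for k by (rule integral_nonneg) (auto intro!: integrable_continuous_interval continuous_intros Fc')
      show "(\<Sum>k<N. ?e k) \<le> t * B" for N
      proof -
        have "(\<Sum>k<N. ?e k) = integral {0..t} (\<lambda>s. \<Sum>k<N. (F k s)^2)"
          by (rule integral_sum[symmetric]) (auto intro!: integrable_continuous_interval continuous_intros Fc')
        also have "\<dots> \<le> integral {0..t} (\<lambda>s. B)"
          by (rule integral_le) (use B sub in \<open>auto intro!: integrable_continuous_interval continuous_intros Fc'\<close>)
        also have "\<dots> = t * B" using sub by simp
        finally show ?thesis .
      qed
    qed
    have "(\<lambda>n. integral ?R (\<lambda>p. S n p * wk l j (snd p))) \<longlonglongrightarrow> integral ?J (\<lambda>x. (U t x - U 0 x) * wk l j x)"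
    proof (rule mean_of_pointwise_derivative[OF sub(2) Sc])
      show "(\<lambda>n. S n p) \<longlonglongrightarrow> G p" if "p \<in> ?R" for p
      proof -
        have "fst p \<in> {0..T}" using that Rsub by auto
        from sums_summable[OF Fsum[OF this, of "snd p"]] show ?thesis
          unfolding S_def G_def by (intro tendsto_intros summable_LIMSEQ)
      qed
      show "((\<lambda>s. U s x) has_real_derivative G (s, x)) (at s within {0..t})" if "s \<in> {0..t}" for x s
        using Ud[of s x] that sub by (auto intro: has_field_derivative_subset)
      show "continuous_on ?J (U 0)" "continuous_on ?J (U t)" using t sub T by (auto intro: U_cont)
      show "continuous_on ?J (wk l j)" unfolding wk_eq[abs_def] by (intro continuous_intros)
      fix e :: real assume e: "0 < e"
      \<comment> \<open>Makes the first term of \<open>rect_integral_abs_le\<close> at most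
        \<open>e / 2\<close>; the tail is afterwards taken below \<open>\<eta> * (e / 2)\<close>.
        The \<open>+ 1\<close> covers \<open>t = 0\<close>.\<close>
      define \<eta> where "\<eta> = e / (2 * (t * l + 1))"
      have tl: "0 \<le> t * l" using sub l_pos by simp
      have \<eta>: "0 < \<eta>" using e tl by (simp add: \<eta>_def)
      have \<eta>1: "\<eta> * (t * l) \<le> e / 2" using e tl by (simp add: \<eta>_def divide_simps)
      from \<open>summable ?e\<close>[unfolded summable_Cauchy] obtain N where
        N: "\<And>m n. m \<ge> N \<Longrightarrow> norm (sum ?e {m..<n}) < \<eta> * (e / 2)"
        using mult_pos_pos[OF \<eta>, of "e / 2"] e by (metis half_gt_zero)
      have half: "integral ?R (\<lambda>p. \<bar>S n p - S m p\<bar>) \<le> e" if "N \<le> m" "m \<le> n" for n m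
      proof -
        have "S n p - S m p = (\<Sum>k\<in>{m..<n}. F k (fst p) * wk l k (snd p))" for p
          unfolding S_def using that(2) by (simp add: sum_diff_nat_ivl[of 0 m n, folded atLeast0LessThan] atLeast0LessThan[symmetric] sum_diff_nat_ivl)
        hence "integral ?R (\<lambda>p. \<bar>S n p - S m p\<bar>) \<le> \<eta> * (t * l) + sum ?e {m..<n} / \<eta>"
          using rect_integral_abs_le[OF sub(2) Fc' _ \<eta>, of "{m..<n}"] by simp
        also have "sum ?e {m..<n} / \<eta> \<le> e / 2"
          using N[OF that(1), of n] \<eta> by (simp add: divide_le_eq abs_less_iff mult.commute)
        finally show ?thesis using \<eta>1 by linarith
      qed
      have "integral ?R (\<lambda>p. \<bar>S n p - S m p\<bar>) \<le> e" if "N \<le> n" "N \<le> m" for n m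
      proof (cases "m \<le> n")
        case False
        hence "integral ?R (\<lambda>p. \<bar>S m p - S n p\<bar>) \<le> e" by (intro half that) auto
        thus ?thesis by (simp only: abs_minus_commute)
      qed (intro half that)
      thus "\<exists>N. \<forall>n\<ge>N. \<forall>m\<ge>N. integral ?R (\<lambda>p. \<bar>S n p - S m p\<bar>) \<le> e" by blast
    qed
    \<comment> \<open>Tested against \<open>wk l j\<close>, the partial sums no longer depend on
      \<open>n\<close> once they contain mode \<open>j\<close>, so the limit is known
      exactly.\<close>
    moreover have "integral ?R (\<lambda>p. S n p * wk l j (snd p)) = integral {0..t} E" if n: "j < n" for n
    proof -
      have "integral ?R (\<lambda>p. S n p * wk l j (snd p)) = integral {0..t} (\<lambda>s. integral ?J (\<lambda>x. S n (s, x) * wk l j x))"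
      proof -
        have "continuous_on ?R (\<lambda>p. S n p * wk l j (snd p))" unfolding wk_eq by (intro continuous_intros Sc)
        from integral_prod_continuous[OF this] show ?thesis by (simp only: interval_cbox snd_conv)
      qed
      also have "\<dots> = integral {0..t} E"
      proof (rule integral_cong)
        fix s assume "s \<in> {0..t}"
        hence s: "s \<in> {0..T}" using sub by auto
        have pds: "continuous_on UNIV (pd r (z s))" if "r \<le> 4" for r
          using z4[OF s] that by (auto simp: cper_def creg_const_iff)
        have c1: "continuous_on ?J (\<lambda>x. (- 4) * pd 4 (z s) x + (- 1) * pd 2 (z s) x)"
          by (intro continuous_intros continuous_on_subset[OF pds]) auto
        have c2: "continuous_on ?J (\<lambda>x. \<Sum>k<n. F k s * wk l k x)" unfolding wk_eq by (intro continuous_intros)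
        have "integral ?J (\<lambda>x. S n (s, x) * wk l j x)
           = fcoef l (\<lambda>x. ((- 4) * pd 4 (z s) x + (- 1) * pd 2 (z s) x) + (\<Sum>k<n. F k s * wk l k x)) j"
          unfolding fcoef_def S_def by simp
        also have "\<dots> = fcoef l (\<lambda>x. (- 4) * pd 4 (z s) x + (- 1) * pd 2 (z s) x) j + fcoef l (\<lambda>x. \<Sum>k<n. F k s * wk l k x) j"
          by (rule fcoef_add[OF c1 c2])
        also have "fcoef l (\<lambda>x. (- 4) * pd 4 (z s) x + (- 1) * pd 2 (z s) x) j
            = fcoef l (\<lambda>x. (- 4) * pd 4 (z s) x) j + fcoef l (\<lambda>x. (- 1) * pd 2 (z s) x) j"
          by (rule fcoef_add) (intro continuous_intros continuous_on_subset[OF pds]; simp)+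
        also have "\<dots> = (- 4) * fcoef l (pd 4 (z s)) j + (- 1) * fcoef l (pd 2 (z s)) j" by (simp only: fcoef_cmult)
        also have "fcoef l (pd 4 (z s)) j = lam l j ^ 2 * ?y s j" by (rule fcoef_pd_4[OF l_pos z4[OF s]])
        also have "fcoef l (pd 2 (z s)) j = - lam l j * ?y s j"
          by (rule fcoef_pd_2[OF l_pos cper_mono[OF z4[OF s]]]) simp
        also have "fcoef l (\<lambda>x. \<Sum>k<n. F k s * wk l k x) j = F j s"
        proof -
          have "fcoef l (\<lambda>x. \<Sum>k<n. F k s * wk l k x) j = integral ?J (\<lambda>x. \<Sum>k<n. F k s * (wk l k x * wk l j x))"
            unfolding fcoef_def by (simp add: sum_distrib_right mult.assoc)
          also have "\<dots> = (\<Sum>k<n. integral ?J (\<lambda>x. F k s * (wk l k x * wk l j x)))"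
            unfolding wk_eq by (intro integral_sum integrable_continuous_interval continuous_intros) auto
          also have "\<dots> = (\<Sum>k<n. F k s * (if k = j then 1 else 0))"
            by (simp only: integral_mult_right wk_orthonormal[OF l_pos])
          also have "\<dots> = F j s" using n by (simp add: if_distrib cong: if_cong)
          finally show ?thesis .
        qed
        finally show "integral ?J (\<lambda>x. S n (s, x) * wk l j x) = E s"
          by (simp add: E_def zrhs_def F_def algebra_simps)
      qed
      finally show ?thesis .
    qed
    hence "(\<lambda>n. integral ?R (\<lambda>p. S n p * wk l j (snd p))) \<longlonglongrightarrow> integral {0..t} E"
      by (intro tendsto_eventually) (auto simp: eventually_sequentially intro!: exI[of _ "Suc j"])
    ultimately have "integral ?J (\<lambda>x. (U t x - U 0 x) * wk l j x) = integral {0..t} E" by (rule LIMSEQ_unique)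
    moreover have "integral ?J (\<lambda>x. (U t x - U 0 x) * wk l j x) = fcoef l (U t) j - fcoef l (U 0) j"
      unfolding fcoef_def[symmetric] by (rule fcoef_diff) (use t T U_cont in auto)
    ultimately show ?thesis using Uf[OF t] Uf[of 0] T y0 by simp
  qed
  \<comment> \<open>As \<open>E\<close> is continuous, the integral equation can be differentiated
    back at every time.\<close>
  have "((\<lambda>t. integral {0..t} E / bsym l \<epsilon> j) has_real_derivative E t / bsym l \<epsilon> j) (at t within {0..T})"
    by (intro DERIV_cdivide integral_has_real_derivative Ec t)
  moreover have "integral {0..s} E / bsym l \<epsilon> j = ?y s j" if "s \<in> {0..T}" for s
    using main[OF that] b[of j] by (simp add: divide_eq_eq mult.commute)
  ultimately show ?thesis
    unfolding E_def using t by (auto intro: has_field_derivative_transform_within[where d = 1])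
qed

end

text \<open>The series bounds are uniform on bounded time intervals only. Derivative and continuity
  are local, and near a given time \<open>{0..}\<close> agrees with an interval reaching one unit
  further.\<close>

lemma time_deriv_atLeast:
  assumes "\<And>T. 0 < T \<Longrightarrow> time_deriv {0..T} u ut"
  shows "time_deriv {0..} u ut"
  unfolding time_deriv_def
proof (intro conjI ballI allI)
  fix \<tau> x :: real assume "\<tau> \<in> {0..}"
  hence \<tau>: "0 \<le> \<tau>" by simp
  have "at \<tau> within {0..\<tau> + 1} = at \<tau> within {0..}"
    by (rule at_within_nhd[of _ "{..<\<tau> + 1}"]) auto
  moreover have "((\<lambda>s. u s x) has_real_derivative ut \<tau> x) (at \<tau> within {0..\<tau> + 1})"
    using assms[of "\<tau> + 1"] \<tau> by (simp add: time_deriv_def)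
  ultimately show "((\<lambda>s. u s x) has_real_derivative ut \<tau> x) (at \<tau> within {0..})" by simp
next
  show "continuous_on ({0..} \<times> UNIV) (\<lambda>p. ut (fst p) (snd p))"
    unfolding continuous_on_eq_continuous_within
  proof
    fix p :: "real \<times> real" assume "p \<in> {0..} \<times> UNIV"
    hence p: "0 \<le> fst p" by auto
    have "at p within {0..fst p + 1} \<times> UNIV = at p within {0..} \<times> UNIV"
      by (rule at_within_nhd[of _ "{..<fst p + 1} \<times> UNIV"]) (auto intro: open_Times simp: mem_Times_iff)
    moreover have "continuous (at p within {0..fst p + 1} \<times> UNIV) (\<lambda>p. ut (fst p) (snd p))"
      using assms[of "fst p + 1"] p unfolding time_deriv_def continuous_on_eq_continuous_within
      by (cases p) auto
    ultimately show "continuous (at p within {0..} \<times> UNIV) (\<lambda>p. ut (fst p) (snd p))" by simp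
  qed
qed

section \<open>Comparison of two solutions\<close>

lemma zeta_solution_cper:
  assumes "zeta_solution l \<epsilon> T Psi Psit z" "\<tau> \<in> {0..T}"
  shows "cper l 2 (z \<tau>)"
proof (rule creg_imp_cper[OF _ assms(2)])
  show "creg {0..T} 2 z" by (rule creg_mono[of _ 4]) (use assms(1) in \<open>auto simp: zeta_solution_def\<close>)
  show "periodic l (z \<tau>)" using assms by (auto simp: zeta_solution_def)
qed

lemma zeta_solution_fcoef_0: "zeta_solution l \<epsilon> T Psi Psit z \<Longrightarrow> fcoef l (z 0) k = 0"
  by (simp add: zeta_solution_def fcoef_def)

definition gap_const :: "real \<Rightarrow> real" where
  "gap_const l = 2 * weight_const l * (sqrt (2 / l) * l)"

context
  fixes l :: real
  assumes l_pos: "0 < l"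
begin

text \<open>The inverse square weight is comparable with \<open>1 + lam l k\<close>, whose two
  summands correspond to the function and its second derivative.\<close>

lemma fcoef_gap:
  assumes f: "cper l 2 f" and g: "cper l 2 g"
    and d: "\<And>x. x \<in> {-l/2..l/2} \<Longrightarrow> \<bar>f x - g x\<bar> \<le> 1" "\<And>x. x \<in> {-l/2..l/2} \<Longrightarrow> \<bar>pd 2 f x - pd 2 g x\<bar> \<le> 1"
  shows "\<bar>fcoef l f k - fcoef l g k\<bar> \<le> gap_const l * wt k ^ 2"
proof -
  let ?d = "fcoef l f k - fcoef l g k"
  let ?B = "sqrt (2 / l) * l"
  let ?J = "{-l/2..l/2}"
  have pc: "continuous_on ?J (pd 2 u)" if "cper l 2 u" for u
    using that by (auto simp: cper_def creg_const_iff intro: continuous_on_subset)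
  have lam: "0 \<le> lam l k" using l_pos by simp
  have "\<bar>fcoef l (\<lambda>x. f x - g x) k\<bar> \<le> 1 * sqrt (2 / l) * l"
    by (rule fcoef_bound[OF l_pos _ d(1)]) (intro continuous_intros cper_continuous[OF f] cper_continuous[OF g])
  moreover have "fcoef l (\<lambda>x. f x - g x) k = ?d"
    by (rule fcoef_diff[OF cper_continuous[OF f] cper_continuous[OF g]])
  ultimately have 1: "\<bar>?d\<bar> \<le> ?B" by simp
  have "\<bar>fcoef l (\<lambda>x. pd 2 f x - pd 2 g x) k\<bar> \<le> 1 * sqrt (2 / l) * l"
    by (rule fcoef_bound[OF l_pos _ d(2)]) (intro continuous_intros pc f g)
  moreover have "fcoef l (\<lambda>x. pd 2 f x - pd 2 g x) k = - (lam l k * ?d)"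
    by (simp add: fcoef_diff[OF pc[OF f] pc[OF g]] fcoef_pd_2[OF l_pos f] fcoef_pd_2[OF l_pos g] algebra_simps)
  ultimately have 2: "lam l k * \<bar>?d\<bar> \<le> ?B" using lam by (simp add: abs_mult)
  have "\<bar>?d\<bar> \<le> (weight_const l * (1 + lam l k) * wt k ^ 2) * \<bar>?d\<bar>"
    using mult_right_mono[OF inverse_wt_square_le[OF l_pos, of k], of "\<bar>?d\<bar>"] by simp
  also have "\<dots> = weight_const l * wt k ^ 2 * (\<bar>?d\<bar> + lam l k * \<bar>?d\<bar>)" by (simp add: algebra_simps)
  also have "\<dots> \<le> weight_const l * wt k ^ 2 * (?B + ?B)"
    using weight_const_pos[OF l_pos] by (intro mult_left_mono add_mono 1 2) auto
  finally show ?thesis by (simp add: gap_const_def mult_ac)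
qed

text \<open>The crude bound \<open>2 * Y\<close> of the difference is improved repeatedly: each
  passage through the mode equations at least halves its constant, so it tends to 0 at every fixed
  time and index.\<close>

lemma zeta_unique_bounded:
  assumes T: "0 < T" and g: "good_params l P Y \<epsilon> \<gamma>" and P: "0 \<le> P"
    and Psi: "creg {0..T} 4 Psi" "\<And>\<tau>. \<tau> \<in> {0..T} \<Longrightarrow> periodic l (Psi \<tau>)"
    and Psit: "creg {0..T} 3 Psit" "\<And>\<tau>. \<tau> \<in> {0..T} \<Longrightarrow> periodic l (Psit \<tau>)"
    and a: "\<And>\<tau> k. \<tau> \<in> {0..T} \<Longrightarrow> \<bar>fcoef l (Psi \<tau>) k\<bar> \<le> P * wt k ^ 2"
    and z1: "zeta_solution l \<epsilon> T Psi Psit z1" and z2: "zeta_solution l \<epsilon> T Psi Psit z2"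
    and t1: "t1 \<in> {0..T}"
    and y: "\<And>\<tau> k. \<tau> \<in> {0..t1} \<Longrightarrow> \<bar>fcoef l (z1 \<tau>) k\<bar> \<le> Y * wt k ^ 2" "\<And>\<tau> k. \<tau> \<in> {0..t1} \<Longrightarrow> \<bar>fcoef l (z2 \<tau>) k\<bar> \<le> Y * wt k ^ 2"
    and t: "t \<in> {0..t1}"
  shows "fcoef l (z1 t) k = fcoef l (z2 t) k"
proof -
  have eps: "0 < \<epsilon>" "\<epsilon> \<le> 1" and \<gamma>: "3 \<le> \<gamma>" using g by (auto simp: good_params_def)
  have sub: "\<tau> \<in> {0..T}" if "\<tau> \<in> {0..t1}" for \<tau> using that t1 by auto
  note c = zeta_solution_cper
  have cP: "cper l 2 (Psi \<tau>)" if "\<tau> \<in> {0..T}" for \<tau>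
    by (rule creg_imp_cper[OF creg_mono[OF Psi(1)] that Psi(2)[OF that]]) simp
  have Y: "0 \<le> Y" using decay_bound_nonneg[OF y(1)[of 0 0]] t1 by simp
  have b: "1 \<le> bsym l \<epsilon> k" for k by (rule bsym_ge_1[OF eps])
  have r1: "1 \<le> rate l \<epsilon> k + \<gamma>" for k by (rule rate_plus_ge_1[OF l_pos g])
  have init: "fcoef l (z1 0) k - fcoef l (z2 0) k = 0" for k
    by (simp add: zeta_solution_fcoef_0[OF z1] zeta_solution_fcoef_0[OF z2])
  have modes: "((\<lambda>s. fcoef l (z s) k) has_real_derivative zrhs l \<epsilon> (Psi s) (Psit s) (z s) k / bsym l \<epsilon> k) (at s within {0..t1})"
    if "zeta_solution l \<epsilon> T Psi Psit z" "s \<in> {0..t1}" for z s k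
    by (rule has_field_derivative_subset[OF zeta_modes[OF l_pos T eps Psi Psit that(1) sub[OF that(2)]]]) (use sub in auto)
  have iter: "\<bar>fcoef l (z1 t) k - fcoef l (z2 t) k\<bar> \<le> 2 * Y / 2 ^ n * exp (\<gamma> * t) * wt k ^ 2" if "t \<in> {0..t1}" for n t k
    using that
  proof (induction n arbitrary: t k)
    case 0
    have "\<bar>fcoef l (z1 t) k - fcoef l (z2 t) k\<bar> \<le> 2 * Y * 1 * wt k ^ 2"
      using y(1)[OF 0, of k] y(2)[OF 0, of k] by linarith
    also have "\<dots> \<le> 2 * Y * exp (\<gamma> * t) * wt k ^ 2"
      using 0 \<gamma> Y by (intro mult_right_mono mult_left_mono) auto
    finally show ?case by simp
  next
    case (Suc n)
    let ?K = "2 * Y / 2 ^ n"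
    let ?r = "rate l \<epsilon> k + \<gamma>"
    let ?y = "\<lambda>s. fcoef l (z1 s) k - fcoef l (z2 s) k"
    have "\<bar>?y t\<bar> \<le> exp (\<gamma> * t) * (\<bar>?y 0\<bar> + (?r / 4 * (?K * wt k ^ 2)) / ?r)"
    proof (rule ode_growth_bound[OF DERIV_diff[OF modes[OF z1] modes[OF z2]] _ _ Suc.prems])
      fix s assume s: "s \<in> {0..t1}"
      note sT = sub[OF s]
      have "zrhs l \<epsilon> (Psi s) (Psit s) (z1 s) k / bsym l \<epsilon> k - zrhs l \<epsilon> (Psi s) (Psit s) (z2 s) k / bsym l \<epsilon> k + rate l \<epsilon> k * ?y s
         = (zforce l \<epsilon> (Psi s) (Psit s) (z1 s) k - zforce l \<epsilon> (Psi s) (Psit s) (z2 s) k) / bsym l \<epsilon> k"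
      proof -
        have "(F1 - q * u1) / c - (F2 - q * u2) / c + q / c * (u1 - u2) = (F1 - F2) / c" for F1 F2 q u1 u2 c :: real
          by (simp add: diff_divide_distrib right_diff_distrib)
        thus ?thesis unfolding zrhs_def rate_def .
      qed
      hence "\<bar>zrhs l \<epsilon> (Psi s) (Psit s) (z1 s) k / bsym l \<epsilon> k - zrhs l \<epsilon> (Psi s) (Psit s) (z2 s) k / bsym l \<epsilon> k + rate l \<epsilon> k * ?y s\<bar>
         = \<bar>zforce l \<epsilon> (Psi s) (Psit s) (z1 s) k - zforce l \<epsilon> (Psi s) (Psit s) (z2 s) k\<bar> / bsym l \<epsilon> k"
        using b[of k] by simp
      also have "\<dots> \<le> ?r / 4 * (?K * exp (\<gamma> * s) * wt k ^ 2)"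
        by (rule zforce_contraction[OF l_pos g P _ cP[OF sT] c[OF z1 sT] c[OF z2 sT] a[OF sT] y(1)[OF s] y(2)[OF s] Suc.IH[OF s]]) simp
      finally show "\<bar>zrhs l \<epsilon> (Psi s) (Psit s) (z1 s) k / bsym l \<epsilon> k - zrhs l \<epsilon> (Psi s) (Psit s) (z2 s) k / bsym l \<epsilon> k + rate l \<epsilon> k * ?y s\<bar>
         \<le> ?r / 4 * (?K * wt k ^ 2) * exp (\<gamma> * s)" by (simp add: mult_ac)
    qed (use r1[of k] in auto)
    also have "\<dots> = ?K / 4 * exp (\<gamma> * t) * wt k ^ 2"
      using r1[of k] by (simp add: init)
    also have "\<dots> \<le> ?K / 2 * exp (\<gamma> * t) * wt k ^ 2"
    proof (intro mult_right_mono)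
      have "0 \<le> ?K" using Y by simp
      thus "?K / 4 \<le> ?K / 2" by (intro divide_left_mono) auto
    qed auto
    finally show ?case by (simp add: mult_ac)
  qed
  have "(\<lambda>n. 2 * Y * exp (\<gamma> * t) * wt k ^ 2 * (1 / 2) ^ n) \<longlonglongrightarrow> 2 * Y * exp (\<gamma> * t) * wt k ^ 2 * 0"
    by (intro tendsto_mult tendsto_const LIMSEQ_power_zero) auto
  hence "\<bar>fcoef l (z1 t) k - fcoef l (z2 t) k\<bar> \<le> 2 * Y * exp (\<gamma> * t) * wt k ^ 2 * 0"
  proof (rule LIMSEQ_le_const)
    have "\<bar>fcoef l (z1 t) k - fcoef l (z2 t) k\<bar> \<le> 2 * Y * exp (\<gamma> * t) * wt k ^ 2 * (1 / 2) ^ n" for n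
      using iter[OF t, of k n] by (simp add: power_one_over mult_ac)
    thus "\<exists>N. \<forall>n\<ge>N. \<bar>fcoef l (z1 t) k - fcoef l (z2 t) k\<bar> \<le> 2 * Y * exp (\<gamma> * t) * wt k ^ 2 * (1 / 2) ^ n" by blast
  qed
  thus ?thesis by simp
qed

text \<open>The second solution is not known to be small. It is compared with the first one on successive short
  time intervals, on each of which it stays within \<^term>\<open>gap_const l\<close> of its value at the left end.\<close>

lemma zeta_unique:
  assumes T: "0 < T" and g: "good_params l P Y \<epsilon> \<gamma>" and P: "0 \<le> P"
    and Psi: "creg {0..T} 4 Psi" "\<And>\<tau>. \<tau> \<in> {0..T} \<Longrightarrow> periodic l (Psi \<tau>)"
    and Psit: "creg {0..T} 3 Psit" "\<And>\<tau>. \<tau> \<in> {0..T} \<Longrightarrow> periodic l (Psit \<tau>)"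
    and a: "\<And>\<tau> k. \<tau> \<in> {0..T} \<Longrightarrow> \<bar>fcoef l (Psi \<tau>) k\<bar> \<le> P * wt k ^ 2"
    and z1: "zeta_solution l \<epsilon> T Psi Psit z1" and z2: "zeta_solution l \<epsilon> T Psi Psit z2"
    and y1: "\<And>\<tau> k. \<tau> \<in> {0..T} \<Longrightarrow> \<bar>fcoef l (z1 \<tau>) k\<bar> \<le> Y1 * wt k ^ 2" and Y: "Y1 + gap_const l \<le> Y"
    and t: "t \<in> {0..T}"
  shows "z2 t x = z1 t x"
proof -
  have reg: "creg {0..T} 4 z2" using z2 by (simp add: zeta_solution_def)
  note c = zeta_solution_cper
  have gap0: "0 \<le> gap_const l" using l_pos weight_const_pos[OF l_pos] by (simp add: gap_const_def)
  \<comment> \<open>Compactness gives a step length that does not depend on the time at which the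
    step starts.\<close>
  have uc: "\<exists>h>0. \<forall>s\<in>{0..T}. \<forall>t\<in>{0..T}. \<bar>s - t\<bar> < h \<longrightarrow> (\<forall>x\<in>{-l/2..l/2}. \<bar>pd r (z2 s) x - pd r (z2 t) x\<bar> \<le> 1)"
    if r: "r \<le> 4" for r
  proof -
    let ?K = "{0..T} \<times> {-l/2..l/2}"
    have "continuous_on ?K (\<lambda>p. pd r (z2 (fst p)) (snd p))"
      using reg r unfolding creg_def by (blast intro: continuous_on_subset)
    hence "uniformly_continuous_on ?K (\<lambda>p. pd r (z2 (fst p)) (snd p))"
      by (intro compact_uniformly_continuous compact_Times) auto
    then obtain h where h: "h > 0" "\<And>p q. p \<in> ?K \<Longrightarrow> q \<in> ?K \<Longrightarrow> dist q p < h \<Longrightarrow> dist (pd r (z2 (fst q)) (snd q)) (pd r (z2 (fst p)) (snd p)) < 1"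
      unfolding uniformly_continuous_on_def by (metis zero_less_one)
    have "\<bar>pd r (z2 s) x - pd r (z2 t) x\<bar> \<le> 1" if "s \<in> {0..T}" "t \<in> {0..T}" "\<bar>s - t\<bar> < h" "x \<in> {-l/2..l/2}" for s t x
      using h(2)[of "(t, x)" "(s, x)"] that by (simp add: dist_Pair_Pair dist_real_def)
    thus ?thesis using h(1) by blast
  qed
  obtain h0 where h0: "h0 > 0" "\<forall>s\<in>{0..T}. \<forall>t\<in>{0..T}. \<bar>s - t\<bar> < h0 \<longrightarrow> (\<forall>x\<in>{-l/2..l/2}. \<bar>pd 0 (z2 s) x - pd 0 (z2 t) x\<bar> \<le> 1)"
    using uc[of 0] by auto
  obtain h2 where h2: "h2 > 0" "\<forall>s\<in>{0..T}. \<forall>t\<in>{0..T}. \<bar>s - t\<bar> < h2 \<longrightarrow> (\<forall>x\<in>{-l/2..l/2}. \<bar>pd 2 (z2 s) x - pd 2 (z2 t) x\<bar> \<le> 1)"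
    using uc[of 2] by auto
  define h where "h = min h0 h2 / 2"
  have h: "h > 0" "h < h0" "h < h2" using h0(1) h2(1) by (auto simp: h_def)
  have gap: "\<bar>fcoef l (z2 s) k - fcoef l (z2 t) k\<bar> \<le> gap_const l * wt k ^ 2" if "s \<in> {0..T}" "t \<in> {0..T}" "\<bar>s - t\<bar> \<le> h" for s t k
  proof (rule fcoef_gap[OF c[OF z2 that(1)] c[OF z2 that(2)]])
    fix x assume x: "x \<in> {-l/2..l/2}"
    have "\<bar>s - t\<bar> < h0" "\<bar>s - t\<bar> < h2" using that(3) h by linarith+
    thus "\<bar>z2 s x - z2 t x\<bar> \<le> 1" "\<bar>pd 2 (z2 s) x - pd 2 (z2 t) x\<bar> \<le> 1"
      using h0(2)[rule_format, OF that(1,2) _ x] h2(2)[rule_format, OF that(1,2) _ x] by simp_all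
  qed
  have Y1: "0 \<le> Y1" using decay_bound_nonneg[OF y1[of 0 0]] T by simp
  \<comment> \<open>For \<open>n = 0\<close> only the initial time is covered, where both solutions
    vanish.\<close>
  have eq: "\<forall>\<tau>\<in>{0..T}. \<tau> \<le> real n * h \<longrightarrow> (\<forall>k. fcoef l (z1 \<tau>) k = fcoef l (z2 \<tau>) k)" for n
  proof (induction n)
    case 0
    show ?case by (auto simp: zeta_solution_fcoef_0[OF z1] zeta_solution_fcoef_0[OF z2])
  next
    case (Suc n)
    define t1 where "t1 = min T (real (Suc n) * h)"
    have t1: "t1 \<in> {0..T}" using T h(1) by (simp add: t1_def)
    have yb1: "\<bar>fcoef l (z1 \<tau>) k\<bar> \<le> Y * wt k ^ 2" if "\<tau> \<in> {0..t1}" for \<tau> k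
    proof -
      have "\<bar>fcoef l (z1 \<tau>) k\<bar> \<le> Y1 * wt k ^ 2" using that t1 by (intro y1) auto
      also have "\<dots> \<le> Y * wt k ^ 2" using Y gap0 by (intro mult_right_mono) auto
      finally show ?thesis .
    qed
    have yb2: "\<bar>fcoef l (z2 \<tau>) k\<bar> \<le> Y * wt k ^ 2" if "\<tau> \<in> {0..t1}" for \<tau> k
    proof -
      \<comment> \<open>The latest time not after \<open>\<tau>\<close> at which agreement is
        already known; there the second solution inherits the bound \<open>Y1\<close> of the
        first.\<close>
      define \<sigma> where "\<sigma> = min \<tau> (real n * h)"
      have \<sigma>: "\<sigma> \<in> {0..T}" "\<sigma> \<le> real n * h" "\<tau> \<in> {0..T}" using that t1 h(1) by (auto simp: \<sigma>_def min_def)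
      have "\<tau> \<le> real n * h + h" using that by (auto simp: t1_def algebra_simps)
      hence "\<bar>\<tau> - \<sigma>\<bar> \<le> h" using h(1) by (auto simp: \<sigma>_def min_def)
      hence "\<bar>fcoef l (z2 \<tau>) k - fcoef l (z2 \<sigma>) k\<bar> \<le> gap_const l * wt k ^ 2" by (rule gap[OF \<sigma>(3,1)])
      moreover have "\<bar>fcoef l (z2 \<sigma>) k\<bar> \<le> Y1 * wt k ^ 2" using Suc.IH \<sigma> y1[OF \<sigma>(1), of k] by auto
      ultimately have "\<bar>fcoef l (z2 \<tau>) k\<bar> \<le> (Y1 + gap_const l) * wt k ^ 2" unfolding distrib_right by linarith
      also have "\<dots> \<le> Y * wt k ^ 2" by (intro mult_right_mono Y) auto
      finally show ?thesis .
    qed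
    have "fcoef l (z1 \<tau>) k = fcoef l (z2 \<tau>) k" if "\<tau> \<in> {0..t1}" for \<tau> k
      by (rule zeta_unique_bounded[OF T g P Psi Psit a z1 z2 t1 yb1 yb2 that])
    thus ?case by (auto simp: t1_def)
  qed
  obtain n where "T < real n * h" using reals_Archimedean3[OF h(1)] by blast
  hence "fcoef l (z1 t) = fcoef l (z2 t)" using eq[of n] t by (auto simp: fun_eq_iff)
  thus ?thesis
    using fourier_inversion[OF l_pos c[OF z1 t], of x] fourier_inversion[OF l_pos c[OF z2 t], of x] by simp
qed

section \<open>Assembly of existence and uniqueness\<close>

lemma good_params_mono:
  assumes g: "good_params l P Y \<epsilon> \<gamma>" and Y: "Y' \<le> Y"
  shows "good_params l P Y' \<epsilon> \<gamma>"
proof -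
  have "0 < \<epsilon>" "\<epsilon> * Y \<le> 1" using g by (auto simp: good_params_def)
  hence "\<epsilon> * Y' \<le> 1" using mult_left_mono[OF Y, of \<epsilon>] by linarith
  thus ?thesis using g by (simp add: good_params_def)
qed

lemma zeta_well_posed:
  assumes T: "0 < T"
    and Psi: "\<And>\<tau>. 0 \<le> \<tau> \<Longrightarrow> Psi \<tau> = ser l (\<psi> \<tau>) 0"
    and \<psi>: "\<And>k. continuous_on {0..} (\<lambda>\<tau>. \<psi> \<tau> k)" and \<psi>': "\<And>k. continuous_on {0..} (\<lambda>\<tau>. \<psi>' \<tau> k)"
    and P: "0 \<le> P" "\<And>\<tau> k. \<tau> \<in> {0..T} \<Longrightarrow> \<bar>\<psi> \<tau> k\<bar> \<le> P * wt k ^ 12" "\<And>\<tau> k. \<tau> \<in> {0..T} \<Longrightarrow> \<bar>\<psi>' \<tau> k\<bar> \<le> P * wt k ^ 8"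
  defines "Psit \<equiv> \<lambda>\<tau>. ser l (\<psi>' \<tau>) 0"
  shows "\<exists>\<epsilon>0>0. \<forall>\<epsilon>. 0 < \<epsilon> \<and> \<epsilon> \<le> \<epsilon>0 \<longrightarrow>
          (\<exists>z. zeta_solution l \<epsilon> T Psi Psit z \<and>
             (\<forall>z'. zeta_solution l \<epsilon> T Psi Psit z' \<longrightarrow> (\<forall>\<tau>\<in>{0..T}. \<forall>x. z' \<tau> x = z \<tau> x)))"
proof -
  have \<psi>_le: "\<bar>\<psi> \<tau> k\<bar> \<le> P * wt k ^ n" if "\<tau> \<in> {0..T}" "n \<le> 12" for \<tau> k n
    by (rule decay_mono[OF P(2)[OF that(1)] that(2)])
  have \<psi>'_le: "\<bar>\<psi>' \<tau> k\<bar> \<le> P * wt k ^ n" if "\<tau> \<in> {0..T}" "n \<le> 8" for \<tau> k n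
    by (rule decay_mono[OF P(3)[OF that(1)] that(2)])
  have T_sub: "{0..T} \<subseteq> {0..}" by auto
  have Psic: "creg {0..T} 4 Psi"
  proof -
    have "creg {0..T} 4 (\<lambda>\<tau>. ser l (\<psi> \<tau>) 0)"
      by (rule ser_creg[OF l_pos \<psi>_le continuous_on_subset[OF \<psi> T_sub]]) auto
    moreover have "creg {0..T} 4 Psi = creg {0..T} 4 (\<lambda>\<tau>. ser l (\<psi> \<tau>) 0)"
      by (rule creg_cong) (auto simp: Psi)
    ultimately show ?thesis by simp
  qed
  have Psip: "periodic l (Psi \<tau>)" if "\<tau> \<in> {0..T}" for \<tau>
    using that by (simp add: Psi periodic_def ser_periodic[OF l_pos])
  have Psitc: "creg {0..T} 3 Psit"
    unfolding Psit_def by (rule ser_creg[OF l_pos \<psi>'_le continuous_on_subset[OF \<psi>' T_sub]]) auto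
  have Psitp: "periodic l (Psit \<tau>)" for \<tau> by (simp add: Psit_def periodic_def ser_periodic[OF l_pos])
  have fP: "fcoef l (Psi \<tau>) k = \<psi> \<tau> k" if "\<tau> \<in> {0..T}" for \<tau> k
  proof -
    have "fcoef l (ser l (\<psi> \<tau>) 0) k = \<psi> \<tau> k" by (rule fcoef_ser[OF l_pos \<psi>_le[OF that]]) simp
    thus ?thesis using that by (simp add: Psi)
  qed
  have fPt: "fcoef l (Psit \<tau>) k = \<psi>' \<tau> k" if "\<tau> \<in> {0..T}" for \<tau> k
    unfolding Psit_def by (rule fcoef_ser[OF l_pos \<psi>'_le[OF that]]) simp
  have a: "\<bar>fcoef l (Psi \<tau>) k\<bar> \<le> P * wt k ^ n" if "\<tau> \<in> {0..T}" "n \<le> 12" for \<tau> k n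
    using \<psi>_le[OF that] by (simp add: fP[OF that(1)])
  have a': "\<bar>fcoef l (Psit \<tau>) k\<bar> \<le> P * wt k ^ 8" if "\<tau> \<in> {0..T}" for \<tau> k
    using P(3)[OF that] by (simp add: fPt[OF that])
  have a12: "\<bar>fcoef l (Psi \<tau>) k\<bar> \<le> P * wt k ^ 12" and a2: "\<bar>fcoef l (Psi \<tau>) k\<bar> \<le> P * wt k ^ 2"
    if "\<tau> \<in> {0..T}" for \<tau> k
    by (rule a[OF that], simp)+
  obtain \<gamma> where \<gamma>: "3 \<le> \<gamma>" "\<And>Y. 0 \<le> Y \<Longrightarrow> \<exists>\<epsilon>0>0. \<forall>\<epsilon>. 0 < \<epsilon> \<and> \<epsilon> \<le> \<epsilon>0 \<longrightarrow> good_params l P Y \<epsilon> \<gamma>"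
    using good_params_exist[OF l_pos P(1)] by metis
  define R where "R = 2 * forcing_const l P + 1"
  have R: "0 \<le> R" using P(1) conv_const_nonneg[OF l_pos, of 12] l_pos by (simp add: R_def forcing_const_def)
  define Y1 where "Y1 = R * exp (\<gamma> * T)"
  have gap0: "0 \<le> gap_const l" using l_pos weight_const_pos[OF l_pos] by (simp add: gap_const_def)
  have Y1: "0 \<le> Y1" using R by (simp add: Y1_def)
  have Y1_ge: "R * exp (\<gamma> * T) \<le> Y1" by (simp add: Y1_def)
  \<comment> \<open>The parameters are prepared for the larger size \<open>Y1 + gap_const l\<close>
    that the uniqueness argument meets; monotonicity returns the size \<open>Y1\<close> for
    existence, so one threshold serves both.\<close>
  obtain \<epsilon>0 where \<epsilon>0: "0 < \<epsilon>0" "\<And>\<epsilon>. 0 < \<epsilon> \<Longrightarrow> \<epsilon> \<le> \<epsilon>0 \<Longrightarrow> good_params l P (Y1 + gap_const l) \<epsilon> \<gamma>"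
    using \<gamma>(2)[of "Y1 + gap_const l"] Y1 gap0 by auto
  have "\<exists>z. zeta_solution l \<epsilon> T Psi Psit z \<and>
             (\<forall>z'. zeta_solution l \<epsilon> T Psi Psit z' \<longrightarrow> (\<forall>\<tau>\<in>{0..T}. \<forall>x. z' \<tau> x = z \<tau> x))"
    if e: "0 < \<epsilon>" "\<epsilon> \<le> \<epsilon>0" for \<epsilon>
  proof -
    note g = \<epsilon>0(2)[OF e]
    have g1: "good_params l P Y1 \<epsilon> \<gamma>" by (rule good_params_mono[OF g]) (use gap0 in simp)
    have e1: "\<epsilon> \<le> 1" using g by (simp add: good_params_def)
    show ?thesis
    proof (rule zeta_modes_exist[OF l_pos less_imp_le[OF T] Psic Psip creg_mono[OF Psitc le0] a12 a' P(1) g1 R_def Y1_ge])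
    fix y assume y: "\<And>t k. t \<in> {0..T} \<Longrightarrow> \<bar>y t k\<bar> \<le> Y1 * wt k ^ 6" "\<And>k. y 0 k = 0"
      "\<And>t k. t \<in> {0..T} \<Longrightarrow> ((\<lambda>s. y s k) has_real_derivative
       (zforce l \<epsilon> (Psi t) (Psit t) (ser l (y t) 0) k / bsym l \<epsilon> k - rate l \<epsilon> k * y t k)) (at t within {0..T})"
    define z where "z t = ser l (y t) 0" for t
    have z: "zeta_solution l \<epsilon> T Psi Psit z"
      unfolding z_def
      by (rule zeta_solution_of_modes[OF l_pos T e(1) e1 Psic Psip creg_mono[OF Psitc le0] a12 a' y])
    have fz: "\<bar>fcoef l (z \<tau>) k\<bar> \<le> Y1 * wt k ^ 2" if "\<tau> \<in> {0..T}" for \<tau> k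
    proof -
      have y2: "\<bar>y \<tau> k\<bar> \<le> Y1 * wt k ^ 2" for k
        by (rule decay_mono[OF y(1)[OF that]]) simp
      thus ?thesis unfolding z_def by (simp add: fcoef_ser[OF l_pos y2])
    qed
    have "z' \<tau> x = z \<tau> x" if "zeta_solution l \<epsilon> T Psi Psit z'" "\<tau> \<in> {0..T}" for z' \<tau> x
      by (rule zeta_unique[OF T g P(1) Psic Psip Psitc Psitp a2 z that(1) fz order_refl that(2)])
    thus ?thesis using z by blast
    qed
  qed
  thus ?thesis using \<epsilon>0(1) by blast
qed

lemma ks_slope_time_deriv:
  assumes Psi: "\<And>\<tau>. 0 \<le> \<tau> \<Longrightarrow> Psi \<tau> = ser l (\<psi> \<tau>) 0"
    and d: "\<And>\<tau> k. 0 \<le> \<tau> \<Longrightarrow> ((\<lambda>s. \<psi> s k) has_real_derivative \<psi>' \<tau> k) (at \<tau> within {0..})"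
    and \<psi>': "\<And>k. continuous_on {0..} (\<lambda>\<tau>. \<psi>' \<tau> k)"
    and P: "\<And>T. \<exists>P\<ge>0. \<forall>\<tau>\<in>{0..T}. \<forall>k. \<bar>\<psi> \<tau> k\<bar> \<le> P * wt k ^ 12 \<and> \<bar>\<psi>' \<tau> k\<bar> \<le> P * wt k ^ 8"
  shows "time_deriv {0..} Psi (\<lambda>\<tau>. ser l (\<psi>' \<tau>) 0)"
proof (rule time_deriv_atLeast)
  fix T :: real assume T: "0 < T"
  obtain P where P: "P \<ge> 0" "\<And>\<tau> k. \<tau> \<in> {0..T} \<Longrightarrow> \<bar>\<psi> \<tau> k\<bar> \<le> P * wt k ^ 12" "\<And>\<tau> k. \<tau> \<in> {0..T} \<Longrightarrow> \<bar>\<psi>' \<tau> k\<bar> \<le> P * wt k ^ 8"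
    using P[of T] by blast
  have 1: "\<bar>\<psi> \<tau> k\<bar> \<le> P * wt k ^ (0 + 2)" if "\<tau> \<in> {0..T}" for \<tau> k
    by (rule decay_mono[OF P(2)[OF that]]) simp
  have 2: "\<bar>\<psi>' \<tau> k\<bar> \<le> P * wt k ^ (0 + 2)" if "\<tau> \<in> {0..T}" for \<tau> k
    by (rule decay_mono[OF P(3)[OF that]]) simp
  show "time_deriv {0..T} Psi (\<lambda>\<tau>. ser l (\<psi>' \<tau>) 0)"
    unfolding time_deriv_def
  proof (intro conjI ballI allI)
    fix \<tau> x assume \<tau>: "\<tau> \<in> {0..T}"
    have "((\<lambda>s. ser l (\<psi> s) 0 x) has_real_derivative ser l (\<psi>' \<tau>) 0 x) (at \<tau> within {0..T})"
    proof (rule ser_time_deriv[OF l_pos _ \<tau> _ 1 2])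
      show "((\<lambda>s. \<psi> s k) has_real_derivative \<psi>' \<tau> k) (at \<tau> within {0..T})" if "\<tau> \<in> {0..T}" for k \<tau>
        by (rule has_field_derivative_subset[OF d]) (use that in auto)
    qed auto
    thus "((\<lambda>s. Psi s x) has_real_derivative ser l (\<psi>' \<tau>) 0 x) (at \<tau> within {0..T})"
      by (rule has_field_derivative_transform_within[where d = 1]) (use \<tau> in \<open>auto simp: Psi\<close>)
  next
    show "continuous_on ({0..T} \<times> UNIV) (\<lambda>p. ser l (\<psi>' (fst p)) 0 (snd p))"
      by (rule ser_continuous2[OF l_pos 2 continuous_on_subset[OF \<psi>']]) auto
  qed
qed

end

theorem theorem5p7:
  shows "\<exists>m0::nat. \<forall>m\<ge>m0. \<forall>l Phi0 Phi.
    l > 4 * pi \<longrightarrow> Hsharp l m Phi0 \<longrightarrow> ks_solution l Phi0 Phi \<longrightarrow>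
    (let Psi = (\<lambda>\<tau>. pd 1 (Phi \<tau>)) in
     \<exists>Psit. time_deriv {0..} Psi Psit \<and>
       (\<forall>T>0. \<exists>\<epsilon>0>0. \<forall>\<epsilon>. 0 < \<epsilon> \<and> \<epsilon> \<le> \<epsilon>0 \<longrightarrow>
          (\<exists>z. zeta_solution l \<epsilon> T Psi Psit z \<and>
             (\<forall>z'. zeta_solution l \<epsilon> T Psi Psit z' \<longrightarrow>
                (\<forall>\<tau>\<in>{0..T}. \<forall>x. z' \<tau> x = z \<tau> x)))))"
proof (intro exI[of _ 13] allI impI)
  fix m l Phi0 Phi
  assume m: "13 \<le> m" and "4 * pi < l" and H: "Hsharp l m Phi0" and ks: "ks_solution l Phi0 Phi"
  hence l: "0 < l" using pi_gt_zero by linarith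
  obtain \<psi> \<psi>' where
    Psi: "\<And>\<tau>. 0 \<le> \<tau> \<Longrightarrow> pd (Suc 0) (Phi \<tau>) = ser l (\<psi> \<tau>) 0"
    and d: "\<And>\<tau> k. 0 \<le> \<tau> \<Longrightarrow> ((\<lambda>s. \<psi> s k) has_real_derivative \<psi>' \<tau> k) (at \<tau> within {0..})"
    and \<psi>': "\<And>k. continuous_on {0..} (\<lambda>\<tau>. \<psi>' \<tau> k)"
    and P: "\<And>T. \<exists>P\<ge>0. \<forall>\<tau>\<in>{0..T}. \<forall>k. \<bar>\<psi> \<tau> k\<bar> \<le> P * wt k ^ 12 \<and> \<bar>\<psi>' \<tau> k\<bar> \<le> P * wt k ^ 8"
    by (rule ks_regularity[OF l ks H m]) blast
  have \<psi>: "continuous_on {0..} (\<lambda>\<tau>. \<psi> \<tau> k)" for k by (rule DERIV_continuous_on[OF d]) simp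
  \<comment> \<open>The time derivative of \<open>\<Psi>\<close> is built as the series of
    differentiated coefficients, since a classical solution \<open>\<Phi>\<close> comes without a
    mixed derivative.\<close>
  let ?Psi = "\<lambda>\<tau>. pd 1 (Phi \<tau>)" and ?Psit = "\<lambda>\<tau>. ser l (\<psi>' \<tau>) 0"
  have Psi1: "\<And>\<tau>. 0 \<le> \<tau> \<Longrightarrow> ?Psi \<tau> = ser l (\<psi> \<tau>) 0" using Psi by simp
  have "time_deriv {0..} ?Psi ?Psit" by (rule ks_slope_time_deriv[OF l Psi1 d \<psi>' P])
  moreover have "\<exists>\<epsilon>0>0. \<forall>\<epsilon>. 0 < \<epsilon> \<and> \<epsilon> \<le> \<epsilon>0 \<longrightarrow>
          (\<exists>z. zeta_solution l \<epsilon> T ?Psi ?Psit z \<and>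
             (\<forall>z'. zeta_solution l \<epsilon> T ?Psi ?Psit z' \<longrightarrow> (\<forall>\<tau>\<in>{0..T}. \<forall>x. z' \<tau> x = z \<tau> x)))" if T: "0 < T" for T
  proof -
    obtain P where "P \<ge> 0" "\<And>\<tau> k. \<tau> \<in> {0..T} \<Longrightarrow> \<bar>\<psi> \<tau> k\<bar> \<le> P * wt k ^ 12" "\<And>\<tau> k. \<tau> \<in> {0..T} \<Longrightarrow> \<bar>\<psi>' \<tau> k\<bar> \<le> P * wt k ^ 8"
      using P[of T] by blast
    from zeta_well_posed[OF l T Psi1 \<psi> \<psi>' this] show ?thesis .
  qed
  ultimately show "let Psi = ?Psi in \<exists>Psit. time_deriv {0..} Psi Psit \<and>
       (\<forall>T>0. \<exists>\<epsilon>0>0. \<forall>\<epsilon>. 0 < \<epsilon> \<and> \<epsilon> \<le> \<epsilon>0 \<longrightarrow>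
          (\<exists>z. zeta_solution l \<epsilon> T Psi Psit z \<and>
             (\<forall>z'. zeta_solution l \<epsilon> T Psi Psit z' \<longrightarrow> (\<forall>\<tau>\<in>{0..T}. \<forall>x. z' \<tau> x = z \<tau> x))))"
    unfolding Let_def by blast
qed

end
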